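(* Let $d\geq 2$ be a constant and $p$ a positive integer constant. Let $A=a_1\circ\cdots\circ a_n$ be a stream of $n$ rows $a_i\in\mathbb{R}^{1\times d}$ with $\|a_i\|_2=O(1)$. There is a one-pass streaming algorithm which maintains a data structure $Q$ of $O(\varepsilon^{-\frac{2(d-1)}{d+2p-1}})$ words of space such that for each fixed $x\in\mathbb{S}^{d-1}$, with probability at least $9/10$, \[ \left|Q(x)-\frac{1}{n}\|Ax\|_p^p\right| = O(\varepsilon). \] Moreover, the algorithm updates $Q$ in $O(1)$ time per row and can be implemented in $O(\varepsilon^{-\frac{2(d-1)}{d+2p-1}})$ words of space.
   Context: $A$ is the matrix with rows $a_1,\dots,a_n$; $\|Ax\|_p^p=\sum_i|\langle a_i,x\rangle|^p$; $\mathbb{S}^{d-1}$ is the unit sphere. *)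

theory Defs
  imports "HOL-Probability.Probability"
begin

text \<open>
  A randomised word RAM.  Memory is an array of \<open>s\<close> words, each an integer of absolute value
  below \<open>2 ^ w\<close> (\<open>w\<close> bits and a sign).  Both bounds are enforced by the semantics: a computation
  that forms a larger value or uses an address outside \<open>{0..<s}\<close> faults.  Words are kept
  finite because in a real RAM a single register could store an entire (truncated) stream, which
  would make every space bound void.  Real inputs are therefore accessible only through words:
  \<open>Input i e\<close> is the \<open>i\<close>-th input coordinate, multiplied by the word \<open>e\<close> and rounded
  down to an integer, so a program chooses its own fixed-point precision, limited by the word
  length.
\<close>

datatype 'i exp =
    Num int
  | Mem "'i exp"
  | Input 'i "'i exp"
  | Plus "'i exp" "'i exp"
  | Minus "'i exp" "'i exp"
  | Times "'i exp" "'i exp"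
  | Div "'i exp" "'i exp"

type_synonym mem = "nat \<Rightarrow> int"

definition word :: "nat \<Rightarrow> int \<Rightarrow> int option" where
  "word w v = (if \<bar>v\<bar> < 2 ^ w then Some v else None)"

definition address :: "nat \<Rightarrow> int \<Rightarrow> nat option" where
  "address s v = (if 0 \<le> v \<and> v < int s then Some (nat v) else None)"

text \<open>\<open>None\<close> is a fault; every intermediate result has to fit in a word.\<close>

primrec eval :: "nat \<Rightarrow> nat \<Rightarrow> ('i \<Rightarrow> real) \<Rightarrow> mem \<Rightarrow> 'i exp \<Rightarrow> int option" where
  "eval w s inp m (Num k) = word w k"
| "eval w s inp m (Mem e) =
     Option.bind (Option.bind (eval w s inp m e) (address s)) (\<lambda>j. Some (m j))"
| "eval w s inp m (Input i e) =
     Option.bind (eval w s inp m e) (\<lambda>k. word w \<lfloor>of_int k * inp i\<rfloor>)"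
| "eval w s inp m (Plus a b) =
     Option.bind (eval w s inp m a) (\<lambda>x. Option.bind (eval w s inp m b) (\<lambda>y. word w (x + y)))"
| "eval w s inp m (Minus a b) =
     Option.bind (eval w s inp m a) (\<lambda>x. Option.bind (eval w s inp m b) (\<lambda>y. word w (x - y)))"
| "eval w s inp m (Times a b) =
     Option.bind (eval w s inp m a) (\<lambda>x. Option.bind (eval w s inp m b) (\<lambda>y. word w (x * y)))"
| "eval w s inp m (Div a b) =
     Option.bind (eval w s inp m a) (\<lambda>x. Option.bind (eval w s inp m b)
       (\<lambda>y. if y = 0 then None else word w (x div y)))"

text \<open>
  \<open>Store a e\<close> writes \<open>e\<close> to address \<open>a\<close>; \<open>Draw a e\<close> writes to address \<open>a\<close> a fresh uniformly
  random element of \<open>{0..<e}\<close>; \<open>Cond\<close> and \<open>While\<close> test whether an expression is positive.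
\<close>

datatype 'i com =
    Skip
  | Store "'i exp" "'i exp"
  | Draw "'i exp" "'i exp"
  | Seq "'i com" "'i com"
  | Cond "'i exp" "'i com" "'i com"
  | While "'i exp" "'i com"

primrec draw_free :: "'i com \<Rightarrow> bool" where
  "draw_free Skip = True"
| "draw_free (Store a e) = True"
| "draw_free (Draw a e) = False"
| "draw_free (Seq c1 c2) = (draw_free c1 \<and> draw_free c2)"
| "draw_free (Cond e c1 c2) = (draw_free c1 \<and> draw_free c2)"
| "draw_free (While e c) = draw_free c"

text \<open>
  A configuration is the list of commands still to be executed together with the memory, or
  \<open>None\<close> after a fault.  Each step takes one unit of time: expressions are part of the program
  text, which never depends on the stream, the accuracy or the word length, so evaluating
  one takes a constant number of word operations.
\<close>

type_synonym 'i config = "('i com list \<times> mem) option"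

fun step_com :: "nat \<Rightarrow> nat \<Rightarrow> ('i \<Rightarrow> real) \<Rightarrow> 'i com \<Rightarrow> 'i com list \<Rightarrow> mem \<Rightarrow> 'i config pmf" where
  "step_com w s inp Skip cs m = return_pmf (Some (cs, m))"
| "step_com w s inp (Store a e) cs m = return_pmf
     (Option.bind (Option.bind (eval w s inp m a) (address s)) (\<lambda>j.
      Option.bind (eval w s inp m e) (\<lambda>v. Some (cs, m(j := v)))))"
| "step_com w s inp (Draw a e) cs m =
     (case (Option.bind (eval w s inp m a) (address s), eval w s inp m e) of
        (Some j, Some b) \<Rightarrow>
          if 0 < b then map_pmf (\<lambda>v. Some (cs, m(j := v))) (pmf_of_set {0..<b})
          else return_pmf None
      | _ \<Rightarrow> return_pmf None)"
| "step_com w s inp (Seq c1 c2) cs m = return_pmf (Some (c1 # c2 # cs, m))"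
| "step_com w s inp (Cond e c1 c2) cs m = return_pmf
     (Option.bind (eval w s inp m e) (\<lambda>v. Some ((if 0 < v then c1 else c2) # cs, m)))"
| "step_com w s inp (While e c) cs m = return_pmf
     (Option.bind (eval w s inp m e) (\<lambda>v. Some (if 0 < v then c # While e c # cs else cs, m)))"

definition step :: "nat \<Rightarrow> nat \<Rightarrow> ('i \<Rightarrow> real) \<Rightarrow> 'i config \<Rightarrow> 'i config pmf" where
  "step w s inp cf =
     (case cf of Some (c # cs, m) \<Rightarrow> step_com w s inp c cs m | _ \<Rightarrow> return_pmf cf)"

primrec run :: "nat \<Rightarrow> nat \<Rightarrow> ('i \<Rightarrow> real) \<Rightarrow> nat \<Rightarrow> 'i config \<Rightarrow> 'i config pmf" where
  "run w s inp 0 cf = return_pmf cf"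
| "run w s inp (Suc t) cf = bind_pmf (step w s inp cf) (run w s inp t)"

text \<open>Fault-free termination within \<open>t\<close> steps for all random outcomes.\<close>

definition halts_within ::
  "nat \<Rightarrow> nat \<Rightarrow> ('i \<Rightarrow> real) \<Rightarrow> 'i com \<Rightarrow> mem \<Rightarrow> nat \<Rightarrow> bool" where
  "halts_within w s inp c m t \<longleftrightarrow>
     (\<forall>cf \<in> set_pmf (run w s inp t (Some ([c], m))). \<exists>m'. cf = Some ([], m'))"

text \<open>
  Distribution of the final memory; only meaningful if the program halts.  Halted configurations
  are fixed by \<open>step\<close>, so every sufficiently large number of steps gives the same result.
\<close>

definition exec :: "nat \<Rightarrow> nat \<Rightarrow> ('i \<Rightarrow> real) \<Rightarrow> 'i com \<Rightarrow> mem \<Rightarrow> mem option pmf" where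
  "exec w s inp c m =
     map_pmf (\<lambda>cf. case cf of Some ([], m') \<Rightarrow> Some m' | _ \<Rightarrow> None)
       (run w s inp (LEAST t. halts_within w s inp c m t) (Some ([c], m)))"

definition bind_exec :: "mem option pmf \<Rightarrow> (mem \<Rightarrow> mem option pmf) \<Rightarrow> mem option pmf" where
  "bind_exec M f = bind_pmf M (\<lambda>r. case r of None \<Rightarrow> return_pmf None | Some m \<Rightarrow> f m)"

text \<open>
  The data structure after one pass over the rows \<open>as\<close>: the initialisation program sees only
  the accuracy \<open>\<epsilon>\<close>, each run of the update program only the current row and the memory.
\<close>

definition stream_state ::
  "nat \<Rightarrow> nat \<Rightarrow> real \<Rightarrow> unit com \<Rightarrow> 'd com \<Rightarrow> (real ^ 'd) list \<Rightarrow> mem option pmf" where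
  "stream_state w s \<epsilon> init upd as =
     foldl (\<lambda>M a. bind_exec M (exec w s (\<lambda>i. a $ i) upd))
       (exec w s (\<lambda>_. \<epsilon>) init (\<lambda>_. 0)) as"

text \<open>A query leaves its answer, a fraction of two words, at addresses 0 and 1.\<close>

definition answer :: "mem \<Rightarrow> real" where
  "answer m = of_int (m 0) / of_int (m 1)"

definition query_result ::
  "nat \<Rightarrow> nat \<Rightarrow> mem option pmf \<Rightarrow> 'd com \<Rightarrow> real ^ 'd \<Rightarrow> real option pmf" where
  "query_result w s M qry x =
     map_pmf (map_option answer) (bind_exec M (exec w s (\<lambda>i. x $ i) qry))"

definition lp_pow :: "nat \<Rightarrow> (real ^ 'd) list \<Rightarrow> real ^ 'd \<Rightarrow> real" where
  "lp_pow p as x = (\<Sum>a\<leftarrow>as. \<bar>inner a x\<bar> ^ p)"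

end

theory Submission
  imports Defs
begin

text \<open>
  Cut the directions into \<open>C \<approx> k\<^sup>d\<^sup>-\<^sup>1\<close> cones of width about \<open>1/k\<close> and keep, for each cone, the sum of
  the \<open>p\<close>-th tensor powers of the rows in it. If all rows \<open>a\<close> of a cone have \<open>\<langle>a,x\<rangle>\<close> of the same
  sign, then \<open>\<bar>\<Sum>\<langle>a,x\<rangle>\<^sup>p\<bar>\<close> is exactly their contribution. For a row of a cone that is cut by the
  hyperplane orthogonal to \<open>x\<close>, the missing correction is at most \<open>2 \<bar>\<langle>a,x\<rangle>\<bar>\<^sup>p = O(k\<^sup>-\<^sup>p)\<close>; the sum of the
  corrections is estimated from \<open>C\<close> samples. Slot \<open>c\<close> keeps a uniformly random row among those
  at positions congruent to \<open>c\<close> modulo \<open>C\<close>, which costs one random draw per row. The error of the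
  estimate is a martingale with second moment at most \<open>n\<^sup>2 O(k\<^sup>-\<^sup>2\<^sup>p) / (2 C) = n\<^sup>2 O(k\<^sup>-\<^sup>(\<^sup>d\<^sup>+\<^sup>2\<^sup>p\<^sup>-\<^sup>1\<^sup>))\<close>, so
  that \<open>k\<^sup>d\<^sup>+\<^sup>2\<^sup>p\<^sup>-\<^sup>1 \<approx> \<epsilon>\<^sup>-\<^sup>2\<close> and Chebyshev's inequality give the claim. All computations are exact on
  rows and queries rounded to multiples of \<open>1/D\<close> with \<open>D \<approx> 1/\<epsilon>\<close>.
\<close>

section \<open>Exact evaluation and running times\<close>

text \<open>One sample per cone would not do: a single cut cone may contain all rows, and its sample
  would have an error with second moment of order n^2 k^(-2p), without the factor 1/C. Positions
  modulo C split every stream into slots of nearly equal size, and a new row concerns one slot only,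
  whereas C reservoirs over the whole stream would cost C draws per row. The sign of a cone is that
  of its final moment, so the correction to be averaged depends on the whole stream and on x. This
  does no harm because the draws select positions without looking at the rows: the second moment
  bound holds for every fixed function on rows, in particular for one chosen after the pass. Running
  time and faults have to be controlled for all random outcomes. The update is therefore free of
  loops and branches, its choices being made inside arithmetic expressions. Overflow is excluded by
  one bound X on all memory cells, polynomial in n and 1/\<epsilon>.\<close>

primrec ev :: "('i \<Rightarrow> real) \<Rightarrow> mem \<Rightarrow> 'i exp \<Rightarrow> int" where
  "ev inp m (Num k) = k"
| "ev inp m (Mem e) = m (nat (ev inp m e))"
| "ev inp m (Input i e) = \<lfloor>of_int (ev inp m e) * inp i\<rfloor>"
| "ev inp m (Plus a b) = ev inp m a + ev inp m b"
| "ev inp m (Minus a b) = ev inp m a - ev inp m b"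
| "ev inp m (Times a b) = ev inp m a * ev inp m b"
| "ev inp m (Div a b) = ev inp m a div ev inp m b"

text \<open>The faults other than overflow. \<open>ev\<close> is total and returns a meaningless
  value where \<open>ok\<close> fails.\<close>

primrec ok :: "nat \<Rightarrow> ('i \<Rightarrow> real) \<Rightarrow> mem \<Rightarrow> 'i exp \<Rightarrow> bool" where
  "ok s inp m (Num k) = True"
| "ok s inp m (Mem e) = (ok s inp m e \<and> 0 \<le> ev inp m e \<and> ev inp m e < int s)"
| "ok s inp m (Input i e) = ok s inp m e"
| "ok s inp m (Plus a b) = (ok s inp m a \<and> ok s inp m b)"
| "ok s inp m (Minus a b) = (ok s inp m a \<and> ok s inp m b)"
| "ok s inp m (Times a b) = (ok s inp m a \<and> ok s inp m b)"
| "ok s inp m (Div a b) = (ok s inp m a \<and> ok s inp m b \<and> ev inp m b \<noteq> 0)"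

text \<open>If memory and inputs are bounded by \<open>X\<close>, every intermediate value of \<open>e\<close> is bounded by
  \<open>X ^ deg e\<close>, so overflows are excluded by one inequality between \<open>X\<close> and the word length.\<close>

primrec deg :: "'i exp \<Rightarrow> nat" where
  "deg (Num k) = nat \<bar>k\<bar> + 1"
| "deg (Mem e) = deg e + 1"
| "deg (Input i e) = deg e + 2"
| "deg (Plus a b) = deg a + deg b"
| "deg (Minus a b) = deg a + deg b"
| "deg (Times a b) = deg a + deg b"
| "deg (Div a b) = deg a + deg b"

primrec com_deg :: "'i com \<Rightarrow> nat" where
  "com_deg Skip = 0"
| "com_deg (Store a e) = deg a + deg e"
| "com_deg (Draw a e) = deg a + deg e"
| "com_deg (Seq c1 c2) = com_deg c1 + com_deg c2"
| "com_deg (Cond e c1 c2) = deg e + com_deg c1 + com_deg c2"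
| "com_deg (While e c) = deg e + com_deg c"

text \<open>Only meaningful for programs without \<open>Cond\<close> and \<open>While\<close>.\<close>

primrec straight_time :: "'i com \<Rightarrow> nat" where
  "straight_time Skip = 1"
| "straight_time (Store a e) = 1"
| "straight_time (Draw a e) = 1"
| "straight_time (Seq c1 c2) = 1 + straight_time c1 + straight_time c2"
| "straight_time (Cond e c1 c2) = 0"
| "straight_time (While e c) = 0"

lemma deg_pos: "0 < deg e"
  by (induction e) auto

text \<open>A sum of two numbers that are at least 2 is at most their product. This is why
  \<open>deg\<close> can treat addition like multiplication.\<close>

lemma add_power_le_power_add:
  fixes X :: int
  assumes "2 \<le> X" "0 < a" "0 < b"
  shows "X ^ a + X ^ b \<le> X ^ (a + b)"
proof -
  have "2 \<le> X ^ a" "2 \<le> X ^ b"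
    using assms by (metis order_trans self_le_power one_le_numeral)+
  then have "0 \<le> (X ^ a - 2) * X ^ b + (X ^ b - 2) * X ^ a"
    by (intro add_nonneg_nonneg mult_nonneg_nonneg) auto
  then show ?thesis by (simp add: power_add algebra_simps)
qed

text \<open>For a positive divisor the quotient lies between 0 and \<open>x\<close>, or, as division
  rounds down, between \<open>x\<close> and -1 if \<open>x\<close> is negative. For a negative
  divisor both signs are changed.\<close>

lemma abs_div_le_abs: "\<bar>x div y\<bar> \<le> \<bar>x\<bar>" for x y :: int
proof -
  have *: "\<bar>z div q\<bar> \<le> \<bar>z\<bar>" if "q > 0" for z q :: int
  proof (cases "0 \<le> z")
    case True
    then show ?thesis using that
      by (simp add: pos_imp_zdiv_nonneg_iff) (metis div_by_1 zdiv_mono2 int_one_le_iff_zero_less zero_less_one)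
  next
    case False
    then have "z div q < 0" using that by (simp add: pos_imp_zdiv_neg_iff)
    moreover have "z \<le> z div q" using False that
      by (metis div_by_1 zdiv_mono2_neg int_one_le_iff_zero_less linorder_not_le zero_less_one)
    ultimately show ?thesis using False by simp
  qed
  consider "y = 0" | "y > 0" | "- y > 0" by linarith
  then show ?thesis
    using *[of y x] *[of "- y" "- x"] by cases simp_all
qed

section \<open>Runs without faults\<close>

locale ram =
  fixes w s :: nat and X :: int and G :: nat and inp :: "'i \<Rightarrow> real"
  assumes X_ge: "2 \<le> X" and X_fits: "X ^ G < 2 ^ w" and inp_le: "\<And>i. \<bar>inp i\<bar> \<le> of_int X"
begin

definition bnd :: "mem \<Rightarrow> bool" where
  "bnd m \<longleftrightarrow> (\<forall>j. \<bar>m j\<bar> \<le> X)"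

lemma abs_ev_le:
  assumes "bnd m"
  shows "\<bar>ev inp m e\<bar> \<le> X ^ deg e"
proof (induction e)
  case (Num k)
  have "\<bar>k\<bar> < 2 ^ nat \<bar>k\<bar>"
    by (metis of_nat_less_two_power zero_le_numeral abs_ge_zero nat_0_le of_nat_less_numeral_power_cancel_iff less_exp)
  also have "\<dots> \<le> X ^ nat \<bar>k\<bar>" using X_ge by (intro power_mono) auto
  also have "\<dots> \<le> X ^ (nat \<bar>k\<bar> + 1)" using X_ge by (intro power_increasing) auto
  finally show ?case by simp
next
  case (Mem e)
  have "\<bar>m (nat (ev inp m e))\<bar> \<le> X" using assms by (simp add: bnd_def)
  also have "\<dots> \<le> X ^ (deg e + 1)" using X_ge by (intro self_le_power) auto
  finally show ?case by simp
next
  case (Input i e)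
  let ?r = "of_int (ev inp m e) * inp i"
  have "\<bar>?r\<bar> \<le> of_int (X ^ deg e) * of_int X"
    unfolding abs_mult using Input X_ge
    by (intro mult_mono inp_le) (metis of_int_abs of_int_le_iff, auto)
  also have "\<dots> = of_int (X ^ (deg e + 1))" by simp
  finally have r: "\<bar>?r\<bar> \<le> of_int (X ^ (deg e + 1))" .
  have "?r \<le> of_int (X ^ (deg e + 1))" "- of_int (X ^ (deg e + 1)) \<le> ?r"
    using r by linarith+
  \<comment> \<open>The bounds are integers, so rounding down cannot leave the interval.\<close>
  then have "\<bar>\<lfloor>?r\<rfloor>\<bar> \<le> X ^ (deg e + 1)"
    by (simp add: abs_le_iff floor_le_iff le_floor_iff minus_le_iff)
  also have "\<dots> \<le> X ^ (deg e + 2)" using X_ge by (intro power_increasing) auto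
  finally show ?case by simp
next
  case (Plus a b)
  then show ?case using add_power_le_power_add[OF X_ge deg_pos[of a] deg_pos[of b]] by simp
next
  case (Minus a b)
  then show ?case using add_power_le_power_add[OF X_ge deg_pos[of a] deg_pos[of b]] by simp
next
  case (Times a b)
  then show ?case using X_ge by (auto simp: abs_mult power_add intro!: mult_mono)
next
  case (Div a b)
  have "\<bar>ev inp m a div ev inp m b\<bar> \<le> \<bar>ev inp m a\<bar>" by (rule abs_div_le_abs)
  also have "\<dots> \<le> X ^ deg a" by (rule Div)
  also have "\<dots> \<le> X ^ (deg a + deg b)" using X_ge by (intro power_increasing) auto
  finally show ?case by simp
qed

lemma word_ev:
  assumes "bnd m" "deg e \<le> G"
  shows "word w (ev inp m e) = Some (ev inp m e)"
proof -
  have "X ^ deg e \<le> X ^ G" using assms X_ge by (intro power_increasing) auto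
  with abs_ev_le[OF assms(1), of e] X_fits show ?thesis by (simp add: word_def)
qed

text \<open>Subexpressions never have larger degree, so the budget \<open>G\<close> covers all
  intermediate results and only \<open>ok\<close> has to be checked.\<close>

lemma eval_ev:
  assumes "bnd m" "ok s inp m e" "deg e \<le> G"
  shows "eval w s inp m e = Some (ev inp m e)"
  using assms(2,3)
proof (induction e)
  case (Mem e)
  then show ?case by (simp add: address_def)
next
  case (Num k)
  then show ?case using word_ev[OF assms(1), of "Num k"] by simp
next
  case (Input i e)
  then show ?case using word_ev[OF assms(1), of "Input i e"] by simp
next
  case (Plus a b)
  then show ?case using word_ev[OF assms(1), of "Plus a b"] by simp
next
  case (Minus a b)
  then show ?case using word_ev[OF assms(1), of "Minus a b"] by simp
next
  case (Times a b)
  then show ?case using word_ev[OF assms(1), of "Times a b"] by simp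
next
  case (Div a b)
  then show ?case using word_ev[OF assms(1), of "Div a b"] by simp
qed

text \<open>All continuations \<open>cs\<close> are included so that runs can be composed. One exact
  time \<open>t\<close> has to serve every random outcome, which holds for code that makes its
  choices inside expressions.\<close>

definition bigstep :: "'i com \<Rightarrow> mem \<Rightarrow> mem pmf \<Rightarrow> nat \<Rightarrow> bool" where
  "bigstep c m M t \<longleftrightarrow>
     (\<forall>cs. run w s inp t (Some (c # cs, m)) = map_pmf (\<lambda>m'. Some (cs, m')) M)"

lemma run_add: "run w s inp (t + u) cf = bind_pmf (run w s inp t cf) (run w s inp u)"
proof (induction t arbitrary: cf)
  case (Suc t)
  have "run w s inp (Suc t + u) cf = bind_pmf (step w s inp cf) (run w s inp (t + u))" by simp
  also have "\<dots> = bind_pmf (step w s inp cf) (\<lambda>x. bind_pmf (run w s inp t x) (run w s inp u))"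
    by (intro bind_pmf_cong refl Suc)
  finally show ?case by (simp add: bind_assoc_pmf)
qed (simp add: bind_return_pmf)

lemma bigstep_Skip: "bigstep Skip m (return_pmf m) 1"
  by (simp add: bigstep_def step_def bind_return_pmf)

lemma bigstep_Store:
  assumes "bnd m" "ok s inp m a" "ok s inp m e" "deg a + deg e \<le> G"
    and "ev inp m a = int j" "j < s"
  shows "bigstep (Store a e) m (return_pmf (m(j := ev inp m e))) 1"
  using assms by (simp add: bigstep_def step_def bind_return_pmf eval_ev address_def)

lemma bigstep_Draw:
  assumes "bnd m" "ok s inp m a" "ok s inp m e" "deg a + deg e \<le> G"
    and "ev inp m a = int j" "j < s" "0 < ev inp m e"
  shows "bigstep (Draw a e) m (map_pmf (\<lambda>v. m(j := v)) (pmf_of_set {0..<ev inp m e})) 1"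
proof -
  have run0: "run w s inp 0 = return_pmf" by (simp add: fun_eq_iff)
  show ?thesis using assms
    by (simp add: bigstep_def step_def eval_ev address_def map_pmf_comp run0 bind_return_pmf'
        del: run.simps(1))
qed

lemma bigstep_Seq:
  assumes "bigstep c1 m M t1" "\<And>m'. m' \<in> set_pmf M \<Longrightarrow> bigstep c2 m' (F m') t2"
  shows "bigstep (Seq c1 c2) m (bind_pmf M F) (1 + t1 + t2)"
  unfolding bigstep_def
proof
  fix cs
  have "run w s inp (1 + t1 + t2) (Some (Seq c1 c2 # cs, m))
      = bind_pmf (map_pmf (\<lambda>m'. Some (c2 # cs, m')) M) (run w s inp t2)"
    using assms(1) by (simp add: step_def bind_return_pmf run_add bigstep_def)
  also have "\<dots> = bind_pmf M (\<lambda>m'. run w s inp t2 (Some (c2 # cs, m')))"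
    by (simp add: bind_map_pmf)
  also have "\<dots> = bind_pmf M (\<lambda>m'. map_pmf (\<lambda>m'. Some (cs, m')) (F m'))"
    using assms(2) by (intro bind_pmf_cong) (auto simp: bigstep_def)
  finally show "run w s inp (1 + t1 + t2) (Some (Seq c1 c2 # cs, m))
      = map_pmf (\<lambda>m'. Some (cs, m')) (bind_pmf M F)"
    by (simp add: map_bind_pmf)
qed

lemma bigstep_Seq_det:
  assumes "bigstep c1 m (return_pmf m') t1" "bigstep c2 m' M t2"
  shows "bigstep (Seq c1 c2) m M (1 + t1 + t2)"
  using bigstep_Seq[OF assms(1), of c2 "\<lambda>_. M" t2] assms(2)
  by (simp add: bind_return_pmf)

lemma bigstep_While_False:
  assumes "bnd m" "ok s inp m e" "deg e \<le> G" "ev inp m e \<le> 0"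
  shows "bigstep (While e c) m (return_pmf m) 1"
  using assms by (simp add: bigstep_def step_def bind_return_pmf eval_ev)

lemma bigstep_While_True:
  assumes "bnd m" "ok s inp m e" "deg e \<le> G" "0 < ev inp m e"
    and "bigstep c m (return_pmf m') t" "bigstep (While e c) m' M u"
  shows "bigstep (While e c) m M (1 + t + u)"
  using assms by (simp add: bigstep_def step_def bind_return_pmf eval_ev run_add)

text \<open>Loops occur only in the initialisation and in the query, neither of which draws, so a
  rule for deterministic bodies with a decreasing measure \<open>f\<close> suffices. Of their
  running time only existence is claimed.\<close>

lemma bigstep_While:
  assumes "Inv m" "\<And>m. Inv m \<Longrightarrow> bnd m \<and> ok s inp m e" "deg e \<le> G"
    and "\<And>m. Inv m \<Longrightarrow> 0 < ev inp m e \<Longrightarrow>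
      \<exists>m' t. bigstep c m (return_pmf m') t \<and> Inv m' \<and> (f m' :: nat) < f m"
  shows "\<exists>m' t. bigstep (While e c) m (return_pmf m') t \<and> Inv m' \<and> ev inp m' e \<le> 0"
  using assms(1)
proof (induction "f m" arbitrary: m rule: less_induct)
  case less
  show ?case
  proof (cases "0 < ev inp m e")
    case True
    with less assms(4) obtain m' t
      where *: "bigstep c m (return_pmf m') t" "Inv m'" "f m' < f m" by metis
    with less obtain m'' u
      where "bigstep (While e c) m' (return_pmf m'') u" "Inv m''" "ev inp m'' e \<le> 0" by metis
    with * True less assms(2,3) bigstep_While_True show ?thesis by metis
  next
    case False
    with less assms(2,3) bigstep_While_False show ?thesis
      by (meson linorder_not_less)
  qed
qed

lemma run_halted:
  assumes "\<forall>cf \<in> set_pmf M. \<exists>m. cf = Some ([], m)"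
  shows "bind_pmf M (run w s inp u) = M"
proof -
  have "run w s inp u (Some ([], m)) = return_pmf (Some ([], m))" for m
    by (induction u) (simp_all add: step_def bind_return_pmf)
  then have "bind_pmf M (run w s inp u) = bind_pmf M return_pmf"
    using assms by (intro bind_pmf_cong) auto
  then show ?thesis by (simp add: bind_return_pmf')
qed

lemma bigstep_halts: "bigstep c m M t \<Longrightarrow> halts_within w s inp c m t"
  by (auto simp: bigstep_def halts_within_def)

text \<open>\<open>exec\<close> stops at the least halting time, which may be below
  \<open>t\<close>; halted configurations no longer change, so both times give the same
  result.\<close>

lemma bigstep_exec:
  assumes "bigstep c m M t"
  shows "exec w s inp c m = map_pmf Some M"
proof -
  let ?t = "LEAST t. halts_within w s inp c m t"
  have h: "halts_within w s inp c m ?t" and le: "?t \<le> t"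
    using bigstep_halts[OF assms] by (auto intro: LeastI Least_le)
  have "run w s inp t (Some ([c], m)) = run w s inp ?t (Some ([c], m))"
    using run_halted[of "run w s inp ?t (Some ([c], m))" "t - ?t"] h run_add[of ?t "t - ?t"] le
    by (auto simp: halts_within_def)
  with assms have "run w s inp ?t (Some ([c], m)) = map_pmf (\<lambda>m'. Some ([], m')) M"
    by (simp add: bigstep_def)
  then show ?thesis by (simp add: exec_def map_pmf_comp)
qed

end

section \<open>Branch-free expressions\<close>

text \<open>The language has no comparison operator, but \<open>y div (y * y + 1)\<close> is \<open>-1\<close> for negative
  \<open>y\<close> and \<open>0\<close> otherwise.\<close>

definition neg_exp :: "'i exp \<Rightarrow> 'i exp" where
  "neg_exp e = Minus (Num 0) (Div e (Plus (Times e e) (Num 1)))"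

definition sgn_exp :: "'i exp \<Rightarrow> 'i exp" where
  "sgn_exp e = Minus (Num 1) (Times (Num 2) (neg_exp e))"

definition abs_exp :: "'i exp \<Rightarrow> 'i exp" where
  "abs_exp e = Times (sgn_exp e) e"

text \<open>Selection by arithmetic: both alternatives are always evaluated, so both have to be free
  of faults.\<close>

definition if_neg_exp :: "'i exp \<Rightarrow> 'i exp \<Rightarrow> 'i exp \<Rightarrow> 'i exp" where
  "if_neg_exp e a b = Plus b (Times (neg_exp e) (Minus a b))"

definition max_exp :: "'i exp \<Rightarrow> 'i exp \<Rightarrow> 'i exp" where
  "max_exp a b = if_neg_exp (Minus a b) b a"

definition sum_exp :: "'i exp list \<Rightarrow> 'i exp" where
  "sum_exp es = foldr Plus es (Num 0)"

definition prod_exp :: "'i exp list \<Rightarrow> 'i exp" where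
  "prod_exp es = foldr Times es (Num 1)"

definition power_exp :: "'i exp \<Rightarrow> nat \<Rightarrow> 'i exp" where
  "power_exp e n = prod_exp (replicate n e)"

text \<open>The divisor exceeds \<open>\<bar>y\<bar>\<close>, so the rounded quotient can only be 0
  or -1.\<close>

lemma div_square_plus_one: "y div (y * y + 1) = (if y < 0 then - 1 else 0)" for y :: int
proof (cases "y < 0")
  case True
  have "y div (y * y + 1) = - 1"
  proof (rule int_div_pos_eq[where r = "y + (y * y + 1)"])
    have "1 * (- y) \<le> (- y) * (- y)" using True by (intro mult_right_mono) auto
    then show "0 \<le> y + (y * y + 1)" by simp
  qed (use True in auto)
  with True show ?thesis by simp
next
  case False
  have "y < y * y + 1"
    using False mult_left_mono[of 1 y y] by (cases "y = 0") auto
  with False show ?thesis by (simp add: div_pos_pos_trivial)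
qed

lemma square_plus_one_neq: "y * y + 1 \<noteq> (0 :: int)"
  by (smt (verit) zero_le_square)

lemma ev_neg_exp [simp]: "ev inp m (neg_exp e) = (if ev inp m e < 0 then 1 else 0)"
  by (simp add: neg_exp_def div_square_plus_one)

lemma ok_neg_exp [simp]: "ok s inp m (neg_exp e) = ok s inp m e"
  by (simp add: neg_exp_def square_plus_one_neq)

lemma ev_sgn_exp [simp]: "ev inp m (sgn_exp e) = (if ev inp m e < 0 then - 1 else 1)"
  by (simp add: sgn_exp_def)

lemma ok_sgn_exp [simp]: "ok s inp m (sgn_exp e) = ok s inp m e"
  by (simp add: sgn_exp_def)

lemma ev_abs_exp [simp]: "ev inp m (abs_exp e) = \<bar>ev inp m e\<bar>"
  by (simp add: abs_exp_def)

lemma ok_abs_exp [simp]: "ok s inp m (abs_exp e) = ok s inp m e"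
  by (simp add: abs_exp_def)

lemma ev_if_neg_exp [simp]:
  "ev inp m (if_neg_exp e a b) = (if ev inp m e < 0 then ev inp m a else ev inp m b)"
  by (simp add: if_neg_exp_def)

lemma ok_if_neg_exp [simp]:
  "ok s inp m (if_neg_exp e a b) = (ok s inp m e \<and> ok s inp m a \<and> ok s inp m b)"
  by (auto simp: if_neg_exp_def)

lemma ev_max_exp [simp]: "ev inp m (max_exp a b) = max (ev inp m a) (ev inp m b)"
  by (simp add: max_exp_def)

lemma ok_max_exp [simp]: "ok s inp m (max_exp a b) = (ok s inp m a \<and> ok s inp m b)"
  by (auto simp: max_exp_def)

lemma ev_sum_exp [simp]: "ev inp m (sum_exp es) = sum_list (map (ev inp m) es)"
  by (induction es) (simp_all add: sum_exp_def)

lemma ok_sum_exp [simp]: "ok s inp m (sum_exp es) = (\<forall>e \<in> set es. ok s inp m e)"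
  by (induction es) (simp_all add: sum_exp_def)

lemma ev_prod_exp [simp]: "ev inp m (prod_exp es) = prod_list (map (ev inp m) es)"
  by (induction es) (simp_all add: prod_exp_def)

lemma ok_prod_exp [simp]: "ok s inp m (prod_exp es) = (\<forall>e \<in> set es. ok s inp m e)"
  by (induction es) (simp_all add: prod_exp_def)

lemma ev_power_exp [simp]: "ev inp m (power_exp e n) = ev inp m e ^ n"
  by (simp add: power_exp_def prod_list_replicate)

lemma ok_power_exp [simp]: "ok s inp m (power_exp e n) = (n = 0 \<or> ok s inp m e)"
  by (auto simp: power_exp_def)

section \<open>Monomials\<close>

definition dot :: "nat \<Rightarrow> (nat \<Rightarrow> int) \<Rightarrow> (nat \<Rightarrow> int) \<Rightarrow> int" where
  "dot d v x = (\<Sum>n<d. v n * x n)"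

text \<open>Coordinate \<open>j\<close> of the \<open>p\<close>-th tensor power of \<open>v\<close>,
  with the \<open>d ^ p\<close> index tuples enumerated by \<open>List.n_lists\<close>. Tuples that
  differ only in order are kept apart, which avoids multinomial coefficients.\<close>

definition monomial :: "nat \<Rightarrow> nat \<Rightarrow> nat \<Rightarrow> (nat \<Rightarrow> int) \<Rightarrow> int" where
  "monomial d p j v = prod_list (map v (List.n_lists p [0..<d] ! j))"

definition monomial_exp :: "nat \<Rightarrow> nat \<Rightarrow> nat \<Rightarrow> (nat \<Rightarrow> 'i exp) \<Rightarrow> 'i exp" where
  "monomial_exp d p j ce = prod_exp (map ce (List.n_lists p [0..<d] ! j))"

text \<open>The inner product of tensor powers is the power of the inner product. By linearity,
  stored sums of tensor powers of rows can be evaluated at any later \<open>x\<close>.\<close>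

lemma sum_monomial_mult: "(\<Sum>j<d ^ p. monomial d p j v * monomial d p j x) = dot d v x ^ p"
proof -
  let ?f = "\<lambda>t. prod_list (map v t) * prod_list (map x t)"
  have "(\<Sum>j<d ^ p. monomial d p j v * monomial d p j x) = sum_list (map ?f (List.n_lists p [0..<d]))"
    by (simp add: monomial_def sum_list_sum_nth length_n_lists atLeast0LessThan)
  also have "\<dots> = dot d v x ^ p"
  proof (induction p)
    case (Suc p)
    \<comment> \<open>One more tuple entry, ranging over all indices, contributes one more factor
      \<open>dot d v x\<close>.\<close>
    have "sum_list (map ?f (concat (map (\<lambda>ys. map (\<lambda>y. y # ys) [0..<d]) ts))) =
        dot d v x * sum_list (map ?f ts)" for ts
    proof (induction ts)
      case (Cons t ts)
      have "sum_list (map ?f (map (\<lambda>y. y # t) [0..<d])) = (\<Sum>n<d. v n * x n * ?f t)"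
        by (simp add: sum_list_distinct_conv_sum_set o_def atLeast0LessThan mult_ac)
      also have "\<dots> = dot d v x * ?f t" by (simp add: dot_def sum_distrib_right)
      finally show ?case using Cons by (simp add: algebra_simps)
    qed simp
    with Suc show ?case by simp
  qed simp
  finally show ?thesis .
qed

lemma nth_n_lists_subset: "j < d ^ p \<Longrightarrow> set (List.n_lists p [0..<d] ! j) \<subseteq> {..<d}"
  using set_n_lists[of p "[0..<d]"] nth_mem[of j "List.n_lists p [0..<d]"]
  by (auto simp: length_n_lists)

lemma length_nth_n_lists: "j < d ^ p \<Longrightarrow> length (List.n_lists p [0..<d] ! j) = p"
  using nth_mem[of j "List.n_lists p [0..<d]"]
  by (auto simp: length_n_lists set_n_lists)

lemma abs_prod_list_le:
  assumes "\<And>n. n \<in> set t \<Longrightarrow> \<bar>v n\<bar> \<le> Z" "0 \<le> Z"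
  shows "\<bar>prod_list (map v t)\<bar> \<le> (Z :: int) ^ length t"
  using assms by (induction t) (auto simp: abs_mult intro!: mult_mono)

lemma abs_monomial_le:
  assumes "j < d ^ p" "\<And>n. n < d \<Longrightarrow> \<bar>v n\<bar> \<le> Z" "0 \<le> Z"
  shows "\<bar>monomial d p j v\<bar> \<le> Z ^ p"
  unfolding monomial_def
  using abs_prod_list_le[of "List.n_lists p [0..<d] ! j" v Z] assms
    nth_n_lists_subset[of j d p] length_nth_n_lists[of j d p] by auto

lemma monomial_cong:
  assumes "j < d ^ p" "\<And>n. n < d \<Longrightarrow> v n = u n"
  shows "monomial d p j v = monomial d p j u"
proof -
  have "map v (List.n_lists p [0..<d] ! j) = map u (List.n_lists p [0..<d] ! j)"
    using nth_n_lists_subset[OF assms(1)] assms(2) by (intro map_cong refl) auto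
  then show ?thesis unfolding monomial_def by (rule arg_cong)
qed

lemma ev_monomial_exp:
  assumes "j < d ^ p" "\<And>n. n < d \<Longrightarrow> ev inp m (ce n) = v n"
  shows "ev inp m (monomial_exp d p j ce) = monomial d p j v"
  using monomial_cong[OF assms(1), of "\<lambda>n. ev inp m (ce n)" v] assms(2)
  by (simp add: monomial_exp_def monomial_def o_def)

lemma ok_monomial_exp:
  assumes "j < d ^ p" "\<And>n. n < d \<Longrightarrow> ok s inp m (ce n)"
  shows "ok s inp m (monomial_exp d p j ce)"
  using nth_n_lists_subset[OF assms(1)] assms(2) by (auto simp: monomial_exp_def)

section \<open>Partition of the directions into narrow cones\<close>

text \<open>The cones are the preimages, under \<open>v \<mapsto> v / max_norm d v\<close>, of the \<open>(k+1)\<^sup>d\<^sup>-\<^sup>1\<close>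
  boxes on each of the \<open>2 * d\<close> faces of the cube. Starting the maximum at \<open>1\<close> only matters for
  \<open>v = 0\<close>, where it avoids a division by zero.\<close>

definition max_norm :: "nat \<Rightarrow> (nat \<Rightarrow> int) \<Rightarrow> int" where
  "max_norm d v = foldr (\<lambda>n. max \<bar>v n\<bar>) [0..<d] 1"

text \<open>Faces \<open>2 * j\<close> and \<open>2 * j + 1\<close> of the cube are those where
  coordinate \<open>j\<close> is 1 and -1. The scaled vector lies on face \<open>f\<close> if this
  value equals \<open>max_norm d v\<close>.\<close>

definition signed_coord :: "(nat \<Rightarrow> int) \<Rightarrow> nat \<Rightarrow> int" where
  "signed_coord v f = (if even f then v (f div 2) else - v (f div 2))"

text \<open>With M the maximum norm this is the floor of k (v j / M + 1) / 2: the interval from -1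
  to 1 is cut into pieces of length 2/k. The right end point has bucket \<open>k\<close> to itself,
  hence the base \<open>k + 1\<close> of the codes below.\<close>

definition bucket :: "int \<Rightarrow> nat \<Rightarrow> (nat \<Rightarrow> int) \<Rightarrow> nat \<Rightarrow> int" where
  "bucket k d v j = (k * (v j + max_norm d v)) div (2 * max_norm d v)"

definition box_code :: "int \<Rightarrow> nat \<Rightarrow> (nat \<Rightarrow> int) \<Rightarrow> nat list \<Rightarrow> int" where
  "box_code k d v js = foldr (\<lambda>j r. bucket k d v j + (k + 1) * r) js 0"

text \<open>The coordinate that is constant on the face is left out; this is where the exponent
  \<open>d - 1\<close> comes from.\<close>

definition face_code :: "int \<Rightarrow> nat \<Rightarrow> (nat \<Rightarrow> int) \<Rightarrow> nat \<Rightarrow> int" where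
  "face_code k d v f =
     int f + 2 * int d * box_code k d v (filter (\<lambda>j. j \<noteq> f div 2) [0..<d])"

text \<open>A vector on several faces is assigned to the one with the smallest number, and the zero
  vector, which is on no face, gets code 0.\<close>

definition cone_code :: "int \<Rightarrow> nat \<Rightarrow> (nat \<Rightarrow> int) \<Rightarrow> int" where
  "cone_code k d v =
     foldr (\<lambda>f r. if signed_coord v f < max_norm d v then r else face_code k d v f) [0..<2 * d] 0"

lemma max_norm_ge_1: "1 \<le> max_norm d v"
proof -
  have "1 \<le> foldr (\<lambda>n. max \<bar>v n\<bar>) ns 1" for ns by (induction ns) auto
  then show ?thesis by (simp add: max_norm_def)
qed

lemma abs_le_max_norm: "n < d \<Longrightarrow> \<bar>v n\<bar> \<le> max_norm d v"
proof -
  have "n \<in> set ns \<Longrightarrow> \<bar>v n\<bar> \<le> foldr (\<lambda>n. max \<bar>v n\<bar>) ns 1" for ns by (induction ns) auto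
  then show "n < d \<Longrightarrow> \<bar>v n\<bar> \<le> max_norm d v" by (simp add: max_norm_def)
qed

lemma max_norm_le:
  assumes "\<And>n. n < d \<Longrightarrow> \<bar>v n\<bar> \<le> Z" "1 \<le> Z"
  shows "max_norm d v \<le> Z"
proof -
  have "(\<And>n. n \<in> set ns \<Longrightarrow> \<bar>v n\<bar> \<le> Z) \<Longrightarrow> foldr (\<lambda>n. max \<bar>v n\<bar>) ns 1 \<le> Z" for ns
    using assms(2) by (induction ns) auto
  from this[of "[0..<d]"] assms(1) show ?thesis by (simp add: max_norm_def)
qed

text \<open>A nonzero integer coordinate has absolute value at least 1, the start value of the fold,
  so the start value cannot be the only maximum.\<close>

lemma max_norm_attained:
  assumes "n < d" "v n \<noteq> 0"
  obtains j where "j < d" "max_norm d v = \<bar>v j\<bar>"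
proof -
  have "n \<in> set ns \<Longrightarrow> \<exists>j \<in> set ns. foldr (\<lambda>n. max \<bar>v n\<bar>) ns 1 = \<bar>v j\<bar>" for ns
  proof (induction ns)
    case (Cons i ns)
    let ?r = "foldr (\<lambda>n. max \<bar>v n\<bar>) ns 1"
    show ?case
    proof (cases "n \<in> set ns")
      case True
      with Cons.IH show ?thesis by (auto simp: max_def)
    next
      case False
      with Cons.prems have [simp]: "i = n" by simp
      have "?r = 1 \<or> (\<exists>j \<in> set ns. ?r = \<bar>v j\<bar>)" by (induction ns) (auto simp: max_def)
      moreover have "foldr (\<lambda>n. max \<bar>v n\<bar>) (i # ns) 1 = max \<bar>v n\<bar> ?r" by simp
      ultimately show ?thesis using assms(2)
        by (cases "\<bar>v n\<bar> \<le> ?r") (auto simp del: foldr.simps simp: max_absorb1 max_absorb2)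
    qed
  qed simp
  from this[of "[0..<d]"] assms(1) that show thesis by (auto simp: max_norm_def)
qed

lemma bucket_range:
  assumes "0 \<le> k" "j < d"
  shows "0 \<le> bucket k d v j" "bucket k d v j < k + 1"
proof -
  let ?M = "max_norm d v"
  note M = max_norm_ge_1[of d v] abs_le_max_norm[OF assms(2), of v]
  show "0 \<le> bucket k d v j"
    using M assms by (simp add: bucket_def pos_imp_zdiv_nonneg_iff)
  have "k * (v j + ?M) \<le> k * (2 * ?M)" using M assms by (intro mult_left_mono) auto
  then have "bucket k d v j \<le> (k * (2 * ?M)) div (2 * ?M)"
    unfolding bucket_def using M by (intro zdiv_mono1) auto
  also have "\<dots> = k" using M by simp
  finally show "bucket k d v j < k + 1" by simp
qed

lemma mixed_radix_less:
  fixes a r K N :: int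
  assumes "0 \<le> a" "a < K" "0 \<le> r" "r < N"
  shows "a + K * r < K * N"
proof -
  have "K * (r + 1) \<le> K * N" using assms by (intro mult_left_mono) auto
  with assms show ?thesis by (simp add: algebra_simps)
qed

lemma box_code_range:
  assumes "0 \<le> k" "set js \<subseteq> {..<d}"
  shows "0 \<le> box_code k d v js \<and> box_code k d v js < (k + 1) ^ length js"
  using assms(2)
proof (induction js)
  case (Cons j js)
  then show ?case using bucket_range[OF assms(1), of j d v] assms(1)
    by (auto simp: box_code_def intro!: mixed_radix_less)
qed (simp add: box_code_def)

text \<open>Buckets are digits to the base \<open>k + 1\<close>; reduction modulo the base recovers
  the first one.\<close>

lemma box_code_inject:
  assumes "0 \<le> k" "set js \<subseteq> {..<d}" "box_code k d v js = box_code k d u js" "j \<in> set js"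
  shows "bucket k d v j = bucket k d u j"
  using assms(2-)
proof (induction js)
  case (Cons i js)
  note r = bucket_range[OF assms(1), of i d]
  have *: "bucket k d v i + (k + 1) * box_code k d v js = bucket k d u i + (k + 1) * box_code k d u js"
    using Cons.prems by (simp add: box_code_def)
  have "bucket k d v i = (bucket k d v i + (k + 1) * box_code k d v js) mod (k + 1)"
    using r[of v] Cons.prems by simp
  also have "\<dots> = bucket k d u i"
    unfolding * using r[of u] Cons.prems by simp
  finally show ?case using * Cons assms(1) by auto
qed simp

lemma length_filter_neq: "i < d \<Longrightarrow> length (filter (\<lambda>j. j \<noteq> i) [0..<d]) = d - 1"
proof -
  assume "i < d"
  have "length (filter (\<lambda>j. j \<noteq> i) [0..<d]) = card ({..<d} - {i})"
    by (subst distinct_card[symmetric]) (auto intro!: arg_cong[where f = card])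
  with \<open>i < d\<close> show ?thesis by simp
qed

lemma face_code_range:
  assumes "0 \<le> k" "f < 2 * d"
  shows "0 \<le> face_code k d v f" "face_code k d v f < 2 * int d * (k + 1) ^ (d - 1)"
proof -
  have "f div 2 < d" using assms by auto
  then have "0 \<le> box_code k d v (filter (\<lambda>j. j \<noteq> f div 2) [0..<d]) \<and>
      box_code k d v (filter (\<lambda>j. j \<noteq> f div 2) [0..<d]) < (k + 1) ^ (d - 1)"
    using box_code_range[OF assms(1), of "filter (\<lambda>j. j \<noteq> f div 2) [0..<d]" d v]
    by (auto simp: length_filter_neq)
  then show "0 \<le> face_code k d v f" "face_code k d v f < 2 * int d * (k + 1) ^ (d - 1)"
    unfolding face_code_def using assms(2) by (auto intro!: mixed_radix_less)
qed

lemma cone_code_range: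
  assumes "0 \<le> k" "0 < d"
  shows "0 \<le> cone_code k d v \<and> cone_code k d v < 2 * int d * (k + 1) ^ (d - 1)"
proof -
  let ?F = "foldr (\<lambda>f r. if signed_coord v f < max_norm d v then r else face_code k d v f)"
  have "set fs \<subseteq> {..<2 * d} \<Longrightarrow> 0 \<le> ?F fs 0 \<and> ?F fs 0 < 2 * int d * (k + 1) ^ (d - 1)" for fs
    using assms face_code_range[OF assms(1), of _ d v] by (induction fs) auto
  moreover have "set [0..<2 * d] \<subseteq> {..<2 * d}" by auto
  ultimately show ?thesis unfolding cone_code_def by blast
qed

lemma cone_code_cases:
  assumes "n < d" "v n \<noteq> 0"
  obtains f where "f < 2 * d" "signed_coord v f = max_norm d v"
    "cone_code k d v = face_code k d v f"
proof -
  let ?F = "foldr (\<lambda>f r. if signed_coord v f < max_norm d v then r else face_code k d v f)"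
  obtain j where j: "j < d" "max_norm d v = \<bar>v j\<bar>" using max_norm_attained assms by metis
  define f0 where "f0 = (if 0 \<le> v j then 2 * j else 2 * j + 1)"
  have f0: "f0 \<in> set [0..<2 * d]" "\<not> signed_coord v f0 < max_norm d v"
    using j by (auto simp: f0_def signed_coord_def)
  \<comment> \<open>The fold stops at the first face that contains the vector, which may come before
    \<open>f0\<close>.\<close>
  have "f0 \<in> set fs \<Longrightarrow> \<exists>f \<in> set fs. \<not> signed_coord v f < max_norm d v \<and> ?F fs 0 = face_code k d v f" for fs
    using f0(2) by (induction fs) auto
  from this[OF f0(1)] obtain f where f: "f < 2 * d" "max_norm d v \<le> signed_coord v f"
    "cone_code k d v = face_code k d v f" by (auto simp: cone_code_def)
  have "f div 2 < d" using f(1) by auto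
  from abs_le_max_norm[OF this, of v] have "signed_coord v f \<le> max_norm d v"
    by (auto simp: signed_coord_def)
  with f that show thesis by simp
qed

text \<open>Numbers with equal floor differ by at most 1, and one unit on the scale of the buckets
  is 2/k on the scale of the normalised coordinates.\<close>

lemma bucket_eq_imp_close:
  assumes "0 < k" "bucket k d v j = bucket k d u j"
  shows "\<bar>of_int (v j) / of_int (max_norm d v) - of_int (u j) / of_int (max_norm d u)\<bar> \<le> 2 / real_of_int k"
proof -
  have *: "real_of_int (bucket k d v j) \<le> of_int k * (of_int (v j) / of_int (max_norm d v) + 1) / 2 \<and>
     of_int k * (of_int (v j) / of_int (max_norm d v) + 1) / 2 < real_of_int (bucket k d v j) + 1" for v
  proof -
    have M: "0 < max_norm d v" using max_norm_ge_1[of d v] by simp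
    have "bucket k d v j = \<lfloor>of_int (k * (v j + max_norm d v)) / real_of_int (2 * max_norm d v)\<rfloor>"
      unfolding bucket_def by (rule floor_divide_of_int_eq[symmetric])
    also have "of_int (k * (v j + max_norm d v)) / real_of_int (2 * max_norm d v)
        = of_int k * (of_int (v j) / of_int (max_norm d v) + 1) / 2"
      using M by (simp add: field_simps)
    finally show ?thesis by linarith
  qed
  define a b where "a = of_int (v j) / real_of_int (max_norm d v)"
    and "b = of_int (u j) / real_of_int (max_norm d u)"
  have k: "0 < real_of_int k" using assms by simp
  have "\<bar>of_int k * (a + 1) / 2 - of_int k * (b + 1) / 2\<bar> \<le> 1"
    using *[of v] *[of u] assms(2) unfolding a_def b_def by linarith
  moreover have "of_int k * (a + 1) / 2 - of_int k * (b + 1) / 2 = of_int k * (a - b) / 2"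
    by (simp add: field_simps)
  ultimately have "\<bar>of_int k * (a - b)\<bar> \<le> 2" by simp
  then have "of_int k * \<bar>a - b\<bar> \<le> 2" using k by (simp add: abs_mult)
  with k show ?thesis unfolding a_def b_def by (simp add: pos_le_divide_eq mult.commute)
qed

text \<open>Reduction modulo \<open>2 * d\<close> recovers the face. Its own coordinate is the same
  unit 1 or -1 for both normalised vectors, and all other coordinates share a bucket.\<close>

lemma cone_code_eq_imp_close:
  assumes "0 < k" "n < d" "v n \<noteq> 0" "n' < d" "u n' \<noteq> 0" "cone_code k d v = cone_code k d u" "j < d"
  shows "\<bar>of_int (v j) / of_int (max_norm d v) - of_int (u j) / of_int (max_norm d u)\<bar> \<le> 2 / real_of_int k"
proof -
  obtain f where f: "f < 2 * d" "signed_coord v f = max_norm d v"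
    "cone_code k d v = face_code k d v f" using cone_code_cases assms by metis
  obtain g where g: "g < 2 * d" "signed_coord u g = max_norm d u"
    "cone_code k d u = face_code k d u g" using cone_code_cases assms by metis
  have *: "face_code k d v f mod (2 * int d) = int f" if "f < 2 * d" for v f
    using that by (simp add: face_code_def mod_pos_pos_trivial)
  have "int f = int g" using *[OF f(1), of v] *[OF g(1), of u] f g assms by simp
  then have fg: "f = g" by simp
  show ?thesis
  proof (cases "j = f div 2")
    case True
    have *: "of_int (v j) / real_of_int (max_norm d v) = (if even f then 1 else - 1)"
      if "signed_coord v f = max_norm d v" for v
    proof -
      have "v j = (if even f then max_norm d v else - max_norm d v)"
        using that True by (auto simp: signed_coord_def split: if_splits)
      then show ?thesis using max_norm_ge_1[of d v] by auto
    qed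
    have "\<bar>of_int (v j) / real_of_int (max_norm d v) - of_int (u j) / of_int (max_norm d u)\<bar> = 0"
      using *[of v] *[of u] f(2) g(2) fg by simp
    then show ?thesis using assms(1) by simp
  next
    case False
    let ?js = "filter (\<lambda>j. j \<noteq> f div 2) [0..<d]"
    have "box_code k d v ?js = box_code k d u ?js"
      using f g fg assms by (simp add: face_code_def)
    then have "bucket k d v j = bucket k d u j"
      using box_code_inject[of k ?js d v u j] False assms by auto
    with bucket_eq_imp_close assms(1) show ?thesis by blast
  qed
qed

text \<open>Numbers of opposite sign are each at most their distance in absolute value. Here they
  are the inner products of \<open>x\<close> with two normalised vectors of one cone, whose
  coordinates differ by at most 2/k. The factor \<open>max_norm d v\<close> undoes the
  normalisation.\<close>

lemma abs_dot_le_of_cone_cut: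
  assumes "0 < k" "cone_code k d v = cone_code k d u" "dot d v x * dot d u x < 0"
  shows "of_int \<bar>dot d v x\<bar> \<le> of_int (max_norm d v) * (2 / real_of_int k) * of_int (\<Sum>j<d. \<bar>x j\<bar>)"
proof -
  have "\<exists>n<d. v n \<noteq> 0" if "dot d v x \<noteq> 0" for v
    using that by (rule contrapos_np) (simp add: dot_def)
  moreover have "dot d v x \<noteq> 0" "dot d u x \<noteq> 0" using assms by auto
  ultimately obtain n n' where nn: "n < d" "v n \<noteq> 0" "n' < d" "u n' \<noteq> 0" by metis
  define M N where "M = real_of_int (max_norm d v)" and "N = real_of_int (max_norm d u)"
  have MN: "0 < M" "0 < N" using max_norm_ge_1[of d v] max_norm_ge_1[of d u] by (simp_all add: M_def N_def)
  define a b where "a = real_of_int (dot d v x)" and "b = real_of_int (dot d u x)"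
  have "a * b < 0" unfolding a_def b_def using assms(3) by (metis of_int_less_0_iff of_int_mult)
  then have "(a / M) * (b / N) < 0" using MN by (simp add: divide_less_0_iff mult_pos_pos)
  then have "\<bar>a / M\<bar> \<le> \<bar>a / M - b / N\<bar>"
    unfolding mult_less_0_iff by linarith
  also have "a / M - b / N = (\<Sum>j<d. (of_int (v j) / M - of_int (u j) / N) * of_int (x j))"
    by (simp add: a_def b_def dot_def sum_divide_distrib sum_subtractf algebra_simps)
  also have "\<bar>\<dots>\<bar> \<le> (\<Sum>j<d. 2 / of_int k * of_int \<bar>x j\<bar>)"
    using mult_right_mono[OF cone_code_eq_imp_close[OF assms(1) nn assms(2)] abs_ge_zero]
    by (intro order_trans[OF sum_abs] sum_mono) (simp add: abs_mult M_def N_def)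
  also have "\<dots> = 2 / of_int k * of_int (\<Sum>j<d. \<bar>x j\<bar>)" by (simp add: sum_distrib_left)
  finally have "\<bar>a\<bar> / M \<le> 2 / of_int k * of_int (\<Sum>j<d. \<bar>x j\<bar>)" using MN by simp
  then have "\<bar>a\<bar> \<le> 2 / of_int k * of_int (\<Sum>j<d. \<bar>x j\<bar>) * M" using MN by (simp add: pos_divide_le_eq)
  then show ?thesis by (simp add: a_def M_def mult_ac)
qed

lemma cone_code_cong:
  assumes "\<And>i. i < d \<Longrightarrow> v i = u i"
  shows "cone_code k d v = cone_code k d u"
proof -
  have "set ns \<subseteq> {..<d} \<Longrightarrow> foldr (\<lambda>n. max \<bar>v n\<bar>) ns 1 = foldr (\<lambda>n. max \<bar>u n\<bar>) ns 1" for ns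
    using assms by (induction ns) auto
  then have M: "max_norm d v = max_norm d u" by (simp add: max_norm_def lessThan_atLeast0)
  have "set js \<subseteq> {..<d} \<Longrightarrow> box_code k d v js = box_code k d u js" for js
    using assms by (induction js) (auto simp: box_code_def bucket_def M)
  from this[of "filter (\<lambda>j. j \<noteq> _ div 2) [0..<d]"]
  have F: "face_code k d v f = face_code k d u f" for f
    unfolding face_code_def by auto
  have "set fs \<subseteq> {..<2 * d} \<Longrightarrow>
      foldr (\<lambda>f r. if signed_coord v f < max_norm d v then r else face_code k d v f) fs 0 =
      foldr (\<lambda>f r. if signed_coord u f < max_norm d u then r else face_code k d u f) fs 0" for fs
  proof (induction fs)
    case (Cons f fs)
    moreover from Cons have "f div 2 < d" by auto
    ultimately show ?case using assms by (auto simp: F M signed_coord_def)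
  qed simp
  then show ?thesis by (simp add: cone_code_def lessThan_atLeast0)
qed

section \<open>Expressions that compute the cone code\<close>

definition max_norm_exp :: "nat \<Rightarrow> (nat \<Rightarrow> 'i exp) \<Rightarrow> 'i exp" where
  "max_norm_exp d ce = foldr (\<lambda>n. max_exp (abs_exp (ce n))) [0..<d] (Num 1)"

definition signed_coord_exp :: "(nat \<Rightarrow> 'i exp) \<Rightarrow> nat \<Rightarrow> 'i exp" where
  "signed_coord_exp ce f = (if even f then ce (f div 2) else Minus (Num 0) (ce (f div 2)))"

definition bucket_exp :: "'i exp \<Rightarrow> nat \<Rightarrow> (nat \<Rightarrow> 'i exp) \<Rightarrow> nat \<Rightarrow> 'i exp" where
  "bucket_exp k d ce j =
     Div (Times k (Plus (ce j) (max_norm_exp d ce))) (Times (Num 2) (max_norm_exp d ce))"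

definition box_code_exp :: "'i exp \<Rightarrow> nat \<Rightarrow> (nat \<Rightarrow> 'i exp) \<Rightarrow> nat list \<Rightarrow> 'i exp" where
  "box_code_exp k d ce js =
     foldr (\<lambda>j r. Plus (bucket_exp k d ce j) (Times (Plus k (Num 1)) r)) js (Num 0)"

definition face_code_exp :: "'i exp \<Rightarrow> nat \<Rightarrow> (nat \<Rightarrow> 'i exp) \<Rightarrow> nat \<Rightarrow> 'i exp" where
  "face_code_exp k d ce f = Plus (Num (int f))
     (Times (Num (2 * int d)) (box_code_exp k d ce (filter (\<lambda>j. j \<noteq> f div 2) [0..<d])))"

definition cone_code_exp :: "'i exp \<Rightarrow> nat \<Rightarrow> (nat \<Rightarrow> 'i exp) \<Rightarrow> 'i exp" where
  "cone_code_exp k d ce =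
     foldr (\<lambda>f r. if_neg_exp (Minus (signed_coord_exp ce f) (max_norm_exp d ce)) r
       (face_code_exp k d ce f)) [0..<2 * d] (Num 0)"

lemma ev_max_norm_exp: "ev inp m (max_norm_exp d ce) = max_norm d (\<lambda>n. ev inp m (ce n))"
proof -
  have "ev inp m (foldr (\<lambda>n. max_exp (abs_exp (ce n))) ns (Num 1))
      = foldr (\<lambda>n. max \<bar>ev inp m (ce n)\<bar>) ns 1" for ns
    by (induction ns) simp_all
  then show ?thesis by (simp add: max_norm_exp_def max_norm_def)
qed

lemma ev_cone_code_exp: "ev inp m (cone_code_exp k d ce) = cone_code (ev inp m k) d (\<lambda>n. ev inp m (ce n))"
proof -
  have b: "ev inp m (box_code_exp k d ce js) = box_code (ev inp m k) d (\<lambda>n. ev inp m (ce n)) js" for js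
    by (induction js) (simp_all add: box_code_exp_def box_code_def bucket_exp_def bucket_def ev_max_norm_exp)
  have "ev inp m (foldr (\<lambda>f r. if_neg_exp (Minus (signed_coord_exp ce f) (max_norm_exp d ce)) r
       (face_code_exp k d ce f)) fs (Num 0)) =
     foldr (\<lambda>f r. if signed_coord (\<lambda>n. ev inp m (ce n)) f < max_norm d (\<lambda>n. ev inp m (ce n)) then r
        else face_code (ev inp m k) d (\<lambda>n. ev inp m (ce n)) f) fs 0" for fs
    by (induction fs) (simp_all add: signed_coord_exp_def signed_coord_def ev_max_norm_exp b
        face_code_exp_def face_code_def)
  then show ?thesis by (simp add: cone_code_exp_def cone_code_def)
qed

lemma ok_cone_code_exp:
  assumes "\<And>n. n < d \<Longrightarrow> ok s inp m (ce n)" "ok s inp m k"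
  shows "ok s inp m (cone_code_exp k d ce)"
proof -
  have "set ns \<subseteq> {..<d} \<Longrightarrow> ok s inp m (foldr (\<lambda>n. max_exp (abs_exp (ce n))) ns (Num 1))" for ns
    using assms by (induction ns) auto
  then have M: "ok s inp m (max_norm_exp d ce)" by (simp add: max_norm_exp_def lessThan_atLeast0)
  have B: "set js \<subseteq> {..<d} \<Longrightarrow> ok s inp m (box_code_exp k d ce js)" for js
    using assms M max_norm_ge_1[of d "\<lambda>n. ev inp m (ce n)"]
    by (induction js) (auto simp: box_code_exp_def bucket_exp_def ev_max_norm_exp)
  have F: "ok s inp m (face_code_exp k d ce f)" for f
proof -
    have "set (filter (\<lambda>j. j \<noteq> f div 2) [0..<d]) \<subseteq> {..<d}" by auto
    from B[OF this] show ?thesis by (simp add: face_code_exp_def)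
  qed
  have "set fs \<subseteq> {..<2 * d} \<Longrightarrow> ok s inp m (foldr (\<lambda>f r. if_neg_exp (Minus (signed_coord_exp ce f) (max_norm_exp d ce)) r
       (face_code_exp k d ce f)) fs (Num 0))" for fs
    using assms M F by (induction fs) (auto simp: signed_coord_exp_def)
  then show ?thesis by (simp add: cone_code_exp_def lessThan_atLeast0)
qed

section \<open>The programs\<close>

definition stride :: "nat \<Rightarrow> nat \<Rightarrow> nat" where
  "stride d p = d ^ p + d"

text \<open>Addresses 0 and 1 hold the answer of the query, 2 the scale \<open>D\<close>, 3 the resolution \<open>k\<close>, 4 the
  number \<open>C\<close> of cones, 5 the number of rows seen, 6 to 8 are scratch. Record \<open>c < C\<close> contains
  the \<open>d ^ p\<close> moments of cone \<open>c\<close> and the sample of slot \<open>c\<close>, a uniformly random row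
  among those whose position is congruent to \<open>c\<close> modulo \<open>C\<close>.\<close>

definition addr :: "nat \<Rightarrow> nat \<Rightarrow> nat \<Rightarrow> nat \<Rightarrow> nat" where
  "addr d p c j = 9 + c * stride d p + j"

definition addr_exp :: "nat \<Rightarrow> nat \<Rightarrow> 'i exp \<Rightarrow> nat \<Rightarrow> 'i exp" where
  "addr_exp d p c j = Plus (Num (9 + int j)) (Times c (Num (int (stride d p))))"

primrec block :: "'i com list \<Rightarrow> 'i com" where
  "block [] = Skip"
| "block (c # cs) = Seq c (block cs)"

definition coord_exp :: "(nat \<Rightarrow> 'i) \<Rightarrow> nat \<Rightarrow> 'i exp" where
  "coord_exp \<iota> n = Input (\<iota> n) (Mem (Num 2))"

text \<open>The first test is positive exactly while \<open>D * \<epsilon> < 1\<close>, so the first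
  loop finds \<open>D = \<lceil>1 / \<epsilon>\<rceil>\<close>. The second finds the least
  \<open>k \<ge> 1\<close> with \<open>k ^ (d + 2 * p - 1) \<ge> D * D\<close>, which takes a root
  by search.\<close>

definition init_com :: "nat \<Rightarrow> nat \<Rightarrow> unit com" where
  "init_com d p =
     Seq (Store (Num 2) (Num 1))
    (Seq (While (Minus (Num 1) (Input () (Mem (Num 2)))) (Store (Num 2) (Plus (Mem (Num 2)) (Num 1))))
    (Seq (Store (Num 3) (Num 1))
    (Seq (While (Minus (Times (Mem (Num 2)) (Mem (Num 2))) (power_exp (Mem (Num 3)) (d + 2 * p - 1)))
            (Store (Num 3) (Plus (Mem (Num 3)) (Num 1))))
         (Store (Num 4) (Times (Num (2 * int d)) (power_exp (Plus (Mem (Num 3)) (Num 1)) (d - 1)))))))"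

definition slot_exp :: "'i exp" where
  "slot_exp = Minus (Mem (Num 5)) (Times (Mem (Num 4)) (Div (Mem (Num 5)) (Mem (Num 4))))"

definition moments_com :: "nat \<Rightarrow> nat \<Rightarrow> (nat \<Rightarrow> 'i) \<Rightarrow> 'i com" where
  "moments_com d p \<iota> = block (map (\<lambda>j. Store (addr_exp d p (Mem (Num 6)) j)
     (Plus (Mem (addr_exp d p (Mem (Num 6)) j)) (monomial_exp d p j (coord_exp \<iota>)))) [0..<d ^ p])"

text \<open>Cell 7 holds the draw, so the condition is negative exactly if 0 was drawn. Otherwise
  the old sample is written back to itself, which takes the same time.\<close>

definition sample_com :: "nat \<Rightarrow> nat \<Rightarrow> (nat \<Rightarrow> 'i) \<Rightarrow> 'i com" where
  "sample_com d p \<iota> = block (map (\<lambda>n. Store (addr_exp d p slot_exp (d ^ p + n))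
     (if_neg_exp (Minus (Mem (Num 7)) (Num 1)) (coord_exp \<iota> n)
       (Mem (addr_exp d p slot_exp (d ^ p + n))))) [0..<d])"

text \<open>Reservoir sampling: with N rows seen, N div C of them belong to the slot of the new row,
  which is therefore kept with probability 1 / (N div C + 1). The work per moment and per coordinate
  is unrolled into the program text, so the number of steps is constant.\<close>

definition upd_com :: "nat \<Rightarrow> nat \<Rightarrow> (nat \<Rightarrow> 'i) \<Rightarrow> 'i com" where
  "upd_com d p \<iota> =
     Seq (Store (Num 6) (cone_code_exp (Mem (Num 3)) d (coord_exp \<iota>)))
    (Seq (Draw (Num 7) (Plus (Div (Mem (Num 5)) (Mem (Num 4))) (Num 1)))
    (Seq (moments_com d p \<iota>)
    (Seq (sample_com d p \<iota>)
         (Store (Num 5) (Plus (Mem (Num 5)) (Num 1))))))"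

definition moment_exp :: "nat \<Rightarrow> nat \<Rightarrow> (nat \<Rightarrow> 'i) \<Rightarrow> 'i exp \<Rightarrow> 'i exp" where
  "moment_exp d p \<iota> c = sum_exp (map (\<lambda>j. Times (Mem (addr_exp d p c j))
     (monomial_exp d p j (coord_exp \<iota>))) [0..<d ^ p])"

definition sample_exp :: "nat \<Rightarrow> nat \<Rightarrow> nat \<Rightarrow> 'i exp" where
  "sample_exp d p n = Mem (addr_exp d p (Mem (Num 8)) (d ^ p + n))"

definition dot_exp :: "nat \<Rightarrow> nat \<Rightarrow> (nat \<Rightarrow> 'i) \<Rightarrow> 'i exp" where
  "dot_exp d p \<iota> = sum_exp (map (\<lambda>n. Times (sample_exp d p n) (coord_exp \<iota> n)) [0..<d])"

definition slot_size_exp :: "'i exp" where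
  "slot_size_exp = Div (Minus (Minus (Plus (Mem (Num 5)) (Mem (Num 4))) (Num 1)) (Mem (Num 8))) (Mem (Num 4))"

text \<open>The sample of a slot need not lie in the cone of the same number, so its cone is
  recomputed and the sign comes from the moment of that cone. One uniform sample stands for all rows
  of its slot, hence the weight.\<close>

definition summand_exp :: "nat \<Rightarrow> nat \<Rightarrow> (nat \<Rightarrow> 'i) \<Rightarrow> 'i exp" where
  "summand_exp d p \<iota> = Plus (abs_exp (moment_exp d p \<iota> (Mem (Num 8))))
     (Times slot_size_exp (Minus (power_exp (abs_exp (dot_exp d p \<iota>)) p)
       (Times (sgn_exp (moment_exp d p \<iota> (cone_code_exp (Mem (Num 3)) d (sample_exp d p))))
         (power_exp (dot_exp d p \<iota>) p))))"

text \<open>The denominator is the number of rows times \<open>D ^ (2 * p)\<close>: rows and query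
  are both scaled by \<open>D\<close>, and the product is raised to the power
  \<open>p\<close>.\<close>

definition query_com :: "nat \<Rightarrow> nat \<Rightarrow> (nat \<Rightarrow> 'i) \<Rightarrow> 'i com" where
  "query_com d p \<iota> =
     Seq (Store (Num 8) (Mem (Num 4)))
    (Seq (Store (Num 1) (Times (Mem (Num 5)) (power_exp (Mem (Num 2)) (2 * p))))
         (While (Mem (Num 8))
           (Seq (Store (Num 8) (Minus (Mem (Num 8)) (Num 1)))
                (Store (Num 0) (Plus (Mem (Num 0)) (summand_exp d p \<iota>))))))"

lemma draw_free_query_com: "draw_free (query_com d p \<iota>)"
  by (simp add: query_com_def)

section \<open>Correctness of the programs\<close>

definition set_range :: "mem \<Rightarrow> nat \<Rightarrow> nat \<Rightarrow> (nat \<Rightarrow> int) \<Rightarrow> mem" where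
  "set_range m q n f = (\<lambda>a. if q \<le> a \<and> a < q + n then f (a - q) else m a)"

lemma ev_addr_exp: "ev inp m c' = int c \<Longrightarrow> ev inp m (addr_exp d p c' j) = int (addr d p c j)"
  by (simp add: addr_exp_def addr_def)

lemma ok_addr_exp: "ok s inp m (addr_exp d p c j) = ok s inp m c"
  by (simp add: addr_exp_def)

text \<open>Records are disjoint intervals of length \<open>stride d p\<close>, so neither writing
  moments nor writing a sample touches anything else.\<close>

lemma addr_in_range_iff:
  assumes "j < stride d p" "i + n \<le> stride d p"
  shows "addr d p c' i \<le> addr d p c j \<and> addr d p c j < addr d p c' i + n \<longleftrightarrow>
    c = c' \<and> i \<le> j \<and> j < i + n"
proof -
  have *: "a < b \<Longrightarrow> a * stride d p + stride d p \<le> b * stride d p" for a b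
    using mult_le_mono1[of "Suc a" b "stride d p"] by simp
  show ?thesis
    using *[of c c'] *[of c' c] assms by (cases c c' rule: linorder_cases) (auto simp: addr_def)
qed

lemma addr_less:
  assumes "c < C" "j < stride d p"
  shows "addr d p c j < 9 + C * stride d p"
  using mult_le_mono1[of "Suc c" C "stride d p"] assms by (simp add: addr_def)

context ram
begin

lemma bnd_set_range:
  assumes "bnd m" "\<And>i. i < n \<Longrightarrow> \<bar>f i\<bar> \<le> X"
  shows "bnd (set_range m q n f)"
  using assms by (auto simp: bnd_def set_range_def)

text \<open>Each store sees a memory in which the earlier cells of the block are already
  overwritten, while \<open>f\<close> gives the intended values in advance. The induction runs over
  the stores still to come.\<close>

lemma bigstep_block_Store:
  assumes "\<And>j m'. j < n \<Longrightarrow> m' = set_range m q j f \<Longrightarrow> bnd m' \<and> ok s inp m' (ae j) \<and>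
      ok s inp m' (ee j) \<and> ev inp m' (ae j) = int (q + j) \<and> ev inp m' (ee j) = f j"
    and "q + n \<le> s" "com_deg (block (map (\<lambda>j. Store (ae j) (ee j)) [0..<n])) \<le> G"
  shows "bigstep (block (map (\<lambda>j. Store (ae j) (ee j)) [0..<n])) m (return_pmf (set_range m q n f))
    (straight_time (block (map (\<lambda>j. Store (ae j) (ee j)) [0..<n])))"
proof -
  let ?b = "\<lambda>i. block (map (\<lambda>j. Store (ae j) (ee j)) [i..<n])"
  have "i \<le> n \<Longrightarrow> com_deg (?b i) \<le> G \<Longrightarrow>
    bigstep (?b i) (set_range m q i f) (return_pmf (set_range m q n f)) (straight_time (?b i))" for i
  proof (induction i rule: inc_induct)
    case base
    show ?case using bigstep_Skip by simp
  next
    case (step i)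
    have upt: "[i..<n] = i # [Suc i..<n]" using step by (simp add: upt_conv_Cons)
    have r: "(set_range m q i f)(q + i := f i) = set_range m q (Suc i) f"
      by (auto simp: set_range_def fun_eq_iff)
    have "bigstep (Store (ae i) (ee i)) (set_range m q i f) (return_pmf (set_range m q (Suc i) f)) 1"
      using bigstep_Store[of "set_range m q i f" "ae i" "ee i" "q + i"] assms(1)[of i] assms(2) step
      by (simp add: r upt)
    from bigstep_Seq_det[OF this, of "?b (Suc i)"] step show ?case by (simp add: upt)
  qed
  moreover have "set_range m q 0 f = m" by (auto simp: set_range_def)
  ultimately show ?thesis using assms(3) by fastforce
qed

end

text \<open>\<open>n\<close> is the length of the stream and \<open>\<beta>\<close> bounds the coordinates of its rows, so
  \<open>(d * \<beta> * D\<^sup>2) ^ p\<close> bounds \<open>\<bar>dot d b x\<bar> ^ p\<close> for rounded rows \<open>b\<close> and queries \<open>x\<close>, and \<open>X\<close>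
  bounds every memory cell, including the sum of \<open>C\<close> summands computed by a query.\<close>

locale sketch =
  fixes d p D k C n \<beta> s :: nat and X :: int
  assumes d_ge: "2 \<le> d" and p_ge: "1 \<le> p" and D_ge: "1 \<le> D" and k_ge: "1 \<le> k"
    and n_ge: "1 \<le> n" and \<beta>_ge: "1 \<le> \<beta>"
    and C_eq: "C = 2 * d * (k + 1) ^ (d - 1)"
    and X_eq: "X = int (3 * C * n * (d * \<beta> * D\<^sup>2) ^ p)"
    and s_ge: "9 + C * stride d p \<le> s"
begin

text \<open>Vectors are functions on all of \<open>nat\<close>; zero from \<open>d\<close> on makes
  equality of rounded rows and stored samples a matter of the first \<open>d\<close>
  coordinates.\<close>

definition bounded_vec :: "(nat \<Rightarrow> int) \<Rightarrow> bool" where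
  "bounded_vec b \<longleftrightarrow> (\<forall>i. \<bar>b i\<bar> \<le> int (\<beta> * D)) \<and> (\<forall>i\<ge>d. b i = 0)"

abbreviation code :: "(nat \<Rightarrow> int) \<Rightarrow> int" where
  "code b \<equiv> cone_code (int k) d b"

definition sample :: "mem \<Rightarrow> nat \<Rightarrow> nat \<Rightarrow> int" where
  "sample m c = (\<lambda>i. if i < d then m (addr d p c (d ^ p + i)) else 0)"

definition cone_sum :: "((nat \<Rightarrow> int) \<Rightarrow> int) \<Rightarrow> (nat \<Rightarrow> int) list \<Rightarrow> int \<Rightarrow> int" where
  "cone_sum f bs c = (\<Sum>b\<leftarrow>bs. if code b = c then f b else 0)"

text \<open>The law of the samples is not part of the invariant, only that each is a row of the
  stream or the initial zero vector. The bounds on the scratch cells and the last clause serve to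
  bound the entire memory.\<close>

definition state :: "(nat \<Rightarrow> int) list \<Rightarrow> mem \<Rightarrow> bool" where
  "state bs m \<longleftrightarrow> m 0 = 0 \<and> m 1 = 0 \<and> m 2 = int D \<and> m 3 = int k \<and> m 4 = int C \<and>
     m 5 = int (length bs) \<and> 0 \<le> m 6 \<and> m 6 \<le> int C \<and> 0 \<le> m 7 \<and> m 7 \<le> int n \<and> m 8 = 0 \<and>
     (\<forall>c<C. \<forall>j<d ^ p. m (addr d p c j) = cone_sum (monomial d p j) bs (int c)) \<and>
     (\<forall>c<C. sample m c \<in> insert (\<lambda>_. 0) (set bs)) \<and>
     (\<forall>a\<ge>9 + C * stride d p. m a = 0)"

definition upd_mem :: "(nat \<Rightarrow> int) \<Rightarrow> mem \<Rightarrow> int \<Rightarrow> mem" where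
  "upd_mem b m v =
     (let c = nat (code b); c' = nat (m 5) mod C in
      (set_range (set_range (m(6 := code b, 7 := v)) (addr d p c 0) (d ^ p)
          (\<lambda>j. m (addr d p c j) + monomial d p j b))
        (addr d p c' (d ^ p)) d (\<lambda>i. if v = 0 then b i else sample m c' i))
      (5 := m 5 + 1))"

lemma C_pos: "0 < C"
  using d_ge by (simp add: C_eq)

lemma code_range: "0 \<le> code b" "code b < int C"
  using cone_code_range[of "int k" d b] d_ge by (simp_all add: C_eq add.commute)

lemma base_ge_1: "1 \<le> (d * \<beta> * D\<^sup>2) ^ p"
  using d_ge \<beta>_ge D_ge by (simp add: Suc_leI)

lemma le_X:
  assumes "a \<le> C" "b \<le> n" "e \<le> (d * \<beta> * D\<^sup>2) ^ p"
  shows "3 * int a * int b * int e \<le> X" "int a * int b * int e \<le> X"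
proof -
  have "3 * a * b * e \<le> 3 * C * n * (d * \<beta> * D\<^sup>2) ^ p"
    using assms by (intro mult_le_mono) auto
  then have "int (3 * a * b * e) \<le> X" unfolding X_eq by (simp only: of_nat_le_iff)
  then show *: "3 * int a * int b * int e \<le> X" by simp
  have "0 \<le> int a * int b * int e" by simp
  with * show "int a * int b * int e \<le> X" by linarith
qed

lemma scale_le_base: "D\<^sup>2 ^ p \<le> (d * \<beta> * D\<^sup>2) ^ p" "(\<beta> * D) ^ p \<le> (d * \<beta> * D\<^sup>2) ^ p"
    "\<beta> * D \<le> (d * \<beta> * D\<^sup>2) ^ p" "D \<le> (d * \<beta> * D\<^sup>2) ^ p" "\<beta> \<le> (d * \<beta> * D\<^sup>2) ^ p"
    "k \<le> C"
proof -
  have 1: "1 * 1 * D\<^sup>2 \<le> d * \<beta> * D\<^sup>2" using d_ge \<beta>_ge by (intro mult_le_mono) auto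
  then show "D\<^sup>2 ^ p \<le> (d * \<beta> * D\<^sup>2) ^ p" by (intro power_mono) auto
  have 2: "1 * \<beta> * (D * 1) \<le> d * \<beta> * (D * D)" using d_ge D_ge by (intro mult_le_mono) auto
  then show "(\<beta> * D) ^ p \<le> (d * \<beta> * D\<^sup>2) ^ p" by (intro power_mono) (auto simp: power2_eq_square)
  moreover have "\<beta> * D \<le> (\<beta> * D) ^ p" using p_ge \<beta>_ge D_ge by (intro self_le_power) auto
  ultimately show 3: "\<beta> * D \<le> (d * \<beta> * D\<^sup>2) ^ p" by simp
  have "1 * D \<le> \<beta> * D" "\<beta> * 1 \<le> \<beta> * D" using D_ge \<beta>_ge by (intro mult_le_mono; simp)+
  with 3 show "D \<le> (d * \<beta> * D\<^sup>2) ^ p" "\<beta> \<le> (d * \<beta> * D\<^sup>2) ^ p" by linarith+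
  have "k + 1 \<le> (k + 1) ^ (d - 1)" using d_ge by (intro self_le_power) auto
  moreover have "1 * (k + 1) ^ (d - 1) \<le> 2 * d * (k + 1) ^ (d - 1)"
    using d_ge by (intro mult_le_mono) auto
  ultimately show "k \<le> C" unfolding C_eq by linarith
qed

lemma small_le_X: "2 \<le> X" "int D \<le> X" "int k \<le> X" "int C \<le> X" "int n \<le> X" "int \<beta> \<le> X"
    "int (\<beta> * D) \<le> X"
proof -
  note * = scale_le_base base_ge_1 n_ge C_pos
  show "2 \<le> X" using le_X(1)[of 1 1 1] * by simp
  show "int D \<le> X" using le_X(2)[of 1 1 D] * by simp
  show "int C \<le> X" using le_X(2)[of C 1 1] * by simp
  then show "int k \<le> X" using * by linarith
  show "int n \<le> X" using le_X(2)[of 1 n 1] * by simp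
  show "int \<beta> \<le> X" using le_X(2)[of 1 1 \<beta>] * by simp
  show "int (\<beta> * D) \<le> X" using le_X(2)[of 1 1 "\<beta> * D"] * by simp
qed

lemma abs_cone_sum_le:
  assumes "\<And>b. b \<in> set bs \<Longrightarrow> \<bar>f b\<bar> \<le> E" "0 \<le> E"
  shows "\<bar>cone_sum f bs c\<bar> \<le> int (length bs) * E"
  using assms
proof (induction bs)
  case (Cons b bs)
  then have "\<bar>cone_sum f bs c\<bar> \<le> int (length bs) * E" "\<bar>f b\<bar> \<le> E" by auto
  moreover have "\<bar>cone_sum f (b # bs) c\<bar> \<le> \<bar>f b\<bar> + \<bar>cone_sum f bs c\<bar>"
    by (auto simp: cone_sum_def)
  ultimately show ?case by (simp add: algebra_simps)
qed (simp add: cone_sum_def)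

lemma cone_sum_snoc: "cone_sum f (bs @ [b]) c = cone_sum f bs c + (if code b = c then f b else 0)"
  by (simp add: cone_sum_def)

lemma state_sample_vec:
  assumes "state bs m" "\<And>b. b \<in> set bs \<Longrightarrow> bounded_vec b" "c < C"
  shows "bounded_vec (sample m c)"
  using assms by (fastforce simp: state_def bounded_vec_def)

lemma state_le_X:
  assumes "state bs m" "\<And>b. b \<in> set bs \<Longrightarrow> bounded_vec b" "length bs \<le> n"
  shows "\<bar>m a\<bar> \<le> X"
proof (cases "a < 9")
  case True
  then have "a \<in> {0, 1, 2, 3, 4, 5, 6, 7, 8}" by auto
  then show ?thesis using assms small_le_X by (auto simp: state_def)
next
  case a: False
  define c j where "c = (a - 9) div stride d p" and "j = (a - 9) mod stride d p"
  have sp: "0 < stride d p" using d_ge by (simp add: stride_def)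
  have aj: "a = addr d p c j" and j: "j < stride d p"
    using a sp div_mult_mod_eq[of "a - 9" "stride d p"] by (simp_all add: addr_def c_def j_def)
  show ?thesis
  proof (cases "c < C")
    case False
    then have "C * stride d p \<le> c * stride d p" by (intro mult_le_mono1) simp
    then have "9 + C * stride d p \<le> a" unfolding aj addr_def by linarith
    with assms(1) small_le_X show ?thesis by (simp add: state_def)
  next
    case c: True
    show ?thesis
    proof (cases "j < d ^ p")
      case True
      have "\<bar>m a\<bar> = \<bar>cone_sum (monomial d p j) bs (int c)\<bar>"
        using assms(1) c True aj by (simp add: state_def)
      also have "\<dots> \<le> int (length bs) * int (\<beta> * D) ^ p"
        using assms(2) True by (intro abs_cone_sum_le abs_monomial_le) (auto simp: bounded_vec_def)
      also have "\<dots> = int 1 * int (length bs) * int ((\<beta> * D) ^ p)" by simp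
      also have "\<dots> \<le> X" using assms(3) scale_le_base C_pos by (intro le_X) auto
      finally show ?thesis .
    next
      case False
      then have "\<bar>m a\<bar> = \<bar>sample m c (j - d ^ p)\<bar>"
        using j aj by (auto simp: sample_def stride_def)
      also have "\<dots> \<le> int (\<beta> * D)" using state_sample_vec[OF assms(1,2) c] by (simp add: bounded_vec_def)
      finally show ?thesis using small_le_X by linarith
    qed
  qed
qed

lemma upd_mem_addr:
  assumes "c < C" "j < stride d p" "m 5 = int N"
  shows "upd_mem b m v (addr d p c j) =
    (if j < d ^ p then m (addr d p c j) + (if code b = int c then monomial d p j b else 0)
     else if c = N mod C \<and> v = 0 then b (j - d ^ p) else m (addr d p c j))"
proof -
  let ?a = "addr d p c j"
  have ne: "?a \<noteq> 5" "?a \<noteq> 6" "?a \<noteq> 7" by (simp_all add: addr_def)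
  have code: "c = nat (code b) \<longleftrightarrow> code b = int c" using code_range[of b] by auto
  have r: "addr d p (nat (code b)) 0 \<le> ?a \<and> ?a < addr d p (nat (code b)) 0 + d ^ p \<longleftrightarrow>
      code b = int c \<and> j < d ^ p"
    using addr_in_range_iff[OF assms(2), where i = 0 and n = "d ^ p" and c' = "nat (code b)" and c = c] code
    by (simp add: stride_def)
  have r': "addr d p (N mod C) (d ^ p) \<le> ?a \<and> ?a < addr d p (N mod C) (d ^ p) + d \<longleftrightarrow>
      c = N mod C \<and> \<not> j < d ^ p"
    using addr_in_range_iff[OF assms(2), where i = "d ^ p" and n = d and c' = "N mod C" and c = c] assms(2)
    by (auto simp: stride_def)
  have "upd_mem b m v ?a =
    (if addr d p (N mod C) (d ^ p) \<le> ?a \<and> ?a < addr d p (N mod C) (d ^ p) + d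
     then (if v = 0 then b (?a - addr d p (N mod C) (d ^ p))
       else sample m (N mod C) (?a - addr d p (N mod C) (d ^ p)))
     else if addr d p (nat (code b)) 0 \<le> ?a \<and> ?a < addr d p (nat (code b)) 0 + d ^ p
     then m (addr d p (nat (code b)) (?a - addr d p (nat (code b)) 0)) +
       monomial d p (?a - addr d p (nat (code b)) 0) b
     else m ?a)"
    unfolding upd_mem_def Let_def set_range_def using ne by (simp add: assms(3))
  then show ?thesis
    unfolding r r' using assms(2) by (auto simp: addr_def sample_def stride_def)
qed

lemma upd_mem_small:
  assumes "a < 9"
  shows "upd_mem b m v a =
    (if a = 5 then m 5 + 1 else if a = 6 then code b else if a = 7 then v else m a)"
  using assms by (auto simp: upd_mem_def Let_def set_range_def addr_def)

lemma upd_mem_large: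
  assumes "9 + C * stride d p \<le> a" "m 5 = int N"
  shows "upd_mem b m v a = m a"
proof -
  have c: "nat (code b) < C" using code_range[of b] by linarith
  have c': "N mod C < C" using C_pos by simp
  have "addr d p (nat (code b)) 0 + d ^ p \<le> a" "addr d p (N mod C) (d ^ p) + d \<le> a"
    using addr_less[OF c, of "stride d p - 1" d p] addr_less[OF c', of "stride d p - 1" d p] assms d_ge
    by (auto simp: addr_def stride_def)
  moreover have "9 \<le> a" using assms by simp
  ultimately show ?thesis using assms(2) by (auto simp: upd_mem_def Let_def set_range_def)
qed

lemma sample_upd_mem:
  assumes "c < C" "m 5 = int N" "bounded_vec b"
  shows "sample (upd_mem b m v) c = (if c = N mod C \<and> v = 0 then b else sample m c)"
  using assms upd_mem_addr[where N = N and m = m and b = b and v = v, OF assms(1) _ assms(2)]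
  by (auto simp: sample_def fun_eq_iff stride_def bounded_vec_def)

lemma state_upd_mem:
  assumes "state bs m" "bounded_vec b" "length bs < n" "0 \<le> v" "v \<le> int (length bs div C)"
  shows "state (bs @ [b]) (upd_mem b m v)"
proof -
  have N: "m 5 = int (length bs)" using assms(1) by (simp add: state_def)
  have "int (length bs div C) \<le> int n"
    using assms(3) div_le_dividend[of "length bs" C] by linarith
  then have v: "v \<le> int n" using assms(5) by linarith
  have "upd_mem b m v (addr d p c j) = cone_sum (monomial d p j) (bs @ [b]) (int c)"
    if "c < C" "j < d ^ p" for c j
    using upd_mem_addr[where N = "length bs" and m = m and b = b and v = v and j = j, OF that(1) _ N] that assms(1)
    by (simp add: cone_sum_snoc state_def stride_def)
  moreover have "sample (upd_mem b m v) c \<in> insert (\<lambda>_. 0) (set (bs @ [b]))" if "c < C" for c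
    using sample_upd_mem[where m = m and b = b and v = v, OF that N assms(2)] assms(1) that by (auto simp: state_def)
  moreover have "\<forall>a\<ge>9 + C * stride d p. upd_mem b m v a = 0"
    using upd_mem_large[where m = m and N = "length bs" and b = b and v = v, OF _ N] assms(1) by (simp add: state_def)
  ultimately show ?thesis
    using assms(1,4) v code_range[of b] unfolding state_def by (simp add: upd_mem_small)
qed

end

section \<open>The value computed by a query\<close>

context sketch
begin

definition moment :: "(nat \<Rightarrow> int) list \<Rightarrow> (nat \<Rightarrow> int) \<Rightarrow> int \<Rightarrow> int" where
  "moment bs x = cone_sum (\<lambda>b. dot d b x ^ p) bs"

text \<open>What has to be added to the term \<open>\<plusminus> dot d b x ^ p\<close>, the share of \<open>b\<close> in
  \<open>\<bar>moment bs x (code b)\<bar>\<close>, in order to obtain \<open>\<bar>dot d b x\<bar> ^ p\<close>.\<close>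

definition correction :: "(nat \<Rightarrow> int) list \<Rightarrow> (nat \<Rightarrow> int) \<Rightarrow> (nat \<Rightarrow> int) \<Rightarrow> int" where
  "correction bs x b =
     \<bar>dot d b x\<bar> ^ p - (if moment bs x (code b) < 0 then - 1 else 1) * dot d b x ^ p"

text \<open>For \<open>c < C\<close> this is the number of positions \<open>i < N\<close> with
  \<open>i mod C = c\<close>, the ceiling of (N - c) / C.\<close>

definition slot_size :: "nat \<Rightarrow> nat \<Rightarrow> nat" where
  "slot_size N c = (N + C - 1 - c) div C"

definition summand :: "(nat \<Rightarrow> int) list \<Rightarrow> (nat \<Rightarrow> int) \<Rightarrow> mem \<Rightarrow> nat \<Rightarrow> int" where
  "summand bs x m c =
     \<bar>moment bs x (int c)\<bar> + int (slot_size (length bs) c) * correction bs x (sample m c)"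

lemma abs_dot_le:
  assumes "bounded_vec b" "\<And>i. i < d \<Longrightarrow> \<bar>x i\<bar> \<le> int D"
  shows "\<bar>dot d b x\<bar> \<le> int (d * \<beta> * D\<^sup>2)"
proof -
  have "\<bar>dot d b x\<bar> \<le> (\<Sum>i<d. \<bar>b i * x i\<bar>)" unfolding dot_def by (rule sum_abs)
  also have "\<dots> \<le> (\<Sum>i<d. int (\<beta> * D) * int D)"
    using assms by (intro sum_mono) (auto simp: abs_mult bounded_vec_def simp del: of_nat_mult intro!: mult_mono)
  also have "\<dots> = int (d * \<beta> * D\<^sup>2)" by (simp add: power2_eq_square)
  finally show ?thesis .
qed

lemma abs_dot_power_le:
  assumes "bounded_vec b" "\<And>i. i < d \<Longrightarrow> \<bar>x i\<bar> \<le> int D"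
  shows "\<bar>dot d b x\<bar> ^ p \<le> int ((d * \<beta> * D\<^sup>2) ^ p)"
  using power_mono[OF abs_dot_le[OF assms] abs_ge_zero, where n = p] by simp

lemma correction_nonneg: "0 \<le> correction bs x b"
  using abs_ge_self[of "dot d b x ^ p"] abs_ge_minus_self[of "dot d b x ^ p"]
  by (auto simp: correction_def power_abs)

lemma correction_le: "correction bs x b \<le> 2 * \<bar>dot d b x\<bar> ^ p"
  using abs_ge_self[of "dot d b x ^ p"] abs_ge_minus_self[of "dot d b x ^ p"]
  by (auto simp: correction_def power_abs)

lemma slot_size_le: "slot_size N c \<le> N"
proof -
  have "N + C - 1 - c \<le> N * C + (C - 1)" using C_pos by (cases C) auto
  then have "slot_size N c \<le> (N * C + (C - 1)) div C" unfolding slot_size_def by (rule div_le_mono)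
  also have "\<dots> = N" using C_pos by (subst add.commute, subst div_mult_self1) auto
  finally show ?thesis .
qed

text \<open>The index set is arbitrary because the partial sums of the query loop are stored too and
  have to fit.\<close>

lemma sum_summand_bounds:
  assumes "state bs m" "\<And>b. b \<in> set bs \<Longrightarrow> bounded_vec b" "length bs \<le> n"
    and "\<And>i. i < d \<Longrightarrow> \<bar>x i\<bar> \<le> int D" "A \<subseteq> {..<C}"
  shows "\<bar>\<Sum>c\<in>A. summand bs x m c\<bar> \<le> X"
proof -
  let ?E = "int ((d * \<beta> * D\<^sup>2) ^ p)"
  \<comment> \<open>Once \<open>n * ?E\<close> for the moment and twice that for the weighted
    correction: the origin of the 3 in \<open>X\<close>.\<close>
  have s: "0 \<le> summand bs x m c \<and> summand bs x m c \<le> 3 * (int n * ?E)" if "c < C" for c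
  proof -
    have "\<bar>moment bs x (int c)\<bar> \<le> int (length bs) * ?E"
      unfolding moment_def using abs_dot_power_le[OF assms(2,4)]
      by (intro abs_cone_sum_le) (auto simp: power_abs)
    also have "\<dots> \<le> int n * ?E" using assms(3) by (intro mult_right_mono) auto
    finally have 1: "\<bar>moment bs x (int c)\<bar> \<le> int n * ?E" .
    have "bounded_vec (sample m c)" by (rule state_sample_vec[OF assms(1) _ that]) (rule assms(2))
    then have "\<bar>dot d (sample m c) x\<bar> ^ p \<le> ?E" by (rule abs_dot_power_le) (rule assms(4))
    then have "correction bs x (sample m c) \<le> 2 * ?E"
      using correction_le[of bs x "sample m c"] by linarith
    moreover have "int (slot_size (length bs) c) \<le> int n"
      using slot_size_le[of "length bs" c] assms(3) by linarith
    ultimately have "int (slot_size (length bs) c) * correction bs x (sample m c) \<le> int n * (2 * ?E)"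
      using correction_nonneg by (intro mult_mono) auto
    with 1 show ?thesis using correction_nonneg[of bs x "sample m c"]
      by (auto simp: summand_def intro!: add_nonneg_nonneg)
  qed
  have fin: "finite A" using assms(5) finite_subset by blast
  have "(\<Sum>c\<in>A. summand bs x m c) \<le> (\<Sum>c\<in>A. 3 * (int n * ?E))"
    using s assms(5) by (intro sum_mono) auto
  also have "\<dots> = 3 * int (card A) * int n * ?E" by simp
  also have "\<dots> \<le> X"
    using card_mono[OF _ assms(5)] by (intro le_X) auto
  finally have "(\<Sum>c\<in>A. summand bs x m c) \<le> X" .
  moreover have "0 \<le> (\<Sum>c\<in>A. summand bs x m c)" using s assms(5) by (intro sum_nonneg) auto
  ultimately show ?thesis by simp
qed

end

lemma abs_floor_mult_le:
  assumes "\<bar>y\<bar> \<le> real b"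
  shows "\<bar>\<lfloor>real D * y\<rfloor>\<bar> \<le> int (b * D)"
proof -
  have "\<bar>real D * y\<bar> \<le> real D * real b"
    unfolding abs_mult using assms by (intro mult_mono) auto
  then have "- real (b * D) \<le> real D * y" "real D * y \<le> real (b * D)"
    by (auto simp: mult.commute abs_le_iff)
  then have "- int (b * D) \<le> \<lfloor>real D * y\<rfloor>" "\<lfloor>real D * y\<rfloor> \<le> int (b * D)"
    by (simp_all add: le_floor_iff floor_le_iff)
  then show ?thesis by auto
qed

section \<open>Execution of the update and of the query\<close>

locale sketch_ram = sketch d p D k C n \<beta> s X + ram w s X G inp
  for d p D k C n \<beta> s X w G and inp :: "'i \<Rightarrow> real" +
  fixes \<iota> :: "nat \<Rightarrow> 'i"
begin

definition input_vec :: "nat \<Rightarrow> int" where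
  "input_vec = (\<lambda>i. if i < d then \<lfloor>real D * inp (\<iota> i)\<rfloor> else 0)"

lemma abs_input_vec_le:
  assumes "\<And>i. \<bar>inp i\<bar> \<le> real b"
  shows "\<bar>input_vec i\<bar> \<le> int (b * D)"
  using abs_floor_mult_le[OF assms, of D "\<iota> i"] by (simp add: input_vec_def)

lemma bounded_vec_input_vec: "(\<And>i. \<bar>inp i\<bar> \<le> real \<beta>) \<Longrightarrow> bounded_vec input_vec"
  using abs_input_vec_le[of \<beta>] by (simp add: bounded_vec_def) (simp add: input_vec_def)

lemma coord_exp_eval:
  assumes "m 2 = int D"
  shows "i < d \<Longrightarrow> ev inp m (coord_exp \<iota> i) = input_vec i" "ok s inp m (coord_exp \<iota> i)"
  using assms s_ge by (simp_all add: coord_exp_def input_vec_def)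

lemma code_exp_eval:
  assumes "m 3 = int k" "\<And>i. i < d \<Longrightarrow> ev inp m (ce i) = v i" "\<And>i. i < d \<Longrightarrow> ok s inp m (ce i)"
  shows "ev inp m (cone_code_exp (Mem (Num 3)) d ce) = code v"
    "ok s inp m (cone_code_exp (Mem (Num 3)) d ce)"
proof -
  show "ev inp m (cone_code_exp (Mem (Num 3)) d ce) = code v"
    using cone_code_cong[where v = "\<lambda>n. ev inp m (ce n)" and u = v and d = d] assms by (simp add: ev_cone_code_exp)
  show "ok s inp m (cone_code_exp (Mem (Num 3)) d ce)"
    using assms s_ge by (intro ok_cone_code_exp) auto
qed

lemma addr_bound: "c < C \<Longrightarrow> j < stride d p \<Longrightarrow> addr d p c j < s"
  using addr_less s_ge less_le_trans by blast

lemma bigstep_moments_com: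
  assumes "bnd m" "m 2 = int D" "m 6 = int c" "c < C" "com_deg (moments_com d p \<iota>) \<le> G"
    and "\<And>j. j < d ^ p \<Longrightarrow> \<bar>m (addr d p c j) + monomial d p j input_vec\<bar> \<le> X"
  shows "bigstep (moments_com d p \<iota>) m
    (return_pmf (set_range m (addr d p c 0) (d ^ p)
       (\<lambda>j. m (addr d p c j) + monomial d p j input_vec)))
    (straight_time (moments_com d p \<iota>))"
  unfolding moments_com_def
proof (rule bigstep_block_Store)
  show "addr d p c 0 + d ^ p \<le> s"
    using addr_bound[OF assms(4), of "stride d p - 1"] d_ge by (auto simp: addr_def stride_def)
  show "com_deg (block (map (\<lambda>j. Store (addr_exp d p (Mem (Num 6)) j)
     (Plus (Mem (addr_exp d p (Mem (Num 6)) j)) (monomial_exp d p j (coord_exp \<iota>)))) [0..<d ^ p])) \<le> G"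
    using assms(5) by (simp only: moments_com_def)
  fix j m'
  assume j: "j < d ^ p"
    and m'_def: "m' = set_range m (addr d p c 0) j (\<lambda>j. m (addr d p c j) + monomial d p j input_vec)"
  have small: "m' 2 = int D" "m' 6 = int c"
    using assms by (simp_all add: m'_def set_range_def addr_def)
  have "ev inp m' (Mem (Num 6)) = int c" using small by simp
  note a = ev_addr_exp[OF this, of d p j]
  have "m' (addr d p c j) = m (addr d p c j)" by (simp add: m'_def set_range_def addr_def)
  moreover have "addr d p c j < s" using addr_bound[OF assms(4), of j] j d_ge by (simp add: stride_def)
  moreover have "bnd m'" unfolding m'_def using assms j by (intro bnd_set_range) auto
  ultimately show "bnd m' \<and> ok s inp m' (addr_exp d p (Mem (Num 6)) j) \<and>
    ok s inp m' (Plus (Mem (addr_exp d p (Mem (Num 6)) j)) (monomial_exp d p j (coord_exp \<iota>))) \<and>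
    ev inp m' (addr_exp d p (Mem (Num 6)) j) = int (addr d p c 0 + j) \<and>
    ev inp m' (Plus (Mem (addr_exp d p (Mem (Num 6)) j)) (monomial_exp d p j (coord_exp \<iota>))) =
      m (addr d p c j) + monomial d p j input_vec"
    using a s_ge ok_monomial_exp[OF j coord_exp_eval(2)[where m = m', OF small(1)]]
      ev_monomial_exp[OF j coord_exp_eval(1)[where m = m', OF small(1)]]
    by (simp add: ok_addr_exp) (simp add: addr_def)
qed

lemma bigstep_sample_com:
  assumes "bnd m" "m 2 = int D" "m 4 = int C" "m 5 = int N" "com_deg (sample_com d p \<iota>) \<le> G"
    and "\<And>i. \<bar>input_vec i\<bar> \<le> X" "0 \<le> m 7"
  shows "bigstep (sample_com d p \<iota>) m
    (return_pmf (set_range m (addr d p (N mod C) (d ^ p)) d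
       (\<lambda>i. if m 7 = 0 then input_vec i else sample m (N mod C) i)))
    (straight_time (sample_com d p \<iota>))"
  unfolding sample_com_def
proof (rule bigstep_block_Store)
  let ?c = "N mod C"
  have c: "?c < C" using C_pos by simp
  show "addr d p ?c (d ^ p) + d \<le> s"
    using addr_bound[OF c, of "stride d p - 1"] d_ge by (auto simp: addr_def stride_def)
  show "com_deg (block (map (\<lambda>n. Store (addr_exp d p slot_exp (d ^ p + n))
     (if_neg_exp (Minus (Mem (Num 7)) (Num 1)) (coord_exp \<iota> n)
       (Mem (addr_exp d p slot_exp (d ^ p + n))))) [0..<d])) \<le> G"
    using assms(5) by (simp only: sample_com_def)
  fix j m'
  let ?f = "\<lambda>i. if m 7 = 0 then input_vec i else sample m ?c i"
  assume j: "j < d" and m'_def: "m' = set_range m (addr d p ?c (d ^ p)) j ?f"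
  have small: "m' 2 = int D" "m' 4 = int C" "m' 5 = int N" "m' 7 = m 7"
    using assms by (simp_all add: m'_def set_range_def addr_def)
  have "ev inp m' slot_exp = int ?c" using small
    by (simp add: slot_exp_def minus_mult_div_eq_mod flip: of_nat_mod)
  note a = ev_addr_exp[OF this, of d p "d ^ p + j"]
  have "m' (addr d p ?c (d ^ p + j)) = sample m ?c j" using j
    by (simp add: m'_def set_range_def addr_def sample_def)
  moreover have "addr d p ?c (d ^ p + j) < s" using addr_bound[OF c] j by (simp add: stride_def)
  moreover have "bnd m'" unfolding m'_def using assms j by (intro bnd_set_range) (auto simp: sample_def bnd_def)
  moreover have "ok s inp m' slot_exp" using s_ge small C_pos by (simp add: slot_exp_def)
  ultimately show "bnd m' \<and> ok s inp m' (addr_exp d p slot_exp (d ^ p + j)) \<and>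
    ok s inp m' (if_neg_exp (Minus (Mem (Num 7)) (Num 1)) (coord_exp \<iota> j)
       (Mem (addr_exp d p slot_exp (d ^ p + j)))) \<and>
    ev inp m' (addr_exp d p slot_exp (d ^ p + j)) = int (addr d p ?c (d ^ p) + j) \<and>
    ev inp m' (if_neg_exp (Minus (Mem (Num 7)) (Num 1)) (coord_exp \<iota> j)
       (Mem (addr_exp d p slot_exp (d ^ p + j)))) = ?f j"
    using a s_ge coord_exp_eval[where m = m', OF small(1)] small(4) j assms(7)
    by (simp add: ok_addr_exp) (simp add: addr_def)
qed

lemma bigstep_upd_com:
  assumes "state bs m" "\<And>b. b \<in> set bs \<Longrightarrow> bounded_vec b" "length bs < n" "bounded_vec input_vec"
    and "com_deg (upd_com d p \<iota>) \<le> G"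
  shows "bigstep (upd_com d p \<iota>) m
    (map_pmf (upd_mem input_vec m) (pmf_of_set {0..<int (length bs div C) + 1}))
    (straight_time (upd_com d p \<iota>))"
proof -
  let ?b = "input_vec" and ?N = "length bs"
  define c where "c = nat (code ?b)"
  have c: "c < C" "code ?b = int c" using code_range[of ?b] by (auto simp: c_def)
  have m: "m 2 = int D" "m 3 = int k" "m 4 = int C" "m 5 = int ?N" "m 6 \<le> int C"
    using assms(1) by (simp_all add: state_def)
  have bnd: "bnd m" using state_le_X[OF assms(1,2)] assms(3) by (simp add: bnd_def)
  have vecX: "bounded_vec v \<Longrightarrow> \<bar>v i\<bar> \<le> X" for v i
    using small_le_X(7) unfolding bounded_vec_def by (meson order_trans)
  note bX = vecX[OF assms(4)]
  let ?m1 = "m(6 := code ?b)"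
  let ?U = "pmf_of_set {0..<int (?N div C) + 1}"
  have degs: "deg (cone_code_exp (Mem (Num 3)) d (coord_exp \<iota>)) + deg (Num 6 :: 'i exp) \<le> G"
    "deg (Num 7 :: 'i exp) + deg (Plus (Div (Mem (Num 5)) (Mem (Num 4))) (Num 1) :: 'i exp) \<le> G"
    "com_deg (moments_com d p \<iota>) \<le> G" "com_deg (sample_com d p \<iota>) \<le> G"
    "deg (Num 5 :: 'i exp) + deg (Plus (Mem (Num 5)) (Num 1) :: 'i exp) \<le> G"
    using assms(5) by (simp_all add: upd_com_def)
  have 1: "bigstep (Store (Num 6) (cone_code_exp (Mem (Num 3)) d (coord_exp \<iota>))) m (return_pmf ?m1) 1"
    using bigstep_Store[OF bnd, of "Num 6" "cone_code_exp (Mem (Num 3)) d (coord_exp \<iota>)" 6]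
      degs s_ge code_exp_eval[where m = m and ce = "coord_exp \<iota>" and v = ?b, OF m(2)]
        coord_exp_eval[where m = m, OF m(1)] by simp
  have bnd1: "bnd ?m1" using bnd c small_le_X(4) by (auto simp: bnd_def)
  have "0 \<le> int ?N div int C" using C_pos by (simp add: pos_imp_zdiv_nonneg_iff)
  then have 2: "bigstep (Draw (Num 7) (Plus (Div (Mem (Num 5)) (Mem (Num 4))) (Num 1))) ?m1
      (map_pmf (\<lambda>v. ?m1(7 := v)) ?U) 1"
    using bigstep_Draw[OF bnd1, of "Num 7" "Plus (Div (Mem (Num 5)) (Mem (Num 4))) (Num 1)" 7]
      degs s_ge m C_pos by (simp add: zdiv_int)
  have 3: "bigstep (Seq (moments_com d p \<iota>) (Seq (sample_com d p \<iota>) (Store (Num 5) (Plus (Mem (Num 5)) (Num 1)))))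
      m' (return_pmf (upd_mem ?b m (m' 7)))
      (1 + straight_time (moments_com d p \<iota>) + (1 + straight_time (sample_com d p \<iota>) + 1))"
    if m': "m' \<in> set_pmf (map_pmf (\<lambda>v. ?m1(7 := v)) ?U)" for m'
  proof -
    from m' obtain v where v: "0 \<le> v" "v \<le> int (?N div C)" and m'_def: "m' = ?m1(7 := v)"
      by (auto simp: set_pmf_of_set)
    note st = state_upd_mem[OF assms(1,4,3) v]
    \<comment> \<open>All values written on the way occur in the final memory, which satisfies the
      invariant for the longer stream; this shows that the grown moments still fit.\<close>
    have newX: "\<bar>upd_mem ?b m v a\<bar> \<le> X" for a
      using state_le_X[OF st, of a] assms(2,3,4) by auto
    let ?f = "\<lambda>j. m (addr d p c j) + monomial d p j ?b"
    let ?m2 = "set_range m' (addr d p c 0) (d ^ p) ?f"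
    let ?m3 = "set_range ?m2 (addr d p (?N mod C) (d ^ p)) d (\<lambda>i. if v = 0 then ?b i else sample m (?N mod C) i)"
    have m'_addr: "m' (addr d p c' j) = m (addr d p c' j)" for c' j
      by (simp add: m'_def addr_def)
    have "v \<le> X" using newX[of 7] by (simp add: upd_mem_small)
    then have bnd': "bnd m'" using bnd1 v by (simp add: bnd_def m'_def)
    have fX: "\<bar>?f j\<bar> \<le> X" if "j < d ^ p" for j
      using newX[of "addr d p c j"]
        upd_mem_addr[where m = m and b = ?b and v = v and N = ?N and j = j, OF c(1) _ m(4)] that c(2)
      by (simp add: stride_def)
    have A: "bigstep (moments_com d p \<iota>) m' (return_pmf ?m2) (straight_time (moments_com d p \<iota>))"
      using bigstep_moments_com[where m = m' and c = c, OF bnd'] m c degs(3) fX by (simp add: m'_def addr_def)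
    have bnd2: "bnd ?m2" using bnd' fX by (intro bnd_set_range) auto
    have m2: "?m2 2 = int D" "?m2 4 = int C" "?m2 5 = int ?N" "?m2 7 = v"
      using m by (simp_all add: set_range_def m'_def addr_def)
    have s2: "sample ?m2 (?N mod C) = sample m (?N mod C)"
    proof -
      have "?m2 (addr d p c' (d ^ p + i)) = m (addr d p c' (d ^ p + i))" if "i < d" for c' i
        using addr_in_range_iff[of "d ^ p + i" d p 0 "d ^ p" c c'] that m'_addr[of c' "d ^ p + i"]
        by (auto simp: set_range_def stride_def)
      then show ?thesis by (auto simp: sample_def fun_eq_iff)
    qed
    have "0 \<le> ?m2 7" using v(1) m2(4) by simp
    from bigstep_sample_com[where m = ?m2 and N = ?N, OF bnd2 m2(1-3) degs(4) bX this]
    have B: "bigstep (sample_com d p \<iota>) ?m2 (return_pmf ?m3) (straight_time (sample_com d p \<iota>))"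
      unfolding m2(4) s2 .
    have bnd3: "bnd ?m3"
      using bnd2 bX vecX[OF state_sample_vec[OF assms(1,2), of "?N mod C"]] C_pos
      by (intro bnd_set_range[OF bnd2]) auto
    have m3: "?m3 5 = int ?N" using m2 by (simp add: set_range_def addr_def)
    have Cc: "bigstep (Store (Num 5) (Plus (Mem (Num 5)) (Num 1))) ?m3 (return_pmf (?m3(5 := int ?N + 1))) 1"
      using bigstep_Store[OF bnd3, of "Num 5" "Plus (Mem (Num 5)) (Num 1)" 5] degs(5) s_ge m3 by simp
    have "?m3(5 := int ?N + 1) = upd_mem ?b m (m' 7)"
      using m(4) by (simp add: upd_mem_def Let_def m'_def c_def)
    with bigstep_Seq_det[OF A bigstep_Seq_det[OF B Cc]] show ?thesis by simp
  qed
  have "bind_pmf (map_pmf (\<lambda>v. ?m1(7 := v)) ?U) (\<lambda>m'. return_pmf (upd_mem ?b m (m' 7)))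
      = map_pmf (upd_mem ?b m) ?U"
    by (simp add: map_pmf_def bind_assoc_pmf bind_return_pmf)
  with bigstep_Seq_det[OF 1 bigstep_Seq[OF 2 3]] show ?thesis
    by (simp add: upd_com_def)
qed

end

context sketch_ram
begin

lemma sum_cone_sum_monomial:
  "(\<Sum>j<d ^ p. cone_sum (monomial d p j) bs c * monomial d p j x) = moment bs x c"
proof (induction bs rule: rev_induct)
  case (snoc b bs)
  then show ?case
    by (simp add: moment_def cone_sum_snoc distrib_right sum.distrib sum_monomial_mult)
qed (simp add: moment_def cone_sum_def)

lemma moment_exp_eval:
  assumes "m 2 = int D" "\<And>c j. c < C \<Longrightarrow> j < d ^ p \<Longrightarrow> m (addr d p c j) = cone_sum (monomial d p j) bs (int c)"
    and "ev inp m e = int c" "c < C" "ok s inp m e"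
  shows "ev inp m (moment_exp d p \<iota> e) = moment bs input_vec (int c)"
    "ok s inp m (moment_exp d p \<iota> e)"
proof -
  have "ev inp m (Times (Mem (addr_exp d p e j)) (monomial_exp d p j (coord_exp \<iota>))) =
      cone_sum (monomial d p j) bs (int c) * monomial d p j input_vec" if "j < d ^ p" for j
    using assms that ev_addr_exp[OF assms(3), of d p j] ev_monomial_exp[OF that coord_exp_eval(1)[where m = m, OF assms(1)]]
    by simp
  then show "ev inp m (moment_exp d p \<iota> e) = moment bs input_vec (int c)"
    by (simp add: moment_exp_def sum_list_distinct_conv_sum_set o_def atLeast0LessThan
        sum_cone_sum_monomial[symmetric] del: ev.simps cong: sum.cong_simp)
  show "ok s inp m (moment_exp d p \<iota> e)"
    using ev_addr_exp[OF assms(3), of d p] assms(5) addr_bound[OF assms(4)]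
      ok_monomial_exp[OF _ coord_exp_eval(2)[where m = m, OF assms(1)]]
    by (auto simp: moment_exp_def ok_addr_exp stride_def)
qed

lemma summand_exp_eval:
  assumes "state bs m" "\<And>a. a \<notin> {0, 1, 8} \<Longrightarrow> m' a = m a" "m' 8 = int c" "c < C"
  shows "ev inp m' (summand_exp d p \<iota>) = summand bs input_vec m c"
    "ok s inp m' (summand_exp d p \<iota>)"
proof -
  have m: "m' 2 = int D" "m' 3 = int k" "m' 4 = int C" "m' 5 = int (length bs)"
    using assms by (simp_all add: state_def)
  have ma: "m' (addr d p c j) = m (addr d p c j)" for c j
    using assms(2)[of "addr d p c j"] by (simp add: addr_def)
  have mom: "m' (addr d p c j) = cone_sum (monomial d p j) bs (int c)" if "c < C" "j < d ^ p" for c j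
    using assms(1) that by (simp add: state_def ma)
  have c8: "ev inp m' (Mem (Num 8)) = int c" "ok s inp m' (Mem (Num 8))"
    using assms(3) s_ge by simp_all
  note coord = coord_exp_eval[where m = m', OF m(1)]
  have samp: "ev inp m' (sample_exp d p i) = sample m c i" "ok s inp m' (sample_exp d p i)" if "i < d" for i
    using that ev_addr_exp[OF c8(1), of d p "d ^ p + i"] c8 addr_bound[OF assms(4), of "d ^ p + i"]
    by (simp_all add: sample_exp_def ma sample_def stride_def ok_addr_exp del: ev.simps(3))
  note code = code_exp_eval[where m = m' and ce = "sample_exp d p" and v = "sample m c", OF m(2) samp]
  have codec: "ev inp m' (cone_code_exp (Mem (Num 3)) d (sample_exp d p)) = int (nat (code (sample m c)))"
    "nat (code (sample m c)) < C"
    using code(1) code_range[of "sample m c"] by simp_all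
  note mom1 = moment_exp_eval[where m = m' and bs = bs, OF m(1) mom c8(1) assms(4) c8(2)]
  note mom2 = moment_exp_eval[where m = m' and bs = bs, OF m(1) mom codec code(2)]
  have "ev inp m' (dot_exp d p \<iota>) = (\<Sum>i<d. sample m c i * input_vec i)"
    using samp(1) coord(1)
    by (simp add: dot_exp_def sum_list_distinct_conv_sum_set o_def atLeast0LessThan cong: sum.cong_simp)
  then have dot: "ev inp m' (dot_exp d p \<iota>) = dot d (sample m c) input_vec"
    by (simp add: dot_def)
  have dok: "ok s inp m' (dot_exp d p \<iota>)" using samp(2) coord(2) by (auto simp: dot_exp_def)
  \<comment> \<open>\<open>c < C\<close> prevents truncation of the subtraction on
    \<open>nat\<close>.\<close>
  have "int (length bs) + int C - 1 - int c = int (length bs + C - 1 - c)" using assms(4) by simp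
  then have "ev inp m' slot_size_exp = int (slot_size (length bs) c)"
    using m assms(3) by (simp add: slot_size_exp_def slot_size_def zdiv_int)
  moreover have "ok s inp m' slot_size_exp" using m C_pos s_ge by (simp add: slot_size_exp_def)
  ultimately show "ev inp m' (summand_exp d p \<iota>) = summand bs input_vec m c"
    "ok s inp m' (summand_exp d p \<iota>)"
    using mom1 mom2 dot dok code_range[of "sample m c"]
    by (simp_all add: summand_exp_def summand_def correction_def)
qed

lemma bigstep_query_com:
  assumes "state bs m" "\<And>b. b \<in> set bs \<Longrightarrow> bounded_vec b" "length bs \<le> n" "\<And>i. \<bar>inp i\<bar> \<le> 1"
    and "com_deg (query_com d p \<iota>) \<le> G"
  shows "\<exists>m' t. bigstep (query_com d p \<iota>) m (return_pmf m') t \<and>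
    m' 0 = (\<Sum>c<C. summand bs input_vec m c) \<and> m' 1 = int (length bs * D ^ (2 * p))"
proof -
  let ?den = "int (length bs * D ^ (2 * p))"
  \<comment> \<open>The memory of the query loop at counter \<open>i\<close>. The counter runs
    downwards, so the slots already added, with sum \<open>S i\<close>, are those from
    \<open>i\<close> on.\<close>
  define Q where "Q i T = m(0 := T, 1 := ?den, 8 := int i)" for i T
  define S where "S i = (\<Sum>c\<in>{i..<C}. summand bs input_vec m c)" for i
  have bnd: "bnd m" using state_le_X[OF assms(1,2,3)] by (simp add: bnd_def)
  have m: "m 2 = int D" "m 4 = int C" "m 5 = int (length bs)" "m 0 = 0"
    using assms(1) by (simp_all add: state_def)
  have x: "\<bar>input_vec i\<bar> \<le> int D" for i using abs_input_vec_le[of 1 i] assms(4) by simp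
  have SX: "\<bar>S i\<bar> \<le> X" for i
    unfolding S_def by (rule sum_summand_bounds[OF assms(1,2,3) x]) auto
  have "D ^ (2 * p) = D\<^sup>2 ^ p" by (simp add: power_mult)
  then have "\<bar>?den\<bar> \<le> X"
    using le_X(2)[of 1 "length bs" "D ^ (2 * p)"] scale_le_base(1) assms(3) C_pos by simp
  then have bndQ: "bnd (Q i T)" if "i \<le> C" "\<bar>T\<bar> \<le> X" for i T
    using bnd that small_le_X(4) by (auto simp: bnd_def Q_def)
  have bnd8: "bnd (m(8 := int C))" using bnd small_le_X(4) by (simp add: bnd_def)
  have degs: "deg (Num 8 :: 'i exp) + deg (Mem (Num 4) :: 'i exp) \<le> G"
    "deg (Num 1 :: 'i exp) + deg (Times (Mem (Num 5)) (power_exp (Mem (Num 2)) (2 * p)) :: 'i exp) \<le> G"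
    "deg (Mem (Num 8) :: 'i exp) \<le> G"
    "deg (Num 8 :: 'i exp) + deg (Minus (Mem (Num 8)) (Num 1) :: 'i exp) \<le> G"
    "deg (Num 0 :: 'i exp) + deg (Plus (Mem (Num 0)) (summand_exp d p \<iota>)) \<le> G"
    using assms(5) by (simp_all add: query_com_def)
  have 1: "bigstep (Store (Num 8) (Mem (Num 4))) m (return_pmf (m(8 := int C))) 1"
    using bigstep_Store[OF bnd, of "Num 8" "Mem (Num 4)" 8] degs s_ge m by simp
  have "(m(8 := int C))(1 := ?den) = Q C (S C)"
    using m(4) by (auto simp: Q_def S_def fun_eq_iff)
  then have 2: "bigstep (Store (Num 1) (Times (Mem (Num 5)) (power_exp (Mem (Num 2)) (2 * p))))
      (m(8 := int C)) (return_pmf (Q C (S C))) 1"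
    using bigstep_Store[OF bnd8, of "Num 1" "Times (Mem (Num 5)) (power_exp (Mem (Num 2)) (2 * p))" 1]
      degs s_ge m by simp
  define Inv where "Inv m' \<longleftrightarrow> (\<exists>i\<le>C. m' = Q i (S i))" for m'
  have "\<exists>m' t. bigstep (While (Mem (Num 8))
           (Seq (Store (Num 8) (Minus (Mem (Num 8)) (Num 1)))
                (Store (Num 0) (Plus (Mem (Num 0)) (summand_exp d p \<iota>))))) (Q C (S C)) (return_pmf m') t \<and>
      Inv m' \<and> ev inp m' (Mem (Num 8)) \<le> 0"
  proof (rule bigstep_While[where f = "\<lambda>m'. nat (m' 8)"])
    show "Inv (Q C (S C))" by (auto simp: Inv_def)
    show "deg (Mem (Num 8) :: 'i exp) \<le> G" by (rule degs)
    fix m' assume "Inv m'"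
    then obtain i where i: "i \<le> C" "m' = Q i (S i)" by (auto simp: Inv_def)
    have bm': "bnd m'" using i bndQ SX by simp
    then show "bnd m' \<and> ok s inp m' (Mem (Num 8))" using s_ge by simp
    assume "0 < ev inp m' (Mem (Num 8))"
    then have "0 < i" using i by (simp add: Q_def)
    then obtain i' where i': "i = Suc i'" "i' < C" using i by (cases i) auto
    have A: "bigstep (Store (Num 8) (Minus (Mem (Num 8)) (Num 1))) m' (return_pmf (Q i' (S i))) 1"
      using bigstep_Store[OF bm', of "Num 8" "Minus (Mem (Num 8)) (Num 1)" 8] degs s_ge i i'
      by (simp add: Q_def)
    note sm = summand_exp_eval[where m = m and m' = "Q i' (S i)" and c = i', OF assms(1) _ _ i'(2)]
    have "S i' = S i + summand bs input_vec m i'"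
      using i' by (simp add: S_def sum.atLeast_Suc_lessThan)
    then have B: "bigstep (Store (Num 0) (Plus (Mem (Num 0)) (summand_exp d p \<iota>))) (Q i' (S i))
        (return_pmf (Q i' (S i'))) 1"
      using bigstep_Store[of "Q i' (S i)" "Num 0" "Plus (Mem (Num 0)) (summand_exp d p \<iota>)" 0]
        degs s_ge bndQ[of i' "S i"] SX i' sm by (simp add: Q_def fun_upd_twist)
    have "Inv (Q i' (S i'))" unfolding Inv_def using i'(2) by (intro exI[of _ i']) simp
    moreover have "nat (Q i' (S i') 8) < nat (m' 8)" using i i' by (simp add: Q_def)
    ultimately show "\<exists>m'' t. bigstep (Seq (Store (Num 8) (Minus (Mem (Num 8)) (Num 1)))
                (Store (Num 0) (Plus (Mem (Num 0)) (summand_exp d p \<iota>)))) m' (return_pmf m'') t \<and>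
        Inv m'' \<and> nat (m'' 8) < nat (m' 8)" using bigstep_Seq_det[OF A B] by blast
  qed
  then obtain m' t i where *: "bigstep (While (Mem (Num 8))
           (Seq (Store (Num 8) (Minus (Mem (Num 8)) (Num 1)))
                (Store (Num 0) (Plus (Mem (Num 0)) (summand_exp d p \<iota>))))) (Q C (S C)) (return_pmf m') t"
    "m' = Q i (S i)" "ev inp m' (Mem (Num 8)) \<le> 0" by (auto simp: Inv_def)
  then have "i = 0" by (simp add: Q_def)
  have "bigstep (query_com d p \<iota>) m (return_pmf m') (1 + 1 + (1 + 1 + t))"
    unfolding query_com_def by (rule bigstep_Seq_det[OF 1 bigstep_Seq_det[OF 2 *(1)]])
  with *(2) \<open>i = 0\<close> show ?thesis by (auto simp: Q_def S_def atLeast0LessThan)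
qed

end

text \<open>The assumptions determine \<open>D\<close> and \<open>k\<close> as the least positive
  integers at which the tests of the two loops fail. Both loops count upwards from 1, so they stop
  exactly there and never exceed these values.\<close>

lemma (in sketch) bigstep_init_com:
  assumes "ram w X G (\<lambda>_ :: unit. \<epsilon>)" "0 < \<epsilon>" "1 \<le> real D * \<epsilon>" "(real D - 1) * \<epsilon> < 1"
    and "D\<^sup>2 \<le> k ^ (d + 2 * p - 1)" "\<And>j. 1 \<le> j \<Longrightarrow> j < k \<Longrightarrow> j ^ (d + 2 * p - 1) < D\<^sup>2"
    and "com_deg (init_com d p) \<le> G"
  shows "\<exists>m t. ram.bigstep w s (\<lambda>_ :: unit. \<epsilon>) (init_com d p) (\<lambda>_. 0) (return_pmf m) t \<and> state [] m"
proof -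
  let ?inp = "\<lambda>_ :: unit. \<epsilon>"
  interpret ram w s X G ?inp by fact
  let ?q = "d + 2 * p - 1"
  define M :: "nat \<Rightarrow> nat \<Rightarrow> mem" where "M a b = (\<lambda>_. 0)(2 := int a, 3 := int b)" for a b
  let ?e1 = "Minus (Num 1) (Input () (Mem (Num 2)))"
  let ?e2 = "Minus (Times (Mem (Num 2)) (Mem (Num 2))) (power_exp (Mem (Num 3)) ?q) :: unit exp"
  let ?c1 = "Store (Num 2) (Plus (Mem (Num 2)) (Num 1)) :: unit com"
  let ?c2 = "Store (Num 3) (Plus (Mem (Num 3)) (Num 1)) :: unit com"
  let ?e3 = "Times (Num (2 * int d)) (power_exp (Plus (Mem (Num 3)) (Num 1)) (d - 1)) :: unit exp"
  have degs: "deg (Num 2 :: unit exp) + deg (Num 1 :: unit exp) \<le> G" "deg ?e1 \<le> G" "com_deg ?c1 \<le> G"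
    "deg (Num 3 :: unit exp) + deg (Num 1 :: unit exp) \<le> G" "deg ?e2 \<le> G" "com_deg ?c2 \<le> G"
    "deg (Num 4 :: unit exp) + deg ?e3 \<le> G"
    using assms(7) by (simp_all add: init_com_def del: deg.simps)
  have bnd0: "bnd (\<lambda>_. 0)" using small_le_X(1) by (simp add: bnd_def)
  have bndM: "bnd (M a b)" if "a \<le> D" "b \<le> k" for a b
  proof -
    have "int a \<le> X" "int b \<le> X" using that small_le_X(2,3) by linarith+
    then show ?thesis using small_le_X(1) by (auto simp: bnd_def M_def)
  qed
  have 1: "bigstep (Store (Num 2) (Num 1)) (\<lambda>_. 0) (return_pmf (M 1 0)) 1"
    using bigstep_Store[OF bnd0, of "Num 2" "Num 1" 2] degs s_ge by (simp add: M_def fun_upd_def if_distrib cong: if_cong)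
  define I1 where "I1 m \<longleftrightarrow> (\<exists>a. 1 \<le> a \<and> a \<le> D \<and> m = M a 0)" for m
  have "\<exists>m' t. bigstep (While ?e1 ?c1) (M 1 0) (return_pmf m') t \<and> I1 m' \<and> ev ?inp m' ?e1 \<le> 0"
  proof (rule bigstep_While[where f = "\<lambda>m. D - nat (m 2)"])
    show "I1 (M 1 0)" using D_ge by (auto simp: I1_def)
    show "deg ?e1 \<le> G" by (rule degs)
    fix m assume "I1 m"
    then obtain a where a: "1 \<le> a" "a \<le> D" "m = M a 0" by (auto simp: I1_def)
    show "bnd m \<and> ok s ?inp m ?e1" using a bndM s_ge by simp
    assume "0 < ev ?inp m ?e1"
    then have "real a * \<epsilon> < 1" using a by (simp add: M_def floor_less_iff)
    then have "a \<noteq> D" using assms(3) by auto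
    then have aD: "a < D" using a by simp
    have eq: "M (a + 1) 0 = m(2 := ev ?inp m (Plus (Mem (Num 2)) (Num 1)))"
      using a by (auto simp: M_def fun_eq_iff)
    have "bigstep ?c1 m (return_pmf (M (a + 1) 0)) 1"
      unfolding eq by (rule bigstep_Store) (use degs(3) s_ge a bndM in simp_all)
    moreover have "I1 (M (a + 1) 0)" unfolding I1_def using aD by (intro exI[of _ "a + 1"]) simp
    moreover have "D - nat (M (a + 1) 0 2) < D - nat (m 2)" using a aD by (simp add: M_def)
    ultimately show "\<exists>m' t. bigstep ?c1 m (return_pmf m') t \<and> I1 m' \<and> D - nat (m' 2) < D - nat (m 2)"
      by blast
  qed
  then obtain a t1 where a: "bigstep (While ?e1 ?c1) (M 1 0) (return_pmf (M a 0)) t1" "1 \<le> a" "a \<le> D"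
    "ev ?inp (M a 0) ?e1 \<le> 0" by (auto simp: I1_def)
  have "1 \<le> real a * \<epsilon>" using a(4) by (simp add: M_def le_floor_iff)
  then have "(real D - 1) * \<epsilon> < real a * \<epsilon>" using assms(4) by linarith
  then have "a = D" using assms(2) a(3) by simp
  have 2: "bigstep (Store (Num 3) (Num 1)) (M D 0) (return_pmf (M D 1)) 1"
    using bigstep_Store[OF bndM, of D 0 "Num 3" "Num 1" 3] degs s_ge by (simp add: M_def)
  define I2 where "I2 m \<longleftrightarrow> (\<exists>b. 1 \<le> b \<and> b \<le> k \<and> m = M D b)" for m
  have pos: "0 < ev ?inp (M D b) ?e2 \<longleftrightarrow> b ^ ?q < D\<^sup>2" for b
    by (simp add: M_def power2_eq_square flip: of_nat_power of_nat_mult)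
  have "\<exists>m' t. bigstep (While ?e2 ?c2) (M D 1) (return_pmf m') t \<and> I2 m' \<and> ev ?inp m' ?e2 \<le> 0"
  proof (rule bigstep_While[where f = "\<lambda>m. k - nat (m 3)"])
    show "I2 (M D 1)" using k_ge by (auto simp: I2_def)
    show "deg ?e2 \<le> G" by (rule degs)
    fix m assume "I2 m"
    then obtain b where b: "1 \<le> b" "b \<le> k" "m = M D b" by (auto simp: I2_def)
    show "bnd m \<and> ok s ?inp m ?e2" using b bndM s_ge by simp
    assume "0 < ev ?inp m ?e2"
    then have "b \<noteq> k" using b(3) pos assms(5) by (metis linorder_not_less)
    then have bk: "b < k" using b by simp
    have eq: "M D (b + 1) = m(3 := ev ?inp m (Plus (Mem (Num 3)) (Num 1)))"
      using b by (auto simp: M_def fun_eq_iff)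
    have "bigstep ?c2 m (return_pmf (M D (b + 1))) 1"
      unfolding eq by (rule bigstep_Store) (use degs(6) s_ge b bndM in simp_all)
    moreover have "I2 (M D (b + 1))" unfolding I2_def using bk by (intro exI[of _ "b + 1"]) simp
    moreover have "k - nat (M D (b + 1) 3) < k - nat (m 3)" using b bk by (simp add: M_def)
    ultimately show "\<exists>m' t. bigstep ?c2 m (return_pmf m') t \<and> I2 m' \<and> k - nat (m' 3) < k - nat (m 3)"
      by blast
  qed
  then obtain b t2 where b: "bigstep (While ?e2 ?c2) (M D 1) (return_pmf (M D b)) t2" "1 \<le> b" "b \<le> k"
    "ev ?inp (M D b) ?e2 \<le> 0" by (auto simp: I2_def)
  have "b = k" using b pos assms(6) by (metis linorder_not_less le_neq_implies_less)
  have 3: "bigstep (Store (Num 4) ?e3) (M D k) (return_pmf ((M D k)(4 := int C))) 1"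
    using bigstep_Store[OF bndM, of D k "Num 4" ?e3 4] degs(7) s_ge by (simp add: M_def C_eq add.commute)
  let ?m = "(M D k)(4 := int C)"
  have "bigstep (init_com d p) (\<lambda>_. 0) (return_pmf ?m) (1 + 1 + (1 + t1 + (1 + 1 + (1 + t2 + 1))))"
    unfolding init_com_def
    using bigstep_Seq_det[OF 1 bigstep_Seq_det[OF a(1)[unfolded \<open>a = D\<close>] bigstep_Seq_det[OF 2
          bigstep_Seq_det[OF b(1)[unfolded \<open>b = k\<close>] 3]]]] .
  moreover have "?m a = 0" if "9 \<le> a" for a using that by (simp add: M_def)
  then have "state [] ?m"
    unfolding state_def by (auto simp: M_def addr_def cone_sum_def sample_def fun_eq_iff)
  ultimately show ?thesis by blast
qed

section \<open>The sampling error\<close>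

context sketch
begin

text \<open>Admitting \<open>c' = C\<close> lets both \<open>N\<close> and \<open>Suc N\<close> be
  written with the quotient \<open>N div C\<close>, even when \<open>Suc N\<close> is a multiple of
  \<open>C\<close>.\<close>

lemma slot_size_div_mod:
  assumes "c < C" "c' \<le> C"
  shows "slot_size (r * C + c') c = r + (if c < c' then 1 else 0)"
proof (cases "c < c'")
  case True
  have "r * C + c' + C - 1 - c = (c' - 1 - c) + (r + 1) * C"
    using True assms by (simp add: algebra_simps)
  then have "slot_size (r * C + c') c = ((c' - 1 - c) + (r + 1) * C) div C" by (simp only: slot_size_def)
  also have "\<dots> = r + 1" using True assms by (subst div_mult_self1) auto
  finally show ?thesis using True by simp
next
  case False
  have "r * C + c' + C - 1 - c = (c' + C - 1 - c) + r * C"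
    using False assms by simp
  then have "slot_size (r * C + c') c = ((c' + C - 1 - c) + r * C) div C" by (simp only: slot_size_def)
  also have "\<dots> = r" using False assms by (subst div_mult_self1) auto
  finally show ?thesis using False by simp
qed

lemma slot_size_Suc:
  assumes "c < C"
  shows "slot_size (Suc N) c = slot_size N c + (if c = N mod C then 1 else 0)"
    and "slot_size N (N mod C) = N div C"
proof -
  have l: "N mod C < C" using C_pos by simp
  then show "slot_size N (N mod C) = N div C"
    using slot_size_div_mod[of "N mod C" "N mod C" "N div C"] by simp
  show "slot_size (Suc N) c = slot_size N c + (if c = N mod C then 1 else 0)"
    using slot_size_div_mod[OF assms, of "N mod C" "N div C"] slot_size_div_mod[OF assms, of "Suc (N mod C)" "N div C"] l
    by (auto simp: less_Suc_eq)
qed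

definition deviation :: "((nat \<Rightarrow> int) \<Rightarrow> real) \<Rightarrow> (nat \<Rightarrow> int) list \<Rightarrow> mem \<Rightarrow> real" where
  "deviation g bs m =
     (\<Sum>c<C. real (slot_size (length bs) c) * g (sample m c)) - (\<Sum>b\<leftarrow>bs. g b)"

text \<open>Only the slot of the new row changes, its size growing from \<open>r\<close> to
  \<open>r + 1\<close>. The estimate changes by \<open>(r + 1) * g b - r * g old\<close> or by
  \<open>g old\<close>, the true sum by \<open>g b\<close>.\<close>

lemma deviation_upd_mem:
  assumes "state bs m" "bounded_vec b"
  defines "r \<equiv> real (length bs div C)" and "old \<equiv> sample m (length bs mod C)"
  shows "deviation g (bs @ [b]) (upd_mem b m v) =
    deviation g bs m + (if v = 0 then r * (g b - g old) else g old - g b)"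
proof -
  let ?N = "length bs" and ?c' = "length bs mod C"
  have N: "m 5 = int ?N" using assms(1) by (simp add: state_def)
  have c': "?c' \<in> {..<C}" using C_pos by simp
  let ?f = "\<lambda>c. real (slot_size (Suc ?N) c) * g (sample (upd_mem b m v) c)"
  let ?h = "\<lambda>c. real (slot_size ?N c) * g (sample m c)"
  have "sum ?f ({..<C} - {?c'}) = sum ?h ({..<C} - {?c'})"
    using sample_upd_mem[where m = m and N = ?N and b = b and v = v, OF _ N assms(2)]
    by (intro sum.cong) (auto simp: slot_size_Suc(1))
  then have "sum ?f {..<C} - sum ?h {..<C} = ?f ?c' - ?h ?c'"
    using sum.remove[OF _ c', of ?f] sum.remove[OF _ c', of ?h] by simp
  also have "\<dots> = (if v = 0 then r * (g b - g old) else g old - g b) + g b"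
    using sample_upd_mem[where m = m and N = ?N and b = b and v = v, OF _ N assms(2), of ?c'] c'
      slot_size_Suc[of ?c' ?N] by (simp add: r_def old_def algebra_simps)
  finally show ?thesis by (simp add: deviation_def)
qed

text \<open>The increment of the deviation has mean zero, so the squares simply add up.\<close>

lemma expectation_deviation_square:
  assumes "state bs m" "bounded_vec b"
  defines "r \<equiv> length bs div C" and "old \<equiv> sample m (length bs mod C)"
  shows "measure_pmf.expectation (map_pmf (upd_mem b m) (pmf_of_set {0..<int r + 1}))
      (\<lambda>m'. (deviation g (bs @ [b]) m')\<^sup>2) = (deviation g bs m)\<^sup>2 + real r * (g b - g old)\<^sup>2"
proof -
  let ?e = "deviation g bs m" and ?\<Delta> = "g b - g old"
  let ?h = "\<lambda>v :: int. (?e + (if v = 0 then real r * ?\<Delta> else g old - g b))\<^sup>2"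
  have S: "{0..<int r + 1} = insert 0 {1..<int r + 1}" by auto
  have "measure_pmf.expectation (map_pmf (upd_mem b m) (pmf_of_set {0..<int r + 1}))
      (\<lambda>m'. (deviation g (bs @ [b]) m')\<^sup>2) =
      measure_pmf.expectation (pmf_of_set {0..<int r + 1}) ?h"
    using deviation_upd_mem[OF assms(1,2), of g] unfolding r_def old_def by simp
  also have "\<dots> = (\<Sum>v\<in>{0..<int r + 1}. ?h v) / (real r + 1)"
    by (subst integral_pmf_of_set) auto
  also have "(\<Sum>v\<in>{0..<int r + 1}. ?h v) = ?h 0 + (\<Sum>v\<in>{1..<int r + 1}. (?e + (g old - g b))\<^sup>2)"
    unfolding S by (subst sum.insert) (auto intro!: arg_cong2[where f = "(+)"] sum.cong)
  \<comment> \<open>One outcome moves the deviation by \<open>r * ?\<Delta>\<close> and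
    \<open>r\<close> equally likely ones by \<open>- ?\<Delta>\<close>. The cross terms cancel, and
    the squares sum to \<open>(r\<^sup>2 + r) * ?\<Delta>\<^sup>2\<close>.\<close>
  also have "\<dots> = (real r + 1) * (?e\<^sup>2 + real r * ?\<Delta>\<^sup>2)"
    by (simp add: power2_eq_square algebra_simps)
  also have "\<dots> / (real r + 1) = ?e\<^sup>2 + real r * ?\<Delta>\<^sup>2" by simp
  finally show ?thesis .
qed

lemma expectation_deviation_square_le:
  assumes "state bs m" "bounded_vec b" "\<And>v. v \<in> insert (\<lambda>_. 0) (set (bs @ [b])) \<Longrightarrow> 0 \<le> g v \<and> g v \<le> \<Gamma>"
  shows "measure_pmf.expectation (map_pmf (upd_mem b m) (pmf_of_set {0..<int (length bs div C) + 1}))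
      (\<lambda>m'. (deviation g (bs @ [b]) m')\<^sup>2) \<le> (deviation g bs m)\<^sup>2 + \<Gamma>\<^sup>2 * real (length bs div C)"
proof -
  let ?old = "sample m (length bs mod C)"
  have "?old \<in> insert (\<lambda>_. 0) (set bs)" using assms(1) C_pos by (simp add: state_def)
  then have "\<bar>g b - g ?old\<bar> \<le> \<bar>\<Gamma>\<bar>" using assms(3)[of b] assms(3)[of ?old] by auto
  then have "(g b - g ?old)\<^sup>2 \<le> \<Gamma>\<^sup>2" by (simp add: abs_le_square_iff)
  then have "real (length bs div C) * (g b - g ?old)\<^sup>2 \<le> \<Gamma>\<^sup>2 * real (length bs div C)"
    by (subst mult.commute) (intro mult_right_mono, auto)
  with expectation_deviation_square[OF assms(1,2), of g] show ?thesis by simp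
qed

definition scaled_row :: "(nat \<Rightarrow> 'd::finite) \<Rightarrow> real ^ 'd \<Rightarrow> nat \<Rightarrow> int" where
  "scaled_row \<iota> a = (\<lambda>i. if i < d then \<lfloor>real D * a $ \<iota> i\<rfloor> else 0)"

text \<open>The bound is for all \<open>g\<close> under one law \<open>M\<close>: the
  \<open>g\<close> used later depends on the complete stream and on the query. During the induction
  over the rows it stays fixed. Finite support turns expectations into finite sums.\<close>

lemma stream_invariant:
  fixes \<iota> :: "nat \<Rightarrow> 'd::finite" and as :: "(real ^ 'd) list"
  assumes "\<exists>m t. ram.bigstep w s (\<lambda>_. \<epsilon>) init (\<lambda>_. 0) (return_pmf m) t \<and> state [] m"
    and "ram w X G (\<lambda>_ :: unit. \<epsilon>)"
    and "\<And>a. a \<in> set as \<Longrightarrow> ram w X G (\<lambda>i. a $ i)"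
    and "\<And>a i. a \<in> set as \<Longrightarrow> \<bar>a $ i\<bar> \<le> real \<beta>"
    and "length as \<le> n" "com_deg (upd_com d p \<iota>) \<le> G"
  shows "\<exists>M. stream_state w s \<epsilon> init (upd_com d p \<iota>) as = map_pmf Some M \<and> finite (set_pmf M) \<and>
    (\<forall>m \<in> set_pmf M. state (map (scaled_row \<iota>) as) m) \<and>
    (\<forall>g \<Gamma>. (\<forall>v \<in> insert (\<lambda>_. 0) (set (map (scaled_row \<iota>) as)). 0 \<le> g v \<and> g v \<le> \<Gamma>) \<longrightarrow>
      measure_pmf.expectation M (\<lambda>m. (deviation g (map (scaled_row \<iota>) as) m)\<^sup>2) \<le>
        \<Gamma>\<^sup>2 * (\<Sum>i<length as. real (i div C)))"
  using assms(3-5)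
proof (induction as rule: rev_induct)
  case Nil
  from assms(1) obtain m t where m: "ram.bigstep w s (\<lambda>_. \<epsilon>) init (\<lambda>_. 0) (return_pmf m) t" "state [] m"
    by blast
  have "stream_state w s \<epsilon> init (upd_com d p \<iota>) [] = map_pmf Some (return_pmf m)"
    using ram.bigstep_exec[OF assms(2) m(1)] by (simp add: stream_state_def)
  moreover have "deviation g [] m = 0" for g
    using slot_size_div_mod[of _ 0 0] by (simp add: deviation_def)
  ultimately show ?case using m(2) by (intro exI[of _ "return_pmf m"]) simp
next
  case (snoc a as)
  then obtain M where M: "stream_state w s \<epsilon> init (upd_com d p \<iota>) as = map_pmf Some M"
    "finite (set_pmf M)" "\<And>m. m \<in> set_pmf M \<Longrightarrow> state (map (scaled_row \<iota>) as) m"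
    "\<And>g \<Gamma>. (\<forall>v \<in> insert (\<lambda>_. 0) (set (map (scaled_row \<iota>) as)). 0 \<le> g v \<and> g v \<le> \<Gamma>) \<Longrightarrow>
      measure_pmf.expectation M (\<lambda>m. (deviation g (map (scaled_row \<iota>) as) m)\<^sup>2) \<le>
        \<Gamma>\<^sup>2 * (\<Sum>i<length as. real (i div C))" by auto
  interpret A: sketch_ram d p D k C n \<beta> s X w G "\<lambda>i. a $ i" \<iota>
    using snoc.prems(1) sketch_axioms by (intro sketch_ram.intro) auto
  let ?bs = "map (scaled_row \<iota>) as" and ?b = "scaled_row \<iota> a"
  let ?U = "\<lambda>m. map_pmf (upd_mem ?b m) (pmf_of_set {0..<int (length as div C) + 1})"
  have iv: "A.input_vec = ?b" by (simp add: A.input_vec_def scaled_row_def)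
  have vb: "bounded_vec (scaled_row \<iota> a')" if "a' \<in> set (as @ [a])" for a'
  proof -
    interpret A': sketch_ram d p D k C n \<beta> s X w G "\<lambda>i. a' $ i" \<iota>
      using snoc.prems(1)[OF that] sketch_axioms by (intro sketch_ram.intro)
    have "A'.input_vec = scaled_row \<iota> a'" by (simp add: A'.input_vec_def scaled_row_def)
    with A'.bounded_vec_input_vec snoc.prems(2)[OF that] show ?thesis by simp
  qed
  have big: "A.bigstep (upd_com d p \<iota>) m (?U m) (straight_time (upd_com d p \<iota>))" if "m \<in> set_pmf M" for m
    using A.bigstep_upd_com[OF M(3)[OF that]] vb snoc.prems(3) assms(6) by (auto simp: iv)
  have "stream_state w s \<epsilon> init (upd_com d p \<iota>) (as @ [a]) =
      bind_pmf M (\<lambda>m. exec w s (\<lambda>i. a $ i) (upd_com d p \<iota>) m)"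
    using M(1) by (simp add: stream_state_def bind_exec_def bind_map_pmf)
  also have "\<dots> = bind_pmf M (\<lambda>m. map_pmf Some (?U m))"
    using A.bigstep_exec[OF big] by (intro bind_pmf_cong refl) auto
  also have "\<dots> = map_pmf Some (bind_pmf M ?U)" by (simp add: map_bind_pmf)
  finally have eq: "stream_state w s \<epsilon> init (upd_com d p \<iota>) (as @ [a]) = map_pmf Some (bind_pmf M ?U)" .
  have finU: "finite (set_pmf (?U m))" for m by (simp add: set_pmf_of_set)
  have fin: "finite (set_pmf (bind_pmf M ?U))" using M(2) finU by simp
  have st: "state (map (scaled_row \<iota>) (as @ [a])) m'" if m': "m' \<in> set_pmf (bind_pmf M ?U)" for m'
  proof -
    from m' obtain m v where mv: "m \<in> set_pmf M" "0 \<le> v" "v \<le> int (length as div C)" "m' = upd_mem ?b m v"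
      by (auto simp: set_pmf_of_set)
    then show ?thesis using state_upd_mem[OF M(3)[OF mv(1)] vb[of a], of v] snoc.prems(3) by simp
  qed
  have var: "measure_pmf.expectation (bind_pmf M ?U) (\<lambda>m. (deviation g (map (scaled_row \<iota>) (as @ [a])) m)\<^sup>2) \<le>
        \<Gamma>\<^sup>2 * (\<Sum>i<length (as @ [a]). real (i div C))"
    if g: "\<forall>v \<in> insert (\<lambda>_. 0) (set (map (scaled_row \<iota>) (as @ [a]))). 0 \<le> g v \<and> g v \<le> \<Gamma>" for g \<Gamma>
  proof -
    let ?r = "\<Gamma>\<^sup>2 * real (length as div C)"
    have "measure_pmf.expectation (bind_pmf M ?U) (\<lambda>m. (deviation g (map (scaled_row \<iota>) (as @ [a])) m)\<^sup>2) =
        (\<Sum>m\<in>set_pmf M. pmf M m * measure_pmf.expectation (?U m) (\<lambda>m. (deviation g (?bs @ [?b]) m)\<^sup>2))"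
      using pmf_expectation_bind[OF M(2) finU, where h = "\<lambda>m. (deviation g (?bs @ [?b]) m)\<^sup>2"] by simp
    also have "\<dots> \<le> (\<Sum>m\<in>set_pmf M. pmf M m * ((deviation g ?bs m)\<^sup>2 + ?r))"
      using expectation_deviation_square_le[OF M(3) vb[of a], of _ g \<Gamma>] g
      by (intro sum_mono mult_left_mono) (auto simp del: integral_map_pmf)
    also have "\<dots> = (\<Sum>m\<in>set_pmf M. (deviation g ?bs m)\<^sup>2 * pmf M m) + (\<Sum>m\<in>set_pmf M. pmf M m) * ?r"
      by (simp add: sum.distrib sum_distrib_right distrib_left mult.commute)
    also have "\<dots> = measure_pmf.expectation M (\<lambda>m. (deviation g ?bs m)\<^sup>2) + ?r"
      using M(2) by (simp add: sum_pmf_eq_1 integral_measure_pmf_real[of "set_pmf M"])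
    also have "\<dots> \<le> \<Gamma>\<^sup>2 * (\<Sum>i<length as. real (i div C)) + ?r"
      using M(4)[of g \<Gamma>] g by auto
    finally show ?thesis by (simp add: algebra_simps)
  qed
  from eq fin st var show ?case by blast
qed

text \<open>Replace \<open>i div C\<close> by \<open>i / C\<close>. The factor 1/C is the gain of
  \<open>C\<close> slots over a single reservoir.\<close>

lemma sum_div_le: "(\<Sum>i<N. real (i div C)) \<le> (real N)\<^sup>2 / (2 * real C)"
proof (induction N)
  case (Suc N)
  have "real (N div C) \<le> real N / real C" by (simp add: of_nat_div_le_of_nat)
  with Suc have "(\<Sum>i<Suc N. real (i div C)) \<le> (real N)\<^sup>2 / (2 * real C) + real N / real C" by simp
  also have "\<dots> \<le> (real (Suc N))\<^sup>2 / (2 * real C)"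
    using C_pos by (simp add: field_simps power2_eq_square)
  finally show ?case .
qed simp

section \<open>The exact part of the estimate and the size of the corrections\<close>

lemma sum_cone_sum:
  "(\<Sum>c<C. \<sigma> (int c) * cone_sum f bs (int c)) = (\<Sum>b\<leftarrow>bs. \<sigma> (code b) * f b)"
proof (induction bs rule: rev_induct)
  case (snoc b bs)
  have c: "nat (code b) < C" "int (nat (code b)) = code b" using code_range[of b] by auto
  have "(\<Sum>c<C. \<sigma> (int c) * (if code b = int c then f b else 0)) =
      (\<Sum>c<C. if c = nat (code b) then \<sigma> (code b) * f b else 0)"
    using code_range[of b] by (intro sum.cong) auto
  also have "\<dots> = \<sigma> (code b) * f b" using c by simp
  finally show ?case using snoc by (simp add: cone_sum_snoc distrib_left sum.distrib)
qed (simp add: cone_sum_def)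

text \<open>The absolute value of a moment is the moment times its sign, hence a sum over the rows
  of the cone with a common sign; the correction is the remainder row by row.\<close>

lemma sum_abs_moment_plus_correction:
  "(\<Sum>c<C. \<bar>moment bs x (int c)\<bar>) + (\<Sum>b\<leftarrow>bs. correction bs x b) = (\<Sum>b\<leftarrow>bs. \<bar>dot d b x\<bar> ^ p)"
proof -
  let ?\<sigma> = "\<lambda>c. if moment bs x c < 0 then - 1 else 1 :: int"
  have "(\<Sum>c<C. \<bar>moment bs x (int c)\<bar>) = (\<Sum>c<C. ?\<sigma> (int c) * moment bs x (int c))"
    by (intro sum.cong) auto
  also have "\<dots> = (\<Sum>b\<leftarrow>bs. ?\<sigma> (code b) * dot d b x ^ p)"
    unfolding moment_def by (rule sum_cone_sum)
  finally show ?thesis by (simp add: correction_def sum_list_subtractf)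
qed

text \<open>On rounded data the estimate is exact except for replacing the sum of the corrections by
  its sampled version.\<close>

lemma sum_summand:
  "real_of_int (\<Sum>c<C. summand bs x m c) =
    of_int (\<Sum>b\<leftarrow>bs. \<bar>dot d b x\<bar> ^ p) + deviation (\<lambda>b. of_int (correction bs x b)) bs m"
proof -
  have "real_of_int (\<Sum>b\<leftarrow>cs. correction bs x b) = (\<Sum>b\<leftarrow>cs. real_of_int (correction bs x b))" for cs
    by (induction cs) simp_all
  moreover have "(\<Sum>c<C. summand bs x m c) = (\<Sum>b\<leftarrow>bs. \<bar>dot d b x\<bar> ^ p) - (\<Sum>b\<leftarrow>bs. correction bs x b) +
      (\<Sum>c<C. int (slot_size (length bs) c) * correction bs x (sample m c))"
    using sum_abs_moment_plus_correction[of bs x] by (simp add: summand_def sum.distrib)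
  ultimately show ?thesis by (simp add: deviation_def)
qed

text \<open>The correction vanishes if the row agrees in sign with the moment of its cone. If it
  disagrees, some row of the cone must have the opposite sign to produce that moment.\<close>

lemma correction_nonzero_imp_cut:
  assumes "b \<in> set bs" "correction bs x b \<noteq> 0"
  shows "\<exists>u. code b = code u \<and> dot d b x * dot d u x < 0"
proof -
  define y where "y u = dot d u x ^ p" for u
  have ex: "\<exists>u \<in> set cs. code u = c \<and> h u < 0" if "cone_sum h cs c < 0" for h :: "_ \<Rightarrow> int" and cs c
    using that by (induction cs) (auto simp: cone_sum_def split: if_splits, fastforce+)
  \<comment> \<open>For odd \<open>p\<close> the sign survives the power and for even
    \<open>p\<close> the premise is impossible; the contradiction covers both.\<close>
  have opp: "dot d b x * dot d u x < 0" if "y b * y u < 0" for u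
  proof (rule ccontr)
    assume "\<not> dot d b x * dot d u x < 0"
    then have "0 \<le> (dot d b x * dot d u x) ^ p" by (intro zero_le_power) simp
    with that show False by (simp add: y_def power_mult_distrib)
  qed
  have corr: "correction bs x b = \<bar>y b\<bar> - (if moment bs x (code b) < 0 then - 1 else 1) * y b"
    by (simp add: correction_def y_def power_abs)
  show ?thesis
  proof (cases "moment bs x (code b) < 0")
    case True
    then have "0 < y b" using assms(2) corr by (auto simp: abs_if split: if_splits)
    moreover have "cone_sum y bs (code b) < 0" using True by (simp add: moment_def y_def[abs_def])
    then obtain u where "code u = code b" "y u < 0" using ex by blast
    ultimately show ?thesis using opp[of u] by (metis mult_pos_neg)
  next
    case False
    then have yb: "y b < 0" using assms(2) corr by (auto simp: abs_if split: if_splits)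
    have "\<exists>u. code u = code b \<and> 0 < y u"
    proof (rule ccontr)
      assume no: "\<not> ?thesis"
      \<comment> \<open>Without a positive term the sum is at most the negative term of
        \<open>b\<close> itself, which occurs in \<open>bs\<close>; a nonnegative moment is then
        impossible.\<close>
      have ub: "cone_sum y cs (code b) \<le> (if b \<in> set cs then y b else 0)" for cs
      proof (induction cs)
        case (Cons u cs)
        have step: "cone_sum y (u # cs) (code b) =
            (if code u = code b then y u else 0) + cone_sum y cs (code b)"
          by (simp add: cone_sum_def)
        have u: "(if code u = code b then y u else 0) \<le> 0" using no by (auto simp: not_less)
        have t: "cone_sum y cs (code b) \<le> 0" using Cons yb by (cases "b \<in> set cs") simp_all
        show ?case
        proof (cases "u = b")
          case True
          with t step show ?thesis by simp
        next
          case False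
          then have "(b \<in> set (u # cs)) = (b \<in> set cs)" by auto
          moreover have "cone_sum y (u # cs) (code b) \<le> cone_sum y cs (code b)" using u step by linarith
          ultimately show ?thesis using Cons by (simp only:)
        qed
      qed (simp add: cone_sum_def)
      have "0 \<le> cone_sum y bs (code b)" using False by (simp add: moment_def y_def[abs_def])
      moreover have "cone_sum y bs (code b) \<le> y b" using ub[of bs] assms(1) by simp
      ultimately show False using yb by linarith
    qed
    then show ?thesis using yb opp by (metis mult_neg_pos)
  qed
qed

text \<open>A nonzero correction means a cut cone, where \<open>\<bar>dot d b x\<bar>\<close> is at
  most 2/k times \<open>\<beta> * D\<close>, the bound on the row, times \<open>d * D\<close>, the
  bound on the sum of the \<open>\<bar>x i\<bar>\<close>.\<close>

lemma correction_le_of_vec: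
  assumes "b \<in> set bs" "bounded_vec b" "\<And>i. i < d \<Longrightarrow> \<bar>x i\<bar> \<le> int D"
  shows "real_of_int (correction bs x b) \<le> 2 * (2 * real (d * \<beta>) / real k) ^ p * real D ^ (2 * p)"
proof (cases "correction bs x b = 0")
  case False
  then obtain u where "code b = code u" "dot d b x * dot d u x < 0"
    using correction_nonzero_imp_cut assms(1) by blast
  then have "of_int \<bar>dot d b x\<bar> \<le>
      of_int (max_norm d b) * (2 / real_of_int (int k)) * of_int (\<Sum>j<d. \<bar>x j\<bar>)"
    using k_ge by (intro abs_dot_le_of_cone_cut[of "int k" d b u x]) auto
  also have "\<dots> \<le> real (\<beta> * D) * (2 / real k) * real (d * D)"
  proof (intro mult_mono)
    have "1 \<le> \<beta> * D" using \<beta>_ge D_ge by simp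
    then have "1 \<le> int (\<beta> * D)" using of_nat_mono[of 1 "\<beta> * D"] by simp
    then have "max_norm d b \<le> int (\<beta> * D)" using assms(2) unfolding bounded_vec_def by (intro max_norm_le) auto
    then show "of_int (max_norm d b) \<le> real (\<beta> * D)" by linarith
    have "(\<Sum>j<d. \<bar>x j\<bar>) \<le> (\<Sum>j<d. int D)" using assms(3) by (intro sum_mono) auto
    then have "(\<Sum>j<d. \<bar>x j\<bar>) \<le> int (d * D)" by simp
    then show "of_int (\<Sum>j<d. \<bar>x j\<bar>) \<le> real (d * D)" by linarith
  qed auto
  also have "\<dots> = (2 * real (d * \<beta>) / real k) * (real D)\<^sup>2" by (simp add: power2_eq_square)
  finally have "of_int \<bar>dot d b x\<bar> ^ p \<le> ((2 * real (d * \<beta>) / real k) * (real D)\<^sup>2) ^ p"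
    by (intro power_mono) auto
  then have "of_int (\<bar>dot d b x\<bar> ^ p) \<le> (2 * real (d * \<beta>) / real k) ^ p * real D ^ (2 * p)"
    unfolding power_mult_distrib power_mult of_int_power .
  moreover have "real_of_int (correction bs x b) \<le> 2 * of_int (\<bar>dot d b x\<bar> ^ p)"
    using correction_le[of bs x b] by linarith
  ultimately show ?thesis by linarith
qed simp

lemma prob_deviation:
  assumes "finite (set_pmf M)" "D\<^sup>2 \<le> k ^ (d + 2 * p - 1)" "0 < \<epsilon>" "1 \<le> real D * \<epsilon>" "bs \<noteq> []"
    and "\<And>b. b \<in> set bs \<Longrightarrow> bounded_vec b" "\<And>i. i < d \<Longrightarrow> \<bar>x i\<bar> \<le> int D"
    and "\<And>g \<Gamma>. (\<forall>v \<in> insert (\<lambda>_. 0) (set bs). 0 \<le> g v \<and> g v \<le> \<Gamma>) \<Longrightarrow>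
      measure_pmf.expectation M (\<lambda>m. (deviation g bs m)\<^sup>2) \<le> \<Gamma>\<^sup>2 * (\<Sum>i<length bs. real (i div C))"
  shows "9 / 10 \<le> measure_pmf.prob M {m. \<bar>deviation (\<lambda>b. of_int (correction bs x b)) bs m\<bar> \<le>
    5 * (2 * real (d * \<beta>)) ^ p * \<epsilon> * (real (length bs) * real D ^ (2 * p))}"
proof -
  let ?g = "\<lambda>b. real_of_int (correction bs x b)" and ?N = "real (length bs)"
  define h where "h = (2 * real (d * \<beta>)) ^ p"
  define \<Gamma> where "\<Gamma> = 2 * (2 * real (d * \<beta>) / real k) ^ p * real D ^ (2 * p)"
  \<comment> \<open>Chebyshev's threshold. The second moment is at most
    \<open>2 * h\<^sup>2 * \<epsilon>\<^sup>2\<close> times the square of the last factor, and 2/25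
    \<le> 1/10 accounts for the 5.\<close>
  define thr where "thr = 5 * h * \<epsilon> * (?N * real D ^ (2 * p))"
  have h: "0 < h" using d_ge \<beta>_ge by (simp add: h_def)
  have N: "0 < ?N" using assms(5) by simp
  have thr: "0 < thr" using h N assms(3) D_ge by (simp add: thr_def)
  have \<Gamma>0: "0 \<le> \<Gamma>" by (simp add: \<Gamma>_def)
  have "?g (\<lambda>_. 0) = 0" using p_ge by (simp add: correction_def dot_def)
  then have "\<forall>v \<in> insert (\<lambda>_. 0) (set bs). 0 \<le> ?g v \<and> ?g v \<le> \<Gamma>"
    using correction_nonneg[of bs x] correction_le_of_vec[of _ bs x, folded \<Gamma>_def] assms(6,7) \<Gamma>0
    by auto
  from assms(8)[OF this] have "measure_pmf.expectation M (\<lambda>m. (deviation ?g bs m)\<^sup>2)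
      \<le> \<Gamma>\<^sup>2 * (?N\<^sup>2 / (2 * real C))"
    using mult_left_mono[OF sum_div_le[of "length bs"], of "\<Gamma>\<^sup>2"] by simp
  also have "\<dots> \<le> thr\<^sup>2 / 10"
  proof -
    have k: "0 < real k" using k_ge by simp
    have "real k ^ (d - 1) \<le> real C"
    proof -
      have "k ^ (d - 1) \<le> (k + 1) ^ (d - 1)" by (intro power_mono) auto
      also have "\<dots> \<le> C" using d_ge by (simp add: C_eq)
      finally show ?thesis by (metis of_nat_le_iff of_nat_power)
    qed
    then have "real k ^ (2 * p) * real k ^ (d - 1) \<le> real k ^ (2 * p) * real C"
      by (intro mult_left_mono) auto
    moreover have "real k ^ (2 * p) * real k ^ (d - 1) = real k ^ (d + 2 * p - 1)"
    proof -
      have "2 * p + (d - 1) = d + 2 * p - 1" using d_ge by simp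
      then show ?thesis by (metis power_add)
    qed
    moreover have "(real D)\<^sup>2 \<le> real k ^ (d + 2 * p - 1)"
      using assms(2) by (metis of_nat_le_iff of_nat_power)
    \<comment> \<open>Here the choice of \<open>k\<close> pays off: with
      \<open>D * \<epsilon> \<ge> 1\<close> it bounds the factor 1 / (k^(2p) C) of the second moment
      by the square of \<open>\<epsilon>\<close>.\<close>
    ultimately have DkC: "(real D)\<^sup>2 \<le> real k ^ (2 * p) * real C" by linarith
    have "1 \<le> (real D * \<epsilon>)\<^sup>2" using assms(4) by (simp add: one_le_power)
    also have "\<dots> \<le> real k ^ (2 * p) * real C * \<epsilon>\<^sup>2"
      unfolding power_mult_distrib using DkC by (intro mult_right_mono) auto
    finally have 1: "1 \<le> real k ^ (2 * p) * real C * \<epsilon>\<^sup>2" .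
    have G: "\<Gamma>\<^sup>2 = 4 * h\<^sup>2 * (real D ^ (2 * p))\<^sup>2 / real k ^ (2 * p)"
      by (simp add: \<Gamma>_def h_def power_divide power_mult_distrib power_mult[symmetric] mult.commute)
    let ?Y = "h\<^sup>2 * (real D ^ (2 * p))\<^sup>2 * ?N\<^sup>2"
    have "\<Gamma>\<^sup>2 * (?N\<^sup>2 / (2 * real C)) = 2 * ?Y / (real k ^ (2 * p) * real C)"
      unfolding G using k C_pos by (simp add: field_simps)
    also have "\<dots> \<le> 2 * ?Y * \<epsilon>\<^sup>2"
    proof -
      have "2 * ?Y * 1 \<le> 2 * ?Y * (real k ^ (2 * p) * real C * \<epsilon>\<^sup>2)"
        using 1 by (intro mult_left_mono) auto
      then show ?thesis using k C_pos by (simp add: pos_divide_le_eq mult_ac)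
    qed
    also have "\<dots> \<le> thr\<^sup>2 / 10"
      by (simp add: thr_def power_mult_distrib mult_ac)
    finally show ?thesis .
  qed
  finally have "measure_pmf.expectation M (\<lambda>m. (deviation ?g bs m)\<^sup>2) / thr\<^sup>2 \<le> 1 / 10"
    using thr by (simp add: field_simps)
  moreover have "measure_pmf.prob M {m \<in> space (measure_pmf M). \<bar>deviation ?g bs m\<bar> \<ge> thr} \<le>
      measure_pmf.expectation M (\<lambda>m. (deviation ?g bs m)\<^sup>2) / thr\<^sup>2"
    using assms(1) thr by (intro measure_pmf.second_moment_method integrable_measure_pmf_finite) auto
  ultimately have "measure_pmf.prob M {m \<in> space (measure_pmf M). \<bar>deviation ?g bs m\<bar> \<ge> thr} \<le> 1 / 10"
    by (rule order_trans[rotated])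
  then have "measure_pmf.prob M {m. \<bar>deviation ?g bs m\<bar> \<ge> thr} \<le> 1 / 10" by simp
  moreover have "1 - measure_pmf.prob M {m. \<bar>deviation ?g bs m\<bar> \<ge> thr} =
      measure_pmf.prob M (UNIV - {m. \<bar>deviation ?g bs m\<bar> \<ge> thr})"
    using measure_pmf.prob_compl[of "{m. \<bar>deviation ?g bs m\<bar> \<ge> thr}" M] by simp
  moreover have "\<dots> \<le> measure_pmf.prob M {m. \<bar>deviation ?g bs m\<bar> \<le> thr}"
    by (intro measure_pmf.finite_measure_mono) auto
  ultimately show ?thesis by (simp add: thr_def h_def)
qed

end

section \<open>The rounding error and the choice of the parameters\<close>

text \<open>After division by \<open>R\<close> both arguments lie in the unit interval, where the
  \<open>p\<close>-th power has Lipschitz constant \<open>p\<close>; \<open>R \<ge> 1\<close> lets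
  the remaining 1/R be dropped.\<close>

lemma abs_power_diff_le:
  fixes u v R :: real
  assumes "0 < R" "\<bar>u\<bar> \<le> R" "\<bar>v\<bar> \<le> R" "1 \<le> R"
  shows "\<bar>\<bar>u\<bar> ^ p - \<bar>v\<bar> ^ p\<bar> \<le> R ^ p * (real p * \<bar>u - v\<bar>)"
proof -
  have "\<bar>(\<bar>u\<bar> / R) ^ p - (\<bar>v\<bar> / R) ^ p\<bar> \<le> real p * \<bar>\<bar>u\<bar> / R - \<bar>v\<bar> / R\<bar>"
    using norm_power_diff[of "\<bar>u\<bar> / R" "\<bar>v\<bar> / R" p] assms by simp
  also have "\<bar>\<bar>u\<bar> / R - \<bar>v\<bar> / R\<bar> \<le> \<bar>u - v\<bar> / R"
    using assms by (simp add: abs_triangle_ineq3 divide_right_mono flip: diff_divide_distrib)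
  also have "\<dots> \<le> \<bar>u - v\<bar>" using assms by (simp add: pos_divide_le_eq mult_le_cancel_left1)
  finally have "\<bar>(\<bar>u\<bar> / R) ^ p - (\<bar>v\<bar> / R) ^ p\<bar> \<le> real p * \<bar>u - v\<bar>"
    by (simp add: mult_left_mono)
  then have "R ^ p * \<bar>(\<bar>u\<bar> / R) ^ p - (\<bar>v\<bar> / R) ^ p\<bar> \<le> R ^ p * (real p * \<bar>u - v\<bar>)"
    using assms by (intro mult_left_mono) auto
  moreover have "R ^ p * \<bar>(\<bar>u\<bar> / R) ^ p - (\<bar>v\<bar> / R) ^ p\<bar> = \<bar>\<bar>u\<bar> ^ p - \<bar>v\<bar> ^ p\<bar>"
  proof -
    have "(\<bar>u\<bar> / R) ^ p - (\<bar>v\<bar> / R) ^ p = (\<bar>u\<bar> ^ p - \<bar>v\<bar> ^ p) / R ^ p"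
      by (simp add: power_divide diff_divide_distrib)
    then show ?thesis using assms by simp
  qed
  ultimately show ?thesis by simp
qed

lemma abs_sum_list_diff_le:
  fixes f g :: "'a \<Rightarrow> real"
  assumes "\<And>a. a \<in> set as \<Longrightarrow> \<bar>f a - g a\<bar> \<le> e"
  shows "\<bar>(\<Sum>a\<leftarrow>as. f a) - (\<Sum>a\<leftarrow>as. g a)\<bar> \<le> real (length as) * e"
  using assms
proof (induction as)
  case (Cons a as)
  then have "\<bar>f a - g a\<bar> \<le> e" "\<bar>(\<Sum>a\<leftarrow>as. f a) - (\<Sum>a\<leftarrow>as. g a)\<bar> \<le> real (length as) * e" by auto
  then show ?case by (simp add: algebra_simps)
qed simp

context sketch
begin

lemma scaled_row_close:
  assumes "i < d"
  shows "\<bar>of_int (scaled_row \<iota> a i) / real D - a $ \<iota> i\<bar> \<le> 1 / real D"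
proof -
  have "\<bar>of_int (scaled_row \<iota> a i) - real D * a $ \<iota> i\<bar> \<le> 1" using assms by (simp add: scaled_row_def) linarith
  moreover have "of_int (scaled_row \<iota> a i) / real D - a $ \<iota> i = (of_int (scaled_row \<iota> a i) - real D * a $ \<iota> i) / real D"
    using D_ge by (simp add: field_simps)
  ultimately show ?thesis using D_ge by (simp add: divide_right_mono)
qed

lemma ramI:
  assumes "X ^ G < 2 ^ w" "\<And>i. \<bar>inp i\<bar> \<le> real \<beta>"
  shows "ram w X G inp"
proof
  show "2 \<le> X" by (rule small_le_X)
  show "\<bar>inp i\<bar> \<le> of_int X" for i using assms(2)[of i] small_le_X(6) by linarith
qed fact

lemma abs_scaled_row_le:
  assumes "\<And>i. \<bar>a $ i\<bar> \<le> real b"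
  shows "\<bar>scaled_row \<iota> a i\<bar> \<le> int (b * D)"
  using abs_floor_mult_le[OF assms, of D "\<iota> i"] by (simp add: scaled_row_def)

text \<open>Each rounded coordinate is off by at most 1/D. Changing the factors of each product one
  at a time moves the inner product by at most \<open>d * (\<beta> + 1) / D\<close>, and the
  Lipschitz bound for the power applies with radius \<open>d * \<beta>\<close>.\<close>

lemma rounding_error:
  fixes a x :: "real ^ 'd::finite"
  assumes "bij_betw \<iota> {..<d} (UNIV :: 'd set)" "1 \<le> real D * \<epsilon>"
    and "\<And>i. \<bar>a $ i\<bar> \<le> real \<beta>" "norm x = 1"
  shows "\<bar>of_int (\<bar>dot d (scaled_row \<iota> a) (scaled_row \<iota> x)\<bar> ^ p) / real D ^ (2 * p) - \<bar>inner a x\<bar> ^ p\<bar>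
    \<le> real p * real (d * \<beta>) ^ p * real (d * (\<beta> + 1)) * \<epsilon>"
proof -
  let ?a = "scaled_row \<iota> a" and ?x = "scaled_row \<iota> x"
  define v where "v = of_int (dot d ?a ?x) / (real D)\<^sup>2"
  have x1: "\<bar>x $ i\<bar> \<le> 1" for i using component_le_norm_cart[of x i] assms(4) by simp
  have D: "0 < real D" using D_ge by simp
  have inner: "inner a x = (\<Sum>j<d. a $ \<iota> j * x $ \<iota> j)"
    using sum.reindex_bij_betw[OF assms(1), of "\<lambda>i. a $ i * x $ i"] by (simp add: inner_vec_def)
  have v: "v = (\<Sum>j<d. (of_int (?a j) / real D) * (of_int (?x j) / real D))"
    by (simp add: v_def dot_def sum_divide_distrib power2_eq_square)
  have xD: "\<bar>of_int (?x j) / real D\<bar> \<le> 1" for j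
  proof -
    have "\<bar>?x j\<bar> \<le> int D" using abs_scaled_row_le[of x 1 \<iota> j] x1 by simp
    then have "\<bar>real_of_int (?x j)\<bar> \<le> real D" by linarith
    then show ?thesis using D by simp
  qed
  have aD: "\<bar>of_int (?a j) / real D\<bar> \<le> real \<beta>" for j
  proof -
    have "\<bar>?a j\<bar> \<le> int (\<beta> * D)" using abs_scaled_row_le[of a \<beta> \<iota> j] assms(3) by simp
    then have "\<bar>real_of_int (?a j)\<bar> \<le> real (\<beta> * D)" by linarith
    then show ?thesis using D by (simp add: pos_divide_le_eq)
  qed
  have sum_le: "\<bar>\<Sum>j<d. f j * h j\<bar> \<le> real (d * \<beta>)" if "\<And>j. \<bar>f j\<bar> \<le> real \<beta>" "\<And>j. \<bar>h j\<bar> \<le> 1" for f h :: "nat \<Rightarrow> real"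
  proof -
    have "\<bar>\<Sum>j<d. f j * h j\<bar> \<le> (\<Sum>j<d. \<bar>f j * h j\<bar>)" by (rule sum_abs)
    also have "\<dots> \<le> (\<Sum>j<d. real \<beta> * 1)" unfolding abs_mult using that by (intro sum_mono mult_mono) auto
    finally show ?thesis by simp
  qed
  have "\<bar>inner a x - v\<bar> \<le> (\<Sum>j<d. \<bar>a $ \<iota> j * x $ \<iota> j - (of_int (?a j) / real D) * (of_int (?x j) / real D)\<bar>)"
    unfolding inner v sum_subtractf[symmetric] by (rule sum_abs)
  also have "\<dots> \<le> (\<Sum>j<d. real (\<beta> + 1) / real D)"
  proof (intro sum_mono)
    fix j assume "j \<in> {..<d}"
    then have j: "j < d" by simp
    define \<alpha> \<xi> where "\<alpha> = of_int (?a j) / real D" and "\<xi> = of_int (?x j) / real D"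
    have "a $ \<iota> j * x $ \<iota> j - \<alpha> * \<xi> = a $ \<iota> j * (x $ \<iota> j - \<xi>) + (a $ \<iota> j - \<alpha>) * \<xi>"
      by (simp add: algebra_simps)
    also have "\<bar>\<dots>\<bar> \<le> \<bar>a $ \<iota> j\<bar> * \<bar>x $ \<iota> j - \<xi>\<bar> + \<bar>a $ \<iota> j - \<alpha>\<bar> * \<bar>\<xi>\<bar>"
      by (metis abs_mult abs_triangle_ineq)
    also have "\<dots> \<le> real \<beta> * (1 / real D) + (1 / real D) * 1"
      using scaled_row_close[OF j, of \<iota> a] scaled_row_close[OF j, of \<iota> x] assms(3) xD[of j]
      by (intro add_mono mult_mono) (auto simp: \<alpha>_def \<xi>_def abs_minus_commute)
    finally show "\<bar>a $ \<iota> j * x $ \<iota> j - \<alpha> * \<xi>\<bar> \<le> real (\<beta> + 1) / real D"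
      by (simp add: add_divide_distrib)
  qed
  also have "\<dots> = real (d * (\<beta> + 1)) * (1 / real D)" by (simp add: algebra_simps add_divide_distrib)
  also have "\<dots> \<le> real (d * (\<beta> + 1)) * \<epsilon>"
    using assms(2) D by (intro mult_left_mono) (auto simp: pos_divide_le_eq mult.commute)
  finally have uv: "\<bar>inner a x - v\<bar> \<le> real (d * (\<beta> + 1)) * \<epsilon>" .
  have R: "1 \<le> real (d * \<beta>)"
  proof -
    have "1 \<le> d * \<beta>" using d_ge \<beta>_ge by simp
    then show ?thesis by (metis of_nat_1 of_nat_le_iff)
  qed
  have "\<bar>\<bar>inner a x\<bar> ^ p - \<bar>v\<bar> ^ p\<bar> \<le> real (d * \<beta>) ^ p * (real p * \<bar>inner a x - v\<bar>)"
    using sum_le[of "\<lambda>j. a $ \<iota> j" "\<lambda>j. x $ \<iota> j"] sum_le[OF aD xD] assms(3) x1 R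
    by (intro abs_power_diff_le) (auto simp: inner v)
  also have "\<dots> \<le> real (d * \<beta>) ^ p * (real p * (real (d * (\<beta> + 1)) * \<epsilon>))"
    using uv by (intro mult_left_mono) auto
  finally have "\<bar>\<bar>v\<bar> ^ p - \<bar>inner a x\<bar> ^ p\<bar> \<le> real p * real (d * \<beta>) ^ p * real (d * (\<beta> + 1)) * \<epsilon>"
    by (simp add: abs_minus_commute mult_ac)
  moreover have "of_int (\<bar>dot d ?a ?x\<bar> ^ p) / real D ^ (2 * p) = \<bar>v\<bar> ^ p"
    by (simp add: v_def power_divide power_mult)
  ultimately show ?thesis by simp
qed

text \<open>The first term comes from sampling, the second from rounding.\<close>

definition err :: real where
  "err = 5 * (2 * real (d * \<beta>)) ^ p + real p * real (d * \<beta>) ^ p * real (d * (\<beta> + 1))"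

lemma total_error:
  fixes as :: "(real ^ 'd::finite) list"
  assumes "bij_betw \<iota> {..<d} (UNIV :: 'd set)" "1 \<le> real D * \<epsilon>" "as \<noteq> []"
    and "\<And>a i. a \<in> set as \<Longrightarrow> \<bar>a $ i\<bar> \<le> real \<beta>" "norm x = 1"
    and "\<bar>deviation (\<lambda>b. of_int (correction (map (scaled_row \<iota>) as) (scaled_row \<iota> x) b)) (map (scaled_row \<iota>) as) m\<bar> \<le>
      5 * (2 * real (d * \<beta>)) ^ p * \<epsilon> * (real (length as) * real D ^ (2 * p))"
  shows "\<bar>of_int (\<Sum>c<C. summand (map (scaled_row \<iota>) as) (scaled_row \<iota> x) m c) / of_int (int (length as * D ^ (2 * p)))
    - 1 / real (length as) * lp_pow p as x\<bar> \<le> err * \<epsilon>"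
proof -
  let ?N = "real (length as)" and ?E = "real D ^ (2 * p)"
  let ?dev = "deviation (\<lambda>b. of_int (correction (map (scaled_row \<iota>) as) (scaled_row \<iota> x) b)) (map (scaled_row \<iota>) as) m"
  let ?f = "\<lambda>a. of_int (\<bar>dot d (scaled_row \<iota> a) (scaled_row \<iota> x)\<bar> ^ p) / ?E"
  let ?K = "real p * real (d * \<beta>) ^ p * real (d * (\<beta> + 1)) * \<epsilon>"
  have N: "0 < ?N" using assms(3) by simp
  have E: "0 < ?E" using D_ge by simp
  have "real_of_int (\<Sum>a\<leftarrow>cs. \<bar>dot d (scaled_row \<iota> a) (scaled_row \<iota> x)\<bar> ^ p) = (\<Sum>a\<leftarrow>cs. ?f a) * ?E" for cs
    using E by (induction cs) (simp_all add: distrib_right)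
  then have "real_of_int (\<Sum>c<C. summand (map (scaled_row \<iota>) as) (scaled_row \<iota> x) m c) = (\<Sum>a\<leftarrow>as. ?f a) * ?E + ?dev"
    unfolding sum_summand by (simp add: o_def)
  moreover have "of_int (int (length as * D ^ (2 * p))) = ?N * ?E" by simp
  ultimately have eq: "of_int (\<Sum>c<C. summand (map (scaled_row \<iota>) as) (scaled_row \<iota> x) m c) / of_int (int (length as * D ^ (2 * p)))
      - 1 / ?N * lp_pow p as x = ((\<Sum>a\<leftarrow>as. ?f a) - lp_pow p as x) / ?N + ?dev / (?N * ?E)"
    using N E by (simp only: add_divide_distrib diff_divide_distrib) (simp add: field_simps)
  have "\<bar>((\<Sum>a\<leftarrow>as. ?f a) - lp_pow p as x) / ?N + ?dev / (?N * ?E)\<bar> \<le>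
      \<bar>(\<Sum>a\<leftarrow>as. ?f a) - lp_pow p as x\<bar> / ?N + \<bar>?dev\<bar> / (?N * ?E)"
    using N E by (intro order_trans[OF abs_triangle_ineq]) (simp add: abs_mult)
  also have "\<dots> \<le> (?N * ?K) / ?N + (5 * (2 * real (d * \<beta>)) ^ p * \<epsilon> * (?N * ?E)) / (?N * ?E)"
  proof (intro add_mono divide_right_mono)
    show "\<bar>(\<Sum>a\<leftarrow>as. ?f a) - lp_pow p as x\<bar> \<le> ?N * ?K"
      unfolding lp_pow_def using rounding_error[OF assms(1,2) assms(4) assms(5)]
      by (intro abs_sum_list_diff_le) auto
  qed (use N E assms(6) in auto)
  also have "(?N * ?K) / ?N = ?K" using N by (intro nonzero_mult_div_cancel_left) simp
  also have "(5 * (2 * real (d * \<beta>)) ^ p * \<epsilon> * (?N * ?E)) / (?N * ?E) = 5 * (2 * real (d * \<beta>)) ^ p * \<epsilon>"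
    using N E by (intro nonzero_mult_div_cancel_right) (metis mult_pos_pos less_irrefl)
  also have "?K + 5 * (2 * real (d * \<beta>)) ^ p * \<epsilon> = err * \<epsilon>" by (simp add: err_def algebra_simps)
  finally show ?thesis unfolding eq .
qed

lemma sketch_correct:
  fixes as :: "(real ^ 'd::finite) list" and \<iota> :: "nat \<Rightarrow> 'd"
  assumes "bij_betw \<iota> {..<d} UNIV" "0 < \<epsilon>" "\<epsilon> < 1" "1 \<le> real D * \<epsilon>" "(real D - 1) * \<epsilon> < 1"
    and k: "D\<^sup>2 \<le> k ^ (d + 2 * p - 1)" "\<And>j. 1 \<le> j \<Longrightarrow> j < k \<Longrightarrow> j ^ (d + 2 * p - 1) < D\<^sup>2"
    and n: "n = length as" and row_le: "\<And>a i. a \<in> set as \<Longrightarrow> \<bar>a $ i\<bar> \<le> real \<beta>"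
    and G: "X ^ G < 2 ^ w" "com_deg (init_com d p) \<le> G" "com_deg (upd_com d p \<iota>) \<le> G"
      "com_deg (query_com d p \<iota>) \<le> G"
  shows "\<exists>t. halts_within w s (\<lambda>_. \<epsilon>) (init_com d p) (\<lambda>_. 0) t"
    and "\<lbrakk>i < length as; Some m \<in> set_pmf (stream_state w s \<epsilon> (init_com d p) (upd_com d p \<iota>) (take i as))\<rbrakk>
      \<Longrightarrow> halts_within w s (\<lambda>j. (as ! i) $ j) (upd_com d p \<iota>) m (straight_time (upd_com d p \<iota>))"
    and "\<lbrakk>norm x = 1; Some m \<in> set_pmf (stream_state w s \<epsilon> (init_com d p) (upd_com d p \<iota>) as)\<rbrakk>
      \<Longrightarrow> \<exists>t. halts_within w s (\<lambda>j. x $ j) (query_com d p \<iota>) m t"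
    and "norm x = 1 \<Longrightarrow> 9 / 10 \<le> measure_pmf.prob
      (query_result w s (stream_state w s \<epsilon> (init_com d p) (upd_com d p \<iota>) as) (query_com d p \<iota>) x)
      {Some q | q. \<bar>q - 1 / real (length as) * lp_pow p as x\<bar> \<le> err * \<epsilon>}"
proof -
  have ram_init: "ram w X G (\<lambda>_ :: unit. \<epsilon>)" using \<beta>_ge assms(2,3) by (intro ramI[OF G(1)]) simp
  have ram_row: "ram w X G (\<lambda>i. a $ i)" if "a \<in> set as" for a
    using row_le[OF that] by (rule ramI[OF G(1)])
  have init: "\<exists>m t. ram.bigstep w s (\<lambda>_ :: unit. \<epsilon>) (init_com d p) (\<lambda>_. 0) (return_pmf m) t \<and> state [] m"
    using bigstep_init_com[OF ram_init assms(2,4,5) k G(2)] .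
  then show "\<exists>t. halts_within w s (\<lambda>_. \<epsilon>) (init_com d p) (\<lambda>_. 0) t"
    using ram.bigstep_halts[OF ram_init] by blast
  \<comment> \<open>Prefixes are covered as well, since every single update has to be fault-free and
    timed.\<close>
  have inv: "\<exists>M. stream_state w s \<epsilon> (init_com d p) (upd_com d p \<iota>) cs = map_pmf Some M \<and> finite (set_pmf M) \<and>
      (\<forall>m \<in> set_pmf M. state (map (scaled_row \<iota>) cs) m) \<and>
      (\<forall>g \<Gamma>. (\<forall>v \<in> insert (\<lambda>_. 0) (set (map (scaled_row \<iota>) cs)). 0 \<le> g v \<and> g v \<le> \<Gamma>) \<longrightarrow>
        measure_pmf.expectation M (\<lambda>m. (deviation g (map (scaled_row \<iota>) cs) m)\<^sup>2) \<le>
          \<Gamma>\<^sup>2 * (\<Sum>i<length cs. real (i div C)))"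
    if "set cs \<subseteq> set as" "length cs \<le> length as" for cs
    using that ram_row row_le n by (intro stream_invariant[OF init ram_init _ _ _ G(3)]) auto
  have bounded_vec: "bounded_vec (scaled_row \<iota> a)" if "a \<in> set as" for a
    using abs_scaled_row_le[of a \<beta> \<iota>] row_le[OF that] by (simp add: bounded_vec_def) (simp add: scaled_row_def)
  show "halts_within w s (\<lambda>j. (as ! i) $ j) (upd_com d p \<iota>) m (straight_time (upd_com d p \<iota>))"
    if i: "i < length as" and m: "Some m \<in> set_pmf (stream_state w s \<epsilon> (init_com d p) (upd_com d p \<iota>) (take i as))"
  proof -
    have a: "as ! i \<in> set as" using i by simp
    interpret A: sketch_ram d p D k C n \<beta> s X w G "\<lambda>j. (as ! i) $ j" \<iota>
      using ram_row[OF a] sketch_axioms by (intro sketch_ram.intro)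
    have iv: "A.input_vec = scaled_row \<iota> (as ! i)" by (simp add: A.input_vec_def scaled_row_def)
    have "state (map (scaled_row \<iota>) (take i as)) m"
      using inv[of "take i as"] m set_take_subset[of i as] by auto
    then have "A.bigstep (upd_com d p \<iota>) m
      (map_pmf (upd_mem (scaled_row \<iota> (as ! i)) m) (pmf_of_set {0..<int (length (map (scaled_row \<iota>) (take i as)) div C) + 1}))
      (straight_time (upd_com d p \<iota>))"
      unfolding iv[symmetric]
    proof (rule A.bigstep_upd_com)
      show "bounded_vec b" if "b \<in> set (map (scaled_row \<iota>) (take i as))" for b
        using that bounded_vec set_take_subset[of i as] by auto
    qed (use i n bounded_vec[OF a] G(3) iv in auto)
    then show ?thesis by (rule A.bigstep_halts)
  qed
  obtain M where M: "stream_state w s \<epsilon> (init_com d p) (upd_com d p \<iota>) as = map_pmf Some M" "finite (set_pmf M)"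
    "\<And>m. m \<in> set_pmf M \<Longrightarrow> state (map (scaled_row \<iota>) as) m"
    "\<And>g \<Gamma>. (\<forall>v \<in> insert (\<lambda>_. 0) (set (map (scaled_row \<iota>) as)). 0 \<le> g v \<and> g v \<le> \<Gamma>) \<Longrightarrow>
        measure_pmf.expectation M (\<lambda>m. (deviation g (map (scaled_row \<iota>) as) m)\<^sup>2) \<le>
          \<Gamma>\<^sup>2 * (\<Sum>i<length as. real (i div C))"
    using inv[of as] by auto
  have query: "ram w X G (\<lambda>j. x $ j) \<and> (\<exists>m' t. ram.bigstep w s (\<lambda>j. x $ j) (query_com d p \<iota>) m (return_pmf m') t \<and>
      m' 0 = (\<Sum>c<C. summand (map (scaled_row \<iota>) as) (scaled_row \<iota> x) m c) \<and> m' 1 = int (length as * D ^ (2 * p)))"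
    if x: "norm x = 1" and m: "m \<in> set_pmf M" for x m
  proof -
    have x1: "\<bar>x $ j\<bar> \<le> 1" for j using component_le_norm_cart[of x j] x by simp
    have x\<beta>: "\<bar>x $ j\<bar> \<le> real \<beta>" for j using x1[of j] \<beta>_ge by linarith
    have r: "ram w X G (\<lambda>j. x $ j)" using x\<beta> by (rule ramI[OF G(1)])
    then interpret A: sketch_ram d p D k C n \<beta> s X w G "\<lambda>j. x $ j" \<iota>
      using sketch_axioms by (intro sketch_ram.intro)
    have iv: "A.input_vec = scaled_row \<iota> x" by (simp add: A.input_vec_def scaled_row_def)
    have "\<And>b. b \<in> set (map (scaled_row \<iota>) as) \<Longrightarrow> bounded_vec b" using bounded_vec by auto
    from A.bigstep_query_com[OF M(3)[OF m] this _ x1 G(4)] r n show ?thesis by (simp add: iv)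
  qed
  show "\<exists>t. halts_within w s (\<lambda>j. x $ j) (query_com d p \<iota>) m t"
    if "norm x = 1" "Some m \<in> set_pmf (stream_state w s \<epsilon> (init_com d p) (upd_com d p \<iota>) as)"
  proof -
    have "m \<in> set_pmf M" using that(2) M(1) by auto
    from query[OF that(1) this] show ?thesis using ram.bigstep_halts by blast
  qed
  show "9 / 10 \<le> measure_pmf.prob
      (query_result w s (stream_state w s \<epsilon> (init_com d p) (upd_com d p \<iota>) as) (query_com d p \<iota>) x)
      {Some q | q. \<bar>q - 1 / real (length as) * lp_pow p as x\<bar> \<le> err * \<epsilon>}"
    if x: "norm x = 1"
  proof -
    let ?bs = "map (scaled_row \<iota>) as"
    define Q where "Q m = of_int (\<Sum>c<C. summand ?bs (scaled_row \<iota> x) m c) / real_of_int (int (length as * D ^ (2 * p)))" for m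
    have "query_result w s (stream_state w s \<epsilon> (init_com d p) (upd_com d p \<iota>) as) (query_com d p \<iota>) x =
        bind_pmf M (\<lambda>m. map_pmf (map_option answer) (exec w s (\<lambda>j. x $ j) (query_com d p \<iota>) m))"
      by (simp add: query_result_def M(1) bind_exec_def bind_map_pmf map_bind_pmf)
    \<comment> \<open>The query draws nothing, so its answer is a function of the memory and the
      bound on the deviation carries over pointwise.\<close>
    also have "\<dots> = bind_pmf M (\<lambda>m. return_pmf (Some (Q m)))"
    proof (intro bind_pmf_cong refl)
      fix m assume "m \<in> set_pmf M"
      from query[OF x this] obtain m' t where m': "ram w X G (\<lambda>j. x $ j)"
        "ram.bigstep w s (\<lambda>j. x $ j) (query_com d p \<iota>) m (return_pmf m') t"
        "m' 0 = (\<Sum>c<C. summand ?bs (scaled_row \<iota> x) m c)" "m' 1 = int (length as * D ^ (2 * p))" by blast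
      have "answer m' = Q m" unfolding answer_def Q_def m'(3,4) ..
      with ram.bigstep_exec[OF m'(1,2)]
      show "map_pmf (map_option answer) (exec w s (\<lambda>j. x $ j) (query_com d p \<iota>) m) = return_pmf (Some (Q m))"
        by simp
    qed
    also have "\<dots> = map_pmf (\<lambda>m. Some (Q m)) M" by (simp add: map_pmf_def)
    finally have qr: "query_result w s (stream_state w s \<epsilon> (init_com d p) (upd_com d p \<iota>) as) (query_com d p \<iota>) x =
        map_pmf (\<lambda>m. Some (Q m)) M" .
    have ne: "as \<noteq> []" using n n_ge by auto
    have x1: "\<bar>x $ j\<bar> \<le> real 1" for j using component_le_norm_cart[of x j] x by simp
    have "9 / 10 \<le> measure_pmf.prob M {m. \<bar>deviation (\<lambda>b. of_int (correction ?bs (scaled_row \<iota> x) b)) ?bs m\<bar> \<le>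
        5 * (2 * real (d * \<beta>)) ^ p * \<epsilon> * (real (length ?bs) * real D ^ (2 * p))}"
    proof (rule prob_deviation[OF M(2) k(1) assms(2,4)])
      show "bounded_vec b" if "b \<in> set ?bs" for b using that bounded_vec by auto
      show "\<bar>scaled_row \<iota> x i\<bar> \<le> int D" for i using abs_scaled_row_le[OF x1, of \<iota> i] by simp
      show "measure_pmf.expectation M (\<lambda>m. (deviation g ?bs m)\<^sup>2) \<le> \<Gamma>\<^sup>2 * (\<Sum>i<length ?bs. real (i div C))"
        if "\<forall>v \<in> insert (\<lambda>_. 0) (set ?bs). 0 \<le> g v \<and> g v \<le> \<Gamma>" for g \<Gamma>
        using M(4)[OF that] by simp
    qed (use ne in simp)
    also have "\<dots> \<le> measure_pmf.prob M {m. \<bar>Q m - 1 / real (length as) * lp_pow p as x\<bar> \<le> err * \<epsilon>}"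
      unfolding Q_def
      by (intro measure_pmf.finite_measure_mono subsetI)
        (use total_error[OF assms(1,4) ne row_le x] in auto)
    also have "\<dots> = measure_pmf.prob (map_pmf (\<lambda>m. Some (Q m)) M)
        {Some q | q. \<bar>q - 1 / real (length as) * lp_pow p as x\<bar> \<le> err * \<epsilon>}"
      by (simp add: vimage_def)
    finally show ?thesis unfolding qr .
  qed
qed

end

text \<open>Absorbs constants into powers of \<open>Y\<close> when the word length is
  estimated.\<close>

lemma real_le_power_of_ge_2:
  fixes Y :: real
  assumes "2 \<le> Y"
  shows "real c \<le> Y ^ c"
proof -
  have "real c \<le> 2 ^ c" by (metis less_exp less_imp_le of_nat_le_iff of_nat_numeral of_nat_power)
  also have "\<dots> \<le> Y ^ c" using assms by (intro power_mono) auto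
  finally show ?thesis .
qed

text \<open>The crude bound \<open>k \<le> D\<^sup>2\<close> serves the word length only; the space
  bound rests on minimality.\<close>

lemma resolution_exists:
  fixes D q :: nat
  assumes "1 \<le> D" "1 \<le> q"
  obtains k where "1 \<le> k" "D\<^sup>2 \<le> k ^ q" "\<And>j. 1 \<le> j \<Longrightarrow> j < k \<Longrightarrow> j ^ q < D\<^sup>2" "k \<le> D\<^sup>2"
proof -
  let ?k = "LEAST k. D\<^sup>2 \<le> k ^ q"
  have D2: "D\<^sup>2 \<le> (D\<^sup>2) ^ q" using assms by (intro self_le_power) auto
  have k: "D\<^sup>2 \<le> ?k ^ q" using D2 by (rule LeastI)
  have "?k \<noteq> 0"
  proof
    assume "?k = 0"
    from k[unfolded this] show False using assms by (simp add: power_0_left)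
  qed
  moreover have "j ^ q < D\<^sup>2" if "j < ?k" for j using not_less_Least[OF that] by simp
  ultimately show thesis using k Least_le[of "\<lambda>k. D\<^sup>2 \<le> k ^ q", OF D2] by (intro that[of ?k]) auto
qed

text \<open>With z the power of \<open>\<epsilon>\<close>, minimality at \<open>k - 1\<close> gives
  k - 1 < 4 z, and z \<ge> 1 pays for the missing 2, so k + 1 \<le> 6 z. For \<open>k = 1\<close>
  minimality says nothing, but 2 \<le> 6 z.\<close>

lemma resolution_bound:
  fixes \<epsilon> :: real and k D q :: nat
  assumes "0 < \<epsilon>" "\<epsilon> < 1" "real D \<le> 2 / \<epsilon>" "1 \<le> k" "1 \<le> q"
    and "\<And>j. 1 \<le> j \<Longrightarrow> j < k \<Longrightarrow> j ^ q < D\<^sup>2"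
  shows "real (k + 1) \<le> 6 * \<epsilon> powr (- (2 / real q))"
proof -
  let ?z = "\<epsilon> powr (- (2 / real q))"
  have z: "1 \<le> ?z" using assms(1,2) powr_mono'[of "- (2 / real q)" 0 \<epsilon>] by simp
  show ?thesis
  proof (cases "k = 1")
    case True
    with z show ?thesis by simp
  next
    case False
    then have k2: "1 \<le> k - 1" "k - 1 < k" using assms(4) by auto
    have "real (k - 1) ^ q < (real D)\<^sup>2" using assms(6)[OF k2] by (metis of_nat_less_iff of_nat_power)
    also have "\<dots> \<le> (2 / \<epsilon>)\<^sup>2" using assms(3) by (intro power_mono) auto
    also have "\<dots> = 4 * \<epsilon> powr (- 2)" using assms(1) by (simp add: power_divide powr_minus_divide)
    also have "\<dots> \<le> 4 ^ q * \<epsilon> powr (- 2)"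
      using assms(5) by (intro mult_right_mono self_le_power) auto
    also have "\<epsilon> powr (- 2) = ?z ^ q"
      using assms(1,5) by (simp add: powr_realpow[symmetric] powr_powr)
    also have "4 ^ q * ?z ^ q = (4 * ?z) ^ q" by (simp add: power_mult_distrib)
    finally have "real (k - 1) < 4 * ?z" by (rule power_less_imp_less_base) simp
    with z assms(4) show ?thesis by (simp add: of_nat_diff)
  qed
qed

theorem theorem4p12:
  fixes p :: nat and B :: real
  assumes "CARD('d::finite) \<ge> 2" and "p \<ge> 1" and "B > 0"
  shows "\<exists>(init :: unit com) (upd :: 'd com) (qry :: 'd com)
           (K_word :: real) (K_space :: real) (K_err :: real) (T :: nat).
    draw_free qry \<and>
    (\<forall>(\<epsilon> :: real) (as :: (real ^ 'd) list) (w :: nat) (s :: nat).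
       0 < \<epsilon> \<and> \<epsilon> < 1 \<and> as \<noteq> [] \<and> (\<forall>a \<in> set as. norm a \<le> B) \<and>
       real w \<ge> K_word * log 2 (2 * real (length as) / \<epsilon>) \<and>
       s = nat \<lfloor>K_space * \<epsilon> powr (- (2 * (real CARD('d) - 1) / (real CARD('d) + 2 * real p - 1)))\<rfloor>
       \<longrightarrow>
       (\<exists>t. halts_within w s (\<lambda>_. \<epsilon>) init (\<lambda>_. 0) t) \<and>
       (\<forall>i < length as. \<forall>m. Some m \<in> set_pmf (stream_state w s \<epsilon> init upd (take i as)) \<longrightarrow>
          halts_within w s (\<lambda>j. (as ! i) $ j) upd m T) \<and>
       (\<forall>x :: real ^ 'd. norm x = 1 \<longrightarrow>
          (\<forall>m. Some m \<in> set_pmf (stream_state w s \<epsilon> init upd as) \<longrightarrow>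
             (\<exists>t. halts_within w s (\<lambda>j. x $ j) qry m t)) \<and>
          measure_pmf.prob (query_result w s (stream_state w s \<epsilon> init upd as) qry x)
            {Some q | q. \<bar>q - 1 / real (length as) * lp_pow p as x\<bar> \<le> K_err * \<epsilon>} \<ge> 9 / 10))"
proof -
  define d where "d = CARD('d)"
  define \<beta> where "\<beta> = nat \<lceil>B\<rceil>"
  obtain \<iota> :: "nat \<Rightarrow> 'd" where \<iota>: "bij_betw \<iota> {..<d} UNIV"
    using ex_bij_betw_nat_finite[of "UNIV :: 'd set"] by (auto simp: d_def atLeast0LessThan)
  have d: "2 \<le> d" using assms(1) by (simp add: d_def)
  have \<beta>: "1 \<le> \<beta>" "B \<le> real \<beta>" using assms(3) by (auto simp: \<beta>_def) linarith
  define q where "q = d + 2 * p - 1"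
  define G where "G = com_deg (init_com d p) + com_deg (upd_com d p \<iota>) + com_deg (query_com d p \<iota>)"
  \<comment> \<open>Exponents bounding the factors of \<open>X\<close> by powers of
    \<open>Y = 2 * n / \<epsilon>\<close>, which is at least 2: \<open>3 \<le> Y ^ 3\<close>, then
    \<open>2 * d \<le> Y ^ (2 * d)\<close> and \<open>k + 1 \<le> Y ^ 3\<close> inside
    \<open>C\<close>, then \<open>n \<le> Y\<close>, and finally
    \<open>d * \<beta> \<le> Y ^ (d * \<beta>)\<close> and \<open>D\<^sup>2 \<le> Y\<^sup>2\<close>
    under the power \<open>p\<close>.\<close>
  define g where "g = 3 + (2 * d + 3 * (d - 1)) + 1 + (d * \<beta> + 2) * p"
  \<comment> \<open>Nine header cells, absorbed because the power of \<open>\<epsilon>\<close> is at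
    least 1, and \<open>C\<close> records; \<open>6 ^ (d - 1)\<close> comes from the bound on
    \<open>k + 1\<close>.\<close>
  define K_space where "K_space = 9 + 2 * real d * 6 ^ (d - 1) * real (stride d p)"
  have q: "1 \<le> q" "real q = real d + 2 * real p - 1" using d by (simp_all add: q_def of_nat_diff)
  have main:
    "(\<exists>t. halts_within w s (\<lambda>_. \<epsilon>) (init_com d p) (\<lambda>_. 0) t) \<and>
     (\<forall>i < length as. \<forall>m. Some m \<in> set_pmf (stream_state w s \<epsilon> (init_com d p) (upd_com d p \<iota>) (take i as)) \<longrightarrow>
        halts_within w s (\<lambda>j. (as ! i) $ j) (upd_com d p \<iota>) m (straight_time (upd_com d p \<iota>))) \<and>
     (\<forall>x :: real ^ 'd. norm x = 1 \<longrightarrow>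
        (\<forall>m. Some m \<in> set_pmf (stream_state w s \<epsilon> (init_com d p) (upd_com d p \<iota>) as) \<longrightarrow>
           (\<exists>t. halts_within w s (\<lambda>j. x $ j) (query_com d p \<iota>) m t)) \<and>
        measure_pmf.prob (query_result w s (stream_state w s \<epsilon> (init_com d p) (upd_com d p \<iota>) as) (query_com d p \<iota>) x)
          {Some q | q. \<bar>q - 1 / real (length as) * lp_pow p as x\<bar> \<le> sketch.err d p \<beta> * \<epsilon>} \<ge> 9 / 10)"
    if \<epsilon>: "0 < \<epsilon>" "\<epsilon> < 1" and ne: "as \<noteq> []" and rows: "\<forall>a \<in> set as. norm a \<le> B"
      and w: "real w \<ge> (real (g * G) + 1) * log 2 (2 * real (length as) / \<epsilon>)"
      and s: "s = nat \<lfloor>K_space * \<epsilon> powr (- (2 * (real CARD('d) - 1) / (real CARD('d) + 2 * real p - 1)))\<rfloor>"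
    for \<epsilon> :: real and as :: "(real ^ 'd) list" and w s :: nat
  proof -
    define D where "D = nat \<lceil>1 / \<epsilon>\<rceil>"
    have e1: "1 < 1 / \<epsilon>" using \<epsilon> by simp
    have Dr: "1 / \<epsilon> \<le> real D" "real D - 1 < 1 / \<epsilon>" using e1 by (simp_all add: D_def) linarith+
    have D: "1 \<le> D" using Dr(1) e1 by linarith
    have De: "1 \<le> real D * \<epsilon>" "(real D - 1) * \<epsilon> < 1"
      using Dr \<epsilon> by (simp_all add: field_simps)
    have D2: "real D \<le> 2 / \<epsilon>" using Dr(2) e1 by (simp add: field_simps)
    obtain k where k: "1 \<le> k" "D\<^sup>2 \<le> k ^ q" "\<And>j. 1 \<le> j \<Longrightarrow> j < k \<Longrightarrow> j ^ q < D\<^sup>2" "k \<le> D\<^sup>2"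
      by (rule resolution_exists[OF D q(1)]) blast
    define C where "C = 2 * d * (k + 1) ^ (d - 1)"
    define n where "n = length as"
    have n: "1 \<le> n" using ne by (simp add: n_def Suc_leI)
    define X where "X = int (3 * C * n * (d * \<beta> * D\<^sup>2) ^ p)"
    let ?z = "\<epsilon> powr (- (2 * (real d - 1) / real q))"
    have z1: "1 \<le> ?z" using \<epsilon> d powr_mono'[of "- (2 * (real d - 1) / real q)" 0 \<epsilon>] by simp
    have "real C = 2 * real d * real (k + 1) ^ (d - 1)" by (simp add: C_def)
    also have "\<dots> \<le> 2 * real d * (6 * \<epsilon> powr (- (2 / real q))) ^ (d - 1)"
      using resolution_bound[OF \<epsilon> D2 k(1) q(1) k(3)] by (intro mult_left_mono power_mono) auto
    also have "(6 * \<epsilon> powr (- (2 / real q))) ^ (d - 1) = 6 ^ (d - 1) * ?z"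
    proof -
      have "(\<epsilon> powr (- (2 / real q))) ^ (d - 1) = \<epsilon> powr (- (2 / real q) * real (d - 1))"
        using \<epsilon> by (simp add: powr_realpow[symmetric] powr_powr)
      also have "- (2 / real q) * real (d - 1) = - (2 * (real d - 1) / real q)"
        using d by (simp add: of_nat_diff)
      finally show ?thesis by (simp add: power_mult_distrib)
    qed
    finally have "real C * real (stride d p) \<le> (2 * real d * (6 ^ (d - 1) * ?z)) * real (stride d p)"
      by (intro mult_right_mono) auto
    with z1 have "real (9 + C * stride d p) \<le> K_space * ?z" by (simp add: K_space_def algebra_simps)
    then have s_ge: "9 + C * stride d p \<le> s"
      unfolding s d_def[symmetric] q(2)[symmetric] by (simp add: le_nat_floor)
    interpret sketch d p D k C n \<beta> s X
      by unfold_locales (use d assms(2) D k(1) n \<beta>(1) s_ge in \<open>simp_all add: C_def X_def\<close>)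
    define Y where "Y = 2 * real (length as) / \<epsilon>"
    have n_real: "1 \<le> real (length as)" using n by (simp add: n_def)
    have "2 / \<epsilon> \<le> Y" using n_real \<epsilon> by (simp add: Y_def divide_right_mono)
    then have Y: "2 \<le> Y" "real D \<le> Y" using D2 e1 by linarith+
    have nY: "real n \<le> Y"
    proof -
      have "real n * 1 \<le> real n * (2 / \<epsilon>)" using e1 by (intro mult_left_mono) auto
      then show ?thesis by (simp add: Y_def n_def mult.commute)
    qed
    have DY: "(real D)\<^sup>2 \<le> Y\<^sup>2" using Y by (intro power_mono) auto
    have kY: "real (k + 1) \<le> Y ^ 3"
    proof -
      have "1 \<le> D\<^sup>2" using D by simp
      then have "k + 1 \<le> 2 * D\<^sup>2" using k(4) by linarith
      then have "real (k + 1) \<le> real (2 * D\<^sup>2)" by (simp only: of_nat_le_iff)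
      also have "\<dots> = 2 * (real D)\<^sup>2" by simp
      also have "\<dots> \<le> Y * Y\<^sup>2" using Y DY by (intro mult_mono) auto
      finally show ?thesis by (simp add: power2_eq_square power3_eq_cube)
    qed
    have "real_of_int X = real 3 * (real (2 * d) * real (k + 1) ^ (d - 1)) * real n * (real (d * \<beta>) * (real D)\<^sup>2) ^ p"
      by (simp add: X_def C_def)
    also have "\<dots> \<le> Y ^ 3 * (Y ^ (2 * d) * (Y ^ 3) ^ (d - 1)) * Y * (Y ^ (d * \<beta>) * Y\<^sup>2) ^ p"
      using Y(1) nY DY kY real_le_power_of_ge_2[OF Y(1)] real_le_power_of_ge_2[OF Y(1), of 3]
      by (intro mult_mono power_mono mult_nonneg_nonneg zero_le_power) (auto simp del: of_nat_mult)
    also have "\<dots> = Y ^ g"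
      by (simp only: g_def power_add power_mult power_one_right)
    finally have XY: "real_of_int X \<le> Y ^ g" .
    have "real_of_int (X ^ G) \<le> (Y ^ g) ^ G"
      using XY small_le_X(1) by (simp add: power_mono)
    \<comment> \<open>The additional factor \<open>Y\<close> makes the inequality strict; hence the
      \<open>+ 1\<close> in the constant for the word length.\<close>
    also have "\<dots> < Y ^ (g * G + 1)"
      unfolding power_mult[symmetric] using Y(1) by (intro power_strict_increasing) auto
    also have "\<dots> = Y powr real (g * G + 1)" using Y(1) by (subst powr_realpow) auto
    also have "\<dots> = (2 powr log 2 Y) powr real (g * G + 1)" using Y(1) by simp
    also have "\<dots> = 2 powr (real (g * G + 1) * log 2 Y)" by (simp only: powr_powr mult.commute)
    also have "\<dots> \<le> 2 powr real w"
      using w by (intro powr_mono) (simp_all add: Y_def add.commute)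
    also have "\<dots> = 2 ^ w" by (simp add: powr_realpow)
    finally have XG: "X ^ G < 2 ^ w" by (metis of_int_less_iff of_int_numeral of_int_power)
    have coord: "\<bar>a $ i\<bar> \<le> real \<beta>" if "a \<in> set as" for a i
      using component_le_norm_cart[of a i] rows that \<beta>(2) by force
    note correct = sketch_correct[OF \<iota> \<epsilon> De k(2,3)[unfolded q_def] n_def coord XG]
    show ?thesis using correct by (simp add: G_def)
  qed
  show ?thesis
    by (rule exI[of _ "init_com d p"], rule exI[of _ "upd_com d p \<iota>"], rule exI[of _ "query_com d p \<iota>"],
        rule exI[of _ "real (g * G) + 1"], rule exI[of _ K_space], rule exI[of _ "sketch.err d p \<beta>"],
        rule exI[of _ "straight_time (upd_com d p \<iota>)"], rule conjI[OF draw_free_query_com],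
        intro allI impI, elim conjE, rule main)
qed

end
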